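(* Let $(\alpha,\beta)$ be an s-malleable deformation of tracial von Neumann algebras $M\subseteq\widetilde M$. Then for any $Q_1,Q_2\in\mathrm{Rig}(\alpha)$ with $(Q_1\cap Q_2)'\cap\widetilde M\subseteq M$, and any $t\in\mathbb R$, we have $$\epsilon_{2t}(Q_1\vee Q_2)\le 24\,\epsilon_t(Q_1).$$
   Context: A tracial von Neumann algebra $(M,\tau)$ is a von Neumann algebra with a faithful normal tracial state $\tau$; $\|x\|_2=\tau(x^*x)^{1/2}$. Inclusions $M\subseteq\widetilde M$ of tracial von Neumann algebras are unital and trace-preserving; von Neumann subalgebras $Q\leq M$ are unital. $(Q)_1$ is the (operator norm) unit ball of $Q$; $Q_1\vee Q_2$ is the von Neumann subalgebra generated by $Q_1\cup Q_2$. $\mathrm{Aut}(\widetilde M)$ is the group of trace-preserving $*$-automorphisms of $\widetilde M$. An s-malleable deformation $(\alpha,\beta)$ of $M$ inside $\widetilde M$ consists of an action (group homomorphism) $\alpha:\mathbb R\to\mathrm{Aut}(\widetilde M)$ with $\|\alpha_t(x)-x\|_2\to0$ as $t\to0$ for each $x\in\widetilde M$, together with $\beta\in\mathrm{Aut}(\widetilde M)$ satisfying $\beta|_M=\mathrm{id}$, $\beta^2=\mathrm{id}$ and $\beta\alpha_t=\alpha_{-t}\beta$ for all $t\in\mathbb R$. For a von Neumann subalgebra $Q\leq M$ put $\epsilon_t(Q)=\sup_{x\in(Q)_1}\|\alpha_t(x)-x\|_2$. $Q$ is $\alpha$-rigid if $\epsilon_t(Q)\to0$ as $t\to0$. $\mathrm{Rig}(\alpha)$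 is the collection of all $\alpha$-rigid von Neumann subalgebras of $M$. *)

theory Defs
  imports "HOL-Analysis.Analysis"
begin

text \<open>
  Complex Hilbert spaces. They extend the library's real inner product spaces, with
  \<open>x \<bullet> y = Re \<langle>x, y\<rangle>\<close>, so that norm and completeness are the library's.
\<close>

class complex_vector = real_vector +
  fixes scaleC :: "complex \<Rightarrow> 'a \<Rightarrow> 'a"  (infixr \<open>*\<^sub>C\<close> 75)
  assumes scaleC_add_right: "a *\<^sub>C (x + y) = a *\<^sub>C x + a *\<^sub>C y"
    and scaleC_add_left: "(a + b) *\<^sub>C x = a *\<^sub>C x + b *\<^sub>C x"
    and scaleC_scaleC: "a *\<^sub>C b *\<^sub>C x = (a * b) *\<^sub>C x"
    and scaleC_of_real: "complex_of_real r *\<^sub>C x = r *\<^sub>R x"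

class complex_normed_vector = complex_vector + real_normed_vector +
  assumes norm_scaleC: "norm (a *\<^sub>C x) = cmod a * norm x"

text \<open>The inner product is linear in the second and conjugate-linear in the first argument.\<close>

class complex_inner = complex_normed_vector + real_inner +
  fixes cinner :: "'a \<Rightarrow> 'a \<Rightarrow> complex"
  assumes cinner_commute: "cinner x y = cnj (cinner y x)"
    and cinner_add_right: "cinner x (y + z) = cinner x y + cinner x z"
    and cinner_scaleC_right: "cinner x (a *\<^sub>C y) = a * cinner x y"
    and Re_cinner: "Re (cinner x y) = inner x y"

class chilbert_space = complex_inner + complete_space

instantiation complex :: chilbert_space
begin

definition scaleC_complex :: "complex \<Rightarrow> complex \<Rightarrow> complex"
  where "scaleC_complex a x = a * x"

definition cinner_complex :: "complex \<Rightarrow> complex \<Rightarrow> complex"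
  where "cinner_complex x y = cnj x * y"

instance
  by standard
    (auto simp: scaleC_complex_def cinner_complex_def algebra_simps scaleR_conv_of_real
      norm_mult inner_complex_def)

end

text \<open>
  Operators live in the library type of bounded real-linear maps; \<open>cbounded_ops\<close> is the
  algebra \<open>B(H)\<close> inside it. The library norm of its elements is the operator norm.
\<close>

instantiation blinfun :: (real_normed_vector, complex_normed_vector) complex_normed_vector
begin

lift_definition scaleC_blinfun :: "complex \<Rightarrow> ('a \<Rightarrow>\<^sub>L 'b) \<Rightarrow> ('a \<Rightarrow>\<^sub>L 'b)" is "\<lambda>a f x. a *\<^sub>C f x"
proof -
  fix a and f :: "'a \<Rightarrow> 'b"
  assume f: "bounded_linear f"
  have comm: "a *\<^sub>C r *\<^sub>R y = r *\<^sub>R a *\<^sub>C y" for r and y :: 'b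
    by (metis scaleC_of_real scaleC_scaleC mult.commute)
  have "bounded_linear (\<lambda>y::'b. a *\<^sub>C y)"
    by (rule bounded_linear_intro[where K = "cmod a"])
      (auto simp: scaleC_add_right comm norm_scaleC mult.commute)
  from bounded_linear_compose[OF this f] show "bounded_linear (\<lambda>x. a *\<^sub>C f x)" .
qed

instance
proof
  fix a b :: complex and r :: real and x y :: "'a \<Rightarrow>\<^sub>L 'b"
  show "a *\<^sub>C (x + y) = a *\<^sub>C x + a *\<^sub>C y"
    by transfer (simp add: scaleC_add_right)
  show "(a + b) *\<^sub>C x = a *\<^sub>C x + b *\<^sub>C x"
    by transfer (simp add: scaleC_add_left)
  show "a *\<^sub>C b *\<^sub>C x = (a * b) *\<^sub>C x"
    by transfer (simp add: scaleC_scaleC)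
  show "complex_of_real r *\<^sub>C x = r *\<^sub>R x"
    by transfer (simp add: scaleC_of_real)
  have "onorm (\<lambda>u. a *\<^sub>C f u) = cmod a * onorm f" if "bounded_linear f" for f :: "'a \<Rightarrow> 'b"
  proof -
    have "onorm (\<lambda>u. a *\<^sub>C f u) = onorm (\<lambda>u. cmod a *\<^sub>R f u)"
      by (simp add: onorm_def norm_scaleC)
    also have "\<dots> = cmod a * onorm f"
      using onorm_scaleR[OF that, of "cmod a"] by simp
    finally show ?thesis .
  qed
  then show "norm (a *\<^sub>C x) = cmod a * norm x"
    by transfer
qed

end

definition cbounded_ops :: "('h::chilbert_space \<Rightarrow>\<^sub>L 'h) set"
  where "cbounded_ops = {x. \<forall>a \<xi>. blinfun_apply x (a *\<^sub>C \<xi>) = a *\<^sub>C blinfun_apply x \<xi>}"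

text \<open>The adjoint is meaningful only on \<open>cbounded_ops\<close>.\<close>

definition adj :: "('h::chilbert_space \<Rightarrow>\<^sub>L 'h) \<Rightarrow> ('h \<Rightarrow>\<^sub>L 'h)"
  where "adj x = (THE y. \<forall>\<xi> \<eta>. cinner (blinfun_apply y \<xi>) \<eta> = cinner \<xi> (blinfun_apply x \<eta>))"

definition commutant :: "('h::chilbert_space \<Rightarrow>\<^sub>L 'h) set \<Rightarrow> ('h \<Rightarrow>\<^sub>L 'h) set"
  where "commutant S = {x \<in> cbounded_ops. \<forall>y\<in>S. x o\<^sub>L y = y o\<^sub>L x}"

text \<open>
  A commutant is automatically a unital subalgebra of \<open>B(H)\<close>, so the following are exactly the
  \<open>*\<close>-subalgebras of \<open>B(H)\<close> that equal their bicommutant. All of them contain the identity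
  operator, so inclusions of von Neumann algebras on the same Hilbert space are unital.
\<close>

definition von_neumann_algebra :: "('h::chilbert_space \<Rightarrow>\<^sub>L 'h) set \<Rightarrow> bool"
  where "von_neumann_algebra M \<longleftrightarrow> (\<forall>x\<in>M. adj x \<in> M) \<and> commutant (commutant M) = M"

definition vn_join ::
    "('h::chilbert_space \<Rightarrow>\<^sub>L 'h) set \<Rightarrow> ('h \<Rightarrow>\<^sub>L 'h) set \<Rightarrow> ('h \<Rightarrow>\<^sub>L 'h) set"  (infixl \<open>\<or>\<^sub>v\<^sub>N\<close> 65)
  where "Q1 \<or>\<^sub>v\<^sub>N Q2 = von_neumann_algebra hull (Q1 \<union> Q2)"

text \<open>
  The ultraweak (\<open>\<sigma>\<close>-weak) topology, generated by the functionals
  \<open>x \<mapsto> (\<Sum>n. \<langle>\<xi> n, x (\<eta> n)\<rangle>)\<close> with square-summable \<open>\<xi>\<close> and \<open>\<eta>\<close>.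
  Normal functionals are the ultraweakly continuous ones.
\<close>

definition ultraweak_topology :: "('h::chilbert_space \<Rightarrow>\<^sub>L 'h) topology"
  where "ultraweak_topology = topology_generated_by
    {(\<lambda>x. \<Sum>n. cinner (\<xi> n) (blinfun_apply x (\<eta> n))) -` U | (\<xi> :: nat \<Rightarrow> 'h) (\<eta> :: nat \<Rightarrow> 'h) U.
      summable (\<lambda>n. (norm (\<xi> n))\<^sup>2) \<and> summable (\<lambda>n. (norm (\<eta> n))\<^sup>2) \<and> open U}"

definition state_on ::
    "('h::chilbert_space \<Rightarrow>\<^sub>L 'h) set \<Rightarrow> (('h \<Rightarrow>\<^sub>L 'h) \<Rightarrow> complex) \<Rightarrow> bool"
  where "state_on M \<tau> \<longleftrightarrow>
    (\<forall>x\<in>M. \<forall>y\<in>M. \<tau> (x + y) = \<tau> x + \<tau> y) \<and>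
    (\<forall>a. \<forall>x\<in>M. \<tau> (a *\<^sub>C x) = a * \<tau> x) \<and>
    (\<forall>x\<in>M. \<tau> (adj x o\<^sub>L x) \<in> \<real>\<^sub>\<ge>\<^sub>0) \<and>
    \<tau> id_blinfun = 1"

definition normal_on ::
    "('h::chilbert_space \<Rightarrow>\<^sub>L 'h) set \<Rightarrow> (('h \<Rightarrow>\<^sub>L 'h) \<Rightarrow> complex) \<Rightarrow> bool"
  where "normal_on M \<tau> \<longleftrightarrow> continuous_map (subtopology ultraweak_topology M) euclidean \<tau>"

definition faithful_on ::
    "('h::chilbert_space \<Rightarrow>\<^sub>L 'h) set \<Rightarrow> (('h \<Rightarrow>\<^sub>L 'h) \<Rightarrow> complex) \<Rightarrow> bool"
  where "faithful_on M \<tau> \<longleftrightarrow> (\<forall>x\<in>M. \<tau> (adj x o\<^sub>L x) = 0 \<longrightarrow> x = 0)"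

definition tracial_on ::
    "('h::chilbert_space \<Rightarrow>\<^sub>L 'h) set \<Rightarrow> (('h \<Rightarrow>\<^sub>L 'h) \<Rightarrow> complex) \<Rightarrow> bool"
  where "tracial_on M \<tau> \<longleftrightarrow> (\<forall>x\<in>M. \<forall>y\<in>M. \<tau> (x o\<^sub>L y) = \<tau> (y o\<^sub>L x))"

definition tracial_vn_algebra ::
    "('h::chilbert_space \<Rightarrow>\<^sub>L 'h) set \<Rightarrow> (('h \<Rightarrow>\<^sub>L 'h) \<Rightarrow> complex) \<Rightarrow> bool"
  where "tracial_vn_algebra M \<tau> \<longleftrightarrow>
    von_neumann_algebra M \<and> state_on M \<tau> \<and> normal_on M \<tau> \<and> faithful_on M \<tau> \<and> tracial_on M \<tau>"

definition tracial_inclusion ::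
    "('h::chilbert_space \<Rightarrow>\<^sub>L 'h) set \<Rightarrow> (('h \<Rightarrow>\<^sub>L 'h) \<Rightarrow> complex) \<Rightarrow>
     ('h \<Rightarrow>\<^sub>L 'h) set \<Rightarrow> (('h \<Rightarrow>\<^sub>L 'h) \<Rightarrow> complex) \<Rightarrow> bool"
  where "tracial_inclusion M \<tau> M' \<tau>' \<longleftrightarrow>
    tracial_vn_algebra M \<tau> \<and> tracial_vn_algebra M' \<tau>' \<and> M \<subseteq> M' \<and> (\<forall>x\<in>M. \<tau> x = \<tau>' x)"

definition norm2 :: "(('h::chilbert_space \<Rightarrow>\<^sub>L 'h) \<Rightarrow> complex) \<Rightarrow> ('h \<Rightarrow>\<^sub>L 'h) \<Rightarrow> real"
  where "norm2 \<tau> x = sqrt (Re (\<tau> (adj x o\<^sub>L x)))"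

text \<open>
  Maps on a von Neumann algebra \<open>M\<close> are HOL functions on all operators, of which only the values
  on \<open>M\<close> matter. In particular equality of automorphisms means equality on \<open>M\<close>.
\<close>

definition trace_preserving_aut ::
    "('h::chilbert_space \<Rightarrow>\<^sub>L 'h) set \<Rightarrow> (('h \<Rightarrow>\<^sub>L 'h) \<Rightarrow> complex) \<Rightarrow>
     (('h \<Rightarrow>\<^sub>L 'h) \<Rightarrow> ('h \<Rightarrow>\<^sub>L 'h)) \<Rightarrow> bool"
  where "trace_preserving_aut M \<tau> \<phi> \<longleftrightarrow>
    bij_betw \<phi> M M \<and>
    (\<forall>x\<in>M. \<forall>y\<in>M. \<phi> (x + y) = \<phi> x + \<phi> y) \<and>
    (\<forall>a. \<forall>x\<in>M. \<phi> (a *\<^sub>C x) = a *\<^sub>C \<phi> x) \<and>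
    (\<forall>x\<in>M. \<forall>y\<in>M. \<phi> (x o\<^sub>L y) = \<phi> x o\<^sub>L \<phi> y) \<and>
    (\<forall>x\<in>M. \<phi> (adj x) = adj (\<phi> x)) \<and>
    (\<forall>x\<in>M. \<tau> (\<phi> x) = \<tau> x)"

definition s_malleable_deformation ::
    "('h::chilbert_space \<Rightarrow>\<^sub>L 'h) set \<Rightarrow> ('h \<Rightarrow>\<^sub>L 'h) set \<Rightarrow> (('h \<Rightarrow>\<^sub>L 'h) \<Rightarrow> complex) \<Rightarrow>
     (real \<Rightarrow> ('h \<Rightarrow>\<^sub>L 'h) \<Rightarrow> ('h \<Rightarrow>\<^sub>L 'h)) \<Rightarrow> (('h \<Rightarrow>\<^sub>L 'h) \<Rightarrow> ('h \<Rightarrow>\<^sub>L 'h)) \<Rightarrow> bool"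
  where "s_malleable_deformation M M' \<tau>' \<alpha> \<beta> \<longleftrightarrow>
    (\<forall>t. trace_preserving_aut M' \<tau>' (\<alpha> t)) \<and>
    (\<forall>s t. \<forall>x\<in>M'. \<alpha> (s + t) x = \<alpha> s (\<alpha> t x)) \<and>
    (\<forall>x\<in>M'. ((\<lambda>t. norm2 \<tau>' (\<alpha> t x - x)) \<longlongrightarrow> 0) (at 0)) \<and>
    trace_preserving_aut M' \<tau>' \<beta> \<and>
    (\<forall>x\<in>M. \<beta> x = x) \<and>
    (\<forall>x\<in>M'. \<beta> (\<beta> x) = x) \<and>
    (\<forall>t. \<forall>x\<in>M'. \<beta> (\<alpha> t x) = \<alpha> (- t) (\<beta> x))"

text \<open>The supremum is over a nonempty set, bounded by \<open>2\<close>, so it is a genuine real supremum.\<close>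

definition rigidity_eps ::
    "(('h::chilbert_space \<Rightarrow>\<^sub>L 'h) \<Rightarrow> complex) \<Rightarrow> (real \<Rightarrow> ('h \<Rightarrow>\<^sub>L 'h) \<Rightarrow> ('h \<Rightarrow>\<^sub>L 'h)) \<Rightarrow>
     real \<Rightarrow> ('h \<Rightarrow>\<^sub>L 'h) set \<Rightarrow> real"
  where "rigidity_eps \<tau>' \<alpha> t Q = (SUP x\<in>{x \<in> Q. norm x \<le> 1}. norm2 \<tau>' (\<alpha> t x - x))"

definition Rig ::
    "('h::chilbert_space \<Rightarrow>\<^sub>L 'h) set \<Rightarrow> (('h \<Rightarrow>\<^sub>L 'h) \<Rightarrow> complex) \<Rightarrow>
     (real \<Rightarrow> ('h \<Rightarrow>\<^sub>L 'h) \<Rightarrow> ('h \<Rightarrow>\<^sub>L 'h)) \<Rightarrow> ('h \<Rightarrow>\<^sub>L 'h) set set"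
  where "Rig M \<tau>' \<alpha> =
    {Q. von_neumann_algebra Q \<and> Q \<subseteq> M \<and> ((\<lambda>t. rigidity_eps \<tau>' \<alpha> t Q) \<longlongrightarrow> 0) (at 0)}"

end

theory Submission
  imports Defs
begin

text \<open>
  Call \<open>v\<close> an intertwiner of \<open>Q\<close> at time \<open>t\<close> if \<open>\<alpha>\<^sub>t(x) v = v x\<close> for all \<open>x \<in> Q\<close>. If \<open>u\<close> and \<open>v\<close> are
  intertwiners of \<open>N = Q1 \<inter> Q2\<close> at time \<open>t\<close>, then \<open>u* v\<close> commutes with \<open>N\<close>, so by hypothesis it lies
  in \<open>M\<close> and is fixed by \<open>\<beta>\<close>. Suppose for a moment that \<open>u\<close> and \<open>v\<close> are unitary. Then
  \<open>u* v = \<beta>(u)* \<beta>(v)\<close> says that \<open>u \<beta>(u)* = v \<beta>(v)*\<close>: the unitary \<open>w = u \<beta>(u)*\<close> does not depend on the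
  choice of the intertwiner. As \<open>\<beta>\<close> turns an intertwiner at time \<open>t\<close> into one at time \<open>-t\<close>, the
  element \<open>\<alpha>\<^sub>t(w)\<close> intertwines at time \<open>2t\<close> any part of \<open>M\<close> that \<open>u\<close> intertwines at time \<open>t\<close>. Taking \<open>u\<close> from \<open>Q1\<close> and
  \<open>v\<close> from \<open>Q2\<close> shows that \<open>\<alpha>\<^sub>t(w)\<close> intertwines \<open>Q1\<close> and \<open>Q2\<close>, hence the algebra that they generate.

  The distance of \<open>w\<close> from \<open>1\<close> is controlled by \<open>Q1\<close> alone. Averaging \<open>\<alpha>\<^sub>t(x) x*\<close> over the unitaries
  \<open>x\<close> of \<open>Q1\<close> gives an intertwiner \<open>h\<close> of norm at most 1 within \<open>\<epsilon> = \<epsilon>\<^sub>t(Q1)\<close> of \<open>1\<close>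
  (\<open>intertwiner_near_identity\<close>), and \<open>u* h = \<beta>(u)* \<beta>(h)\<close> reads \<open>h = w \<beta>(h)\<close>. Therefore
  \<open>\<parallel>w - 1\<parallel>\<^sub>2 \<le> \<parallel>1 - \<beta>(h)\<parallel>\<^sub>2 + \<parallel>h - 1\<parallel>\<^sub>2 \<le> 2 \<epsilon>\<close>, and \<open>\<parallel>\<alpha>\<^sub>2\<^sub>t(x) - x\<parallel>\<^sub>2 \<le> 2 \<parallel>w - 1\<parallel>\<^sub>2 \<le> 4 \<epsilon>\<close> for every
  contraction \<open>x\<close> that \<open>\<alpha>\<^sub>t(w)\<close> intertwines (\<open>rigidity_join\<close>).

  Unitary intertwiners are replaced by almost unitary ones: contractive intertwiners \<open>u\<close> with
  \<open>\<parallel>u\<parallel>\<^sub>2\<close> as close to 1 as desired. For a rigid algebra and a small time the averages \<open>h\<close> are of this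
  kind. To reach a given time \<open>t\<close>, start at \<open>t / 2\<^sup>n\<close> and apply the doubling \<open>v \<mapsto> \<alpha>\<^sub>s(v \<beta>(v)*)\<close>.
  It preserves the 2-norm when \<open>v* v\<close> is a projection, and a Newton step towards the polar part of
  \<open>v\<close> shows that this is almost the case when \<open>\<parallel>v\<parallel>\<^sub>2\<close> is almost maximal (\<open>unitarity_double\<close>,
  \<open>unitarity_rigid\<close>). The elements \<open>w\<close> then become a sequence, and intertwining holds
  asymptotically in the 2-norm.

  Two facts about a tracial von Neumann algebra carry the analysis. Its unit ball is
  complete in the 2-norm (\<open>n2_complete\<close>), by weak operator compactness and normality of the trace;
  this provides the averages. A self-adjoint unital subalgebra is 2-norm dense in its
  bicommutant (\<open>n2_density\<close>), by von Neumann's argument on the space of square-summable sequences of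
  vectors; this turns the set of asymptotically intertwined elements into a von Neumann algebra
  (\<open>asymp_von_neumann\<close>), which therefore contains the join of \<open>Q1\<close> and \<open>Q2\<close>.
\<close>

notation blinfun_compose (infixl \<open>\<cdot>\<close> 70)

section \<open>Orthogonal projections and adjoints\<close>

text \<open>
  By the parallelogram law the hypothesis on \<open>D\<close> holds when \<open>D\<close> is the distance between
  elements of norms \<open>a m\<close> and \<open>a n\<close> in a convex set on which the norm is at least \<open>d\<close>. It serves
  both the Hilbert space and the 2-norm.
\<close>

lemma minimizing_Cauchy:
  fixes a :: "nat \<Rightarrow> real" and D :: "nat \<Rightarrow> nat \<Rightarrow> real"
  assumes a: "a \<longlonglongrightarrow> d"
    and D: "\<And>m n. (D m n)\<^sup>2 \<le> 2 * (a m)\<^sup>2 + 2 * (a n)\<^sup>2 - 4 * d\<^sup>2"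
    and e: "0 < e"
  obtains N where "\<And>m n. N \<le> m \<Longrightarrow> N \<le> n \<Longrightarrow> D m n < e"
proof -
  have "(\<lambda>n. (a n)\<^sup>2) \<longlonglongrightarrow> d\<^sup>2"
    by (intro tendsto_intros a)
  then have "\<forall>\<^sub>F n in sequentially. (a n)\<^sup>2 < d\<^sup>2 + e\<^sup>2 / 4"
    using e by (intro order_tendstoD) auto
  then obtain N where N: "(a n)\<^sup>2 < d\<^sup>2 + e\<^sup>2 / 4" if "N \<le> n" for n
    unfolding eventually_sequentially by blast
  have "D m n < e" if "N \<le> m" "N \<le> n" for m n
  proof -
    have "(D m n)\<^sup>2 < e\<^sup>2"
      using D[of m n] N[OF that(1)] N[OF that(2)] by linarith
    then show ?thesis
      using e by (meson less_imp_le power2_less_imp_less)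
  qed
  then show ?thesis by (rule that)
qed

text \<open>
  Applied to the square of the norm of \<open>x + s y\<close>, this gives Cauchy-Schwarz for any positive
  semidefinite real form; with \<open>A = 0\<close> it gives a vanishing linear term.
\<close>

lemma quadratic_nonneg_discriminant:
  fixes A B C :: real
  assumes "\<And>s. 0 \<le> A + 2 * s * B + s\<^sup>2 * C"
  shows "B\<^sup>2 \<le> A * C"
proof (cases "C = 0")
  case True
  have "B = 0"
  proof (rule ccontr)
    assume "B \<noteq> 0"
    with assms[of "- (A + 1) / (2 * B)"] True show False
      by (simp add: field_simps)
  qed
  with True show ?thesis by simp
next
  case False
  have "0 \<le> A + 2 * 1 * B + 1\<^sup>2 * C" "0 \<le> A + 2 * (-1) * B + (-1)\<^sup>2 * C"
    by (rule assms)+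
  have "C > 0"
  proof (rule ccontr)
    assume "\<not> C > 0"
    with False have C: "C < 0" by simp
    define s where "s = (\<bar>A\<bar> + 2 * \<bar>B\<bar> + 1) / \<bar>C\<bar> + 1"
    have s1: "s \<ge> 1" unfolding s_def by simp
    have "s * \<bar>C\<bar> = \<bar>A\<bar> + 2 * \<bar>B\<bar> + 1 + \<bar>C\<bar>"
      unfolding s_def using C by (simp add: field_simps)
    then have "s * (s * \<bar>C\<bar>) \<ge> s * (\<bar>A\<bar> + 2 * \<bar>B\<bar> + 1)"
      using s1 by (intro mult_left_mono) auto
    moreover have "s * \<bar>A\<bar> \<ge> \<bar>A\<bar>" using s1 mult_right_mono[of 1 s "\<bar>A\<bar>"] by simp
    moreover have "s\<^sup>2 * C = - (s * (s * \<bar>C\<bar>))" using C by (simp add: power2_eq_square)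
    moreover have "s * B \<le> s * \<bar>B\<bar>" using s1 by (simp add: mult_left_mono)
    moreover have "s * (\<bar>A\<bar> + 2 * \<bar>B\<bar> + 1) = s * \<bar>A\<bar> + 2 * (s * \<bar>B\<bar>) + s"
      by (simp add: algebra_simps)
    moreover have "0 \<le> A + 2 * (s * B) + s\<^sup>2 * C" using assms[of s] by (simp add: mult.assoc)
    ultimately show False
      using s1 abs_ge_self[of A] by linarith
  qed
  moreover have "0 \<le> A + 2 * (- B / C) * B + (- B / C)\<^sup>2 * C" by (rule assms)
  ultimately show ?thesis by (simp add: field_simps power2_eq_square)
qed

text \<open>
  The point of \<open>V\<close> closest to \<open>x\<close>: minimizing sequences are Cauchy, and minimality along each line
  in \<open>V\<close> through the limit is a quadratic inequality that forces orthogonality.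
\<close>

theorem orthogonal_projection_exists:
  fixes V :: "'a::{real_inner,complete_space} set"
  assumes V: "subspace V" and cl: "closed V"
  shows "\<exists>p\<in>V. \<forall>v\<in>V. v \<bullet> (x - p) = 0"
proof -
  define d where "d = infdist x V"
  have ne: "V \<noteq> {}" using V subspace_0 by auto
  have d0: "0 \<le> d" by (simp add: d_def infdist_nonneg)
  have dle: "d \<le> norm (x - v)" if "v \<in> V" for v
    using infdist_le[OF that, of x] by (simp add: d_def dist_norm)
  have "\<exists>v\<in>V. norm (x - v) < d + 1 / real (Suc n)" for n
  proof -
    have "(INF v\<in>V. dist x v) < d + 1 / real (Suc n)"
      using ne by (simp add: d_def infdist_def)
    then show ?thesis
      using ne by (subst (asm) cINF_less_iff) (auto intro!: bdd_belowI[of _ 0] simp: dist_norm)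
  qed
  then obtain v where v: "v n \<in> V" "norm (x - v n) < d + 1 / real (Suc n)" for n
    by metis
  define a where "a n = norm (x - v n)" for n
  have a: "a \<longlonglongrightarrow> d"
  proof (rule tendsto_sandwich[where f = "\<lambda>_. d"])
    show "(\<lambda>n. d + 1 / real (Suc n)) \<longlonglongrightarrow> d"
      using tendsto_add[OF tendsto_const LIMSEQ_inverse_real_of_nat, of d]
      by (simp add: inverse_eq_divide)
  qed (use v dle in \<open>auto simp: a_def intro!: always_eventually less_imp_le\<close>)
  have par: "(norm (v m - v n))\<^sup>2 \<le> 2 * (a m)\<^sup>2 + 2 * (a n)\<^sup>2 - 4 * d\<^sup>2" for m n
  proof -
    have "d\<^sup>2 \<le> (norm (x - (1/2) *\<^sub>R (v m + v n)))\<^sup>2"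
      using v V d0 by (intro power_mono dle) (auto intro!: subspace_scale subspace_add)
    moreover have "(norm (v m - v n))\<^sup>2 =
      2 * (a m)\<^sup>2 + 2 * (a n)\<^sup>2 - 4 * (norm (x - (1/2) *\<^sub>R (v m + v n)))\<^sup>2"
      by (simp add: a_def power2_norm_eq_inner inner_commute algebra_simps)
    ultimately show ?thesis by simp
  qed
  have "Cauchy v"
  proof (rule CauchyI)
    fix e :: real assume "0 < e"
    from minimizing_Cauchy[of a d "\<lambda>m n. norm (v m - v n)", OF a par this]
    show "\<exists>M. \<forall>m\<ge>M. \<forall>n\<ge>M. norm (v m - v n) < e" by metis
  qed
  then obtain p where p: "v \<longlonglongrightarrow> p"
    using Cauchy_convergent convergent_def by blast
  have pV: "p \<in> V"
    using closed_sequentially[OF cl _ p] v by blast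
  have "a \<longlonglongrightarrow> norm (x - p)"
    unfolding a_def by (intro tendsto_intros p)
  then have dp: "norm (x - p) = d"
    using LIMSEQ_unique a by blast
  have "w \<bullet> (x - p) = 0" if w: "w \<in> V" for w
  proof -
    have "0 \<le> 0 + 2 * s * (w \<bullet> (x - p)) + s\<^sup>2 * (norm w)\<^sup>2" for s
    proof -
      have "p - s *\<^sub>R w \<in> V"
        using pV w V by (intro subspace_diff subspace_scale)
      then have "(norm (x - p))\<^sup>2 \<le> (norm (x - (p - s *\<^sub>R w)))\<^sup>2"
        using dle dp by (intro power_mono) auto
      also have "\<dots> = (norm (x - p))\<^sup>2 + 2 * s * (w \<bullet> (x - p)) + s\<^sup>2 * (norm w)\<^sup>2"
        by (simp add: power2_norm_eq_inner inner_commute algebra_simps power2_eq_square[of s])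
      finally show ?thesis by simp
    qed
    from quadratic_nonneg_discriminant[OF this] show ?thesis by simp
  qed
  with pV show ?thesis by blast
qed

definition orth_proj :: "'a::{real_inner,complete_space} set \<Rightarrow> 'a \<Rightarrow> 'a"
  where "orth_proj V x = (SOME p. p \<in> V \<and> (\<forall>v\<in>V. v \<bullet> (x - p) = 0))"

context
  fixes V :: "'a::{real_inner,complete_space} set"
  assumes V: "subspace V" "closed V"
begin

lemma orth_proj:
  shows orth_proj_in: "orth_proj V x \<in> V"
    and orth_proj_orth: "v \<in> V \<Longrightarrow> v \<bullet> (x - orth_proj V x) = 0"
proof -
  have "orth_proj V x \<in> V \<and> (\<forall>v\<in>V. v \<bullet> (x - orth_proj V x) = 0)"
    unfolding orth_proj_def
    by (rule someI_ex) (use orthogonal_projection_exists[OF V] in blast)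
  then show "orth_proj V x \<in> V" "v \<in> V \<Longrightarrow> v \<bullet> (x - orth_proj V x) = 0" by auto
qed

lemma orth_proj_eqI:
  assumes "p \<in> V" "\<And>v. v \<in> V \<Longrightarrow> v \<bullet> (x - p) = 0"
  shows "orth_proj V x = p"
proof -
  let ?q = "orth_proj V x - p"
  have "?q \<in> V" using V assms orth_proj_in by (intro subspace_diff)
  then have "?q \<bullet> (x - p) - ?q \<bullet> (x - orth_proj V x) = 0"
    using assms orth_proj_orth by simp
  then have "?q \<bullet> ?q = 0" by (simp add: algebra_simps)
  then show ?thesis by simp
qed

lemma orth_proj_ident: "x \<in> V \<Longrightarrow> orth_proj V x = x"
  by (rule orth_proj_eqI) auto

lemma bounded_linear_orth_proj: "bounded_linear (orth_proj V)"
proof (rule bounded_linear_intro[where K = 1])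
  fix x y r
  show "orth_proj V (x + y) = orth_proj V x + orth_proj V y"
  proof (rule orth_proj_eqI)
    fix v assume "v \<in> V"
    with orth_proj_orth[of v x] orth_proj_orth[of v y]
    show "v \<bullet> (x + y - (orth_proj V x + orth_proj V y)) = 0"
      by (simp add: algebra_simps)
  qed (use V orth_proj_in in \<open>auto intro: subspace_add\<close>)
  show "orth_proj V (r *\<^sub>R x) = r *\<^sub>R orth_proj V x"
  proof (rule orth_proj_eqI)
    fix v assume "v \<in> V"
    with orth_proj_orth[of v x] show "v \<bullet> (r *\<^sub>R x - r *\<^sub>R orth_proj V x) = 0"
      by (simp add: algebra_simps)
  qed (use V orth_proj_in in \<open>auto intro: subspace_scale\<close>)
  let ?p = "orth_proj V x"
  have "?p \<bullet> ?p = ?p \<bullet> x"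
    using orth_proj_orth[OF orth_proj_in[of x], of x] by (simp add: algebra_simps)
  then have "norm ?p * norm ?p \<le> norm ?p * norm x"
    using norm_cauchy_schwarz[of ?p x] by (simp flip: norm_eq_square power2_norm_eq_inner power2_eq_square)
  then show "norm ?p \<le> norm x * 1"
    by (cases "?p = 0") auto
qed

text \<open>
  As \<open>S\<close> is the adjoint of \<open>T\<close>, invariance of \<open>V\<close> under \<open>S\<close> makes the orthogonal complement of
  \<open>V\<close> invariant under \<open>T\<close>.
\<close>

lemma orth_proj_commute:
  assumes T: "\<And>a b. S a \<bullet> b = a \<bullet> T b" and lin: "linear T"
    and inv: "\<And>v. v \<in> V \<Longrightarrow> T v \<in> V" "\<And>v. v \<in> V \<Longrightarrow> S v \<in> V"
  shows "orth_proj V (T x) = T (orth_proj V x)"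
proof (rule orth_proj_eqI)
  show "T (orth_proj V x) \<in> V" by (intro inv orth_proj_in)
  fix v assume "v \<in> V"
  then have "S v \<bullet> (x - orth_proj V x) = 0" by (intro orth_proj_orth inv)
  then show "v \<bullet> (T x - T (orth_proj V x)) = 0"
    by (simp add: T linear_diff[OF lin])
qed

end

text \<open>
  A vector orthogonal to the kernel of \<open>f\<close> represents \<open>f\<close> up to a scalar, since the kernel has
  codimension at most one.
\<close>

theorem riesz_representation:
  fixes f :: "'a::{real_inner,complete_space} \<Rightarrow> real"
  assumes f: "bounded_linear f"
  shows "\<exists>z. \<forall>x. f x = z \<bullet> x"
proof (cases "\<forall>x. f x = 0")
  case True
  then show ?thesis by (intro exI[of _ 0]) auto
next
  case False
  then obtain x where x: "f x \<noteq> 0" by blast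
  interpret f: bounded_linear f by (rule f)
  define V where "V = {x. f x = 0}"
  have V: "subspace V" unfolding V_def subspace_def by (auto simp: f.add f.scaleR f.zero)
  have clV: "closed V" unfolding V_def
    by (intro closed_Collect_eq continuous_intros linear_continuous_on f)
  define r where "r = x - orth_proj V x"
  have "f (orth_proj V x) = 0"
    using orth_proj_in[OF V clV, of x] by (simp add: V_def)
  then have fr: "f r \<noteq> 0" using x by (simp add: r_def f.diff)
  then have r0: "r \<bullet> r \<noteq> 0" using f.zero by auto
  have "f y = ((f r / (r \<bullet> r)) *\<^sub>R r) \<bullet> y" for y
  proof -
    have "y - (f y / f r) *\<^sub>R r \<in> V"
      using fr by (simp add: V_def f.diff f.scaleR)
    then have "(y - (f y / f r) *\<^sub>R r) \<bullet> r = 0"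
      unfolding r_def by (rule orth_proj_orth[OF V clV])
    then have "r \<bullet> y = (f y / f r) * (r \<bullet> r)"
      by (simp add: algebra_simps inner_commute)
    then show ?thesis using fr r0 by simp
  qed
  then show ?thesis by blast
qed

lemma real_adjoint_exists:
  fixes x :: "'a::{real_inner,complete_space} \<Rightarrow>\<^sub>L 'a"
  shows "\<exists>y :: 'a \<Rightarrow>\<^sub>L 'a. \<forall>\<xi> \<eta>. y \<xi> \<bullet> \<eta> = \<xi> \<bullet> x \<eta>"
proof -
  have "\<exists>z. \<forall>\<eta>. \<xi> \<bullet> x \<eta> = z \<bullet> \<eta>" for \<xi>
    by (rule riesz_representation) (intro bounded_linear_intros)
  then obtain y where y: "\<xi> \<bullet> x \<eta> = y \<xi> \<bullet> \<eta>" for \<xi> \<eta> by metis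
  have "bounded_linear y"
  proof (rule bounded_linear_intro[where K = "norm x"])
    show "y (a + b) = y a + y b" for a b
      by (rule vector_eq_rdot[THEN iffD1]) (simp add: inner_add_left flip: y)
    show "y (r *\<^sub>R a) = r *\<^sub>R y a" for r a
      by (rule vector_eq_rdot[THEN iffD1]) (simp flip: y)
    fix \<xi>
    have "norm (y \<xi>) * norm (y \<xi>) = \<xi> \<bullet> x (y \<xi>)"
      by (simp add: y flip: power2_norm_eq_inner power2_eq_square)
    also have "\<dots> \<le> norm \<xi> * (norm x * norm (y \<xi>))"
      by (rule order_trans[OF norm_cauchy_schwarz])
        (intro mult_left_mono norm_blinfun, simp)
    finally have "norm (y \<xi>) * norm (y \<xi>) \<le> norm (y \<xi>) * (norm \<xi> * norm x)"
      by (simp add: algebra_simps)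
    then show "norm (y \<xi>) \<le> norm \<xi> * norm x"
      by (cases "y \<xi> = 0") auto
  qed
  then show ?thesis
    using y by (intro exI[of _ "Blinfun y"]) (simp add: bounded_linear_Blinfun_apply)
qed

lemma Im_cinner: "Im (cinner x y) = - (x \<bullet> (\<i> *\<^sub>C y))"
  using cinner_scaleC_right[of x \<i> y] Re_cinner[of x "\<i> *\<^sub>C y"] by simp

text \<open>
  The imaginary part of the complex inner product is the real inner product with \<open>\<i>\<close> times a vector,
  so for operators commuting with \<open>\<i>\<close> the real and the complex adjoint relations agree. This is how
  complex adjoints are obtained from the real Hilbert space theory.
\<close>

lemma cinner_eq_iff_inner:
  assumes y: "y \<in> cbounded_ops" and x: "x \<in> cbounded_ops"
  shows "(\<forall>\<xi> \<eta>. cinner (blinfun_apply y \<xi>) \<eta> = cinner \<xi> (blinfun_apply x \<eta>)) \<longleftrightarrow> (\<forall>\<xi> \<eta>. y \<xi> \<bullet> \<eta> = \<xi> \<bullet> x \<eta>)"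
proof -
  have "x (\<i> *\<^sub>C \<eta>) = \<i> *\<^sub>C x \<eta>" for \<eta> using x by (simp add: cbounded_ops_def)
  then have "cinner (y \<xi>) \<eta> = cinner \<xi> (x \<eta>)" if "\<forall>\<xi> \<eta>. y \<xi> \<bullet> \<eta> = \<xi> \<bullet> x \<eta>" for \<xi> \<eta>
    using that by (simp add: complex_eq_iff Re_cinner Im_cinner)
  moreover have "y \<xi> \<bullet> \<eta> = \<xi> \<bullet> x \<eta>" if "\<forall>\<xi> \<eta>. cinner (y \<xi>) \<eta> = cinner \<xi> (x \<eta>)" for \<xi> \<eta>
    using that by (metis Re_cinner)
  ultimately show ?thesis by blast
qed

lemma scaleC_one: "1 *\<^sub>C x = (x :: 'a::complex_vector)"
  using scaleC_of_real[of 1 x] by simp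

lemma minus_scaleC: "(- a) *\<^sub>C x = - (a *\<^sub>C (x :: 'a::complex_vector))"
proof -
  have "a *\<^sub>C x + (- a) *\<^sub>C x = complex_of_real 0 *\<^sub>C x"
    by (simp flip: scaleC_add_left)
  also have "\<dots> = 0" by (simp only: scaleC_of_real scale_zero_left)
  finally show ?thesis by (simp add: eq_neg_iff_add_eq_0 add.commute)
qed

lemma scaleC_diff_right: "a *\<^sub>C (x - y) = a *\<^sub>C x - a *\<^sub>C (y :: 'a::complex_vector)"
  using scaleC_add_right[of a "x - y" y] by simp

lemma scaleC_complex_of_real: "Complex a b *\<^sub>C x = a *\<^sub>R x + b *\<^sub>R (\<i> *\<^sub>C x)"
  by (metis Complex_eq mult.commute scaleC_add_left scaleC_of_real scaleC_scaleC)

lemma i_inner: "(\<i> *\<^sub>C x) \<bullet> (\<i> *\<^sub>C y) = x \<bullet> (y::'a::complex_inner)"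
proof -
  have n: "(\<i> *\<^sub>C z) \<bullet> (\<i> *\<^sub>C z) = z \<bullet> z" for z :: 'a
    using norm_scaleC[of \<i> z] by (simp add: norm_eq)
  show ?thesis
    using n[of "x + y"] n[of x] n[of y]
    by (simp add: scaleC_add_right inner_add_left inner_add_right inner_commute)
qed

lemma i_i: "\<i> *\<^sub>C \<i> *\<^sub>C x = - (x :: 'a::complex_vector)"
proof -
  have "\<i> *\<^sub>C \<i> *\<^sub>C x = complex_of_real (-1) *\<^sub>C x" by (simp add: scaleC_scaleC)
  then show ?thesis unfolding scaleC_of_real by simp
qed

lemma i_inner_left: "(\<i> *\<^sub>C x) \<bullet> y = - (x \<bullet> (\<i> *\<^sub>C (y::'a::complex_inner)))"
  using i_inner[of x "\<i> *\<^sub>C y"] by (simp add: i_i)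

lemma cbounded_ops_iff_i: "x \<in> cbounded_ops \<longleftrightarrow> (\<forall>\<xi>. x (\<i> *\<^sub>C \<xi>) = \<i> *\<^sub>C x \<xi>)"
proof
  assume i: "\<forall>\<xi>. x (\<i> *\<^sub>C \<xi>) = \<i> *\<^sub>C x \<xi>"
  have "x (a *\<^sub>C \<xi>) = a *\<^sub>C x \<xi>" for a \<xi>
    using i by (cases a) (simp add: scaleC_complex_of_real blinfun.bilinear_simps)
  then show "x \<in> cbounded_ops" by (simp add: cbounded_ops_def)
qed (simp add: cbounded_ops_def)

lemma adj_works:
  fixes x y :: "'h::chilbert_space \<Rightarrow>\<^sub>L 'h"
  assumes x: "x \<in> cbounded_ops"
  shows adj_cbounded: "adj x \<in> cbounded_ops"
    and inner_adj: "adj x \<xi> \<bullet> \<eta> = \<xi> \<bullet> x \<eta>"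
    and cinner_adj: "cinner (adj x \<xi>) \<eta> = cinner \<xi> (x \<eta>)"
    and adj_eqI: "(\<And>\<xi> \<eta>. y \<xi> \<bullet> \<eta> = \<xi> \<bullet> x \<eta>) \<Longrightarrow> adj x = y"
proof -
  have xi: "x (\<i> *\<^sub>C \<xi>) = \<i> *\<^sub>C x \<xi>" for \<xi> using x cbounded_ops_iff_i by blast
  obtain y0 :: "'h \<Rightarrow>\<^sub>L 'h" where y0: "y0 \<xi> \<bullet> \<eta> = \<xi> \<bullet> x \<eta>" for \<xi> \<eta>
    using real_adjoint_exists[of x] by blast
  have y0c: "y0 \<in> cbounded_ops"
    unfolding cbounded_ops_iff_i
  proof
    show "y0 (\<i> *\<^sub>C \<xi>) = \<i> *\<^sub>C y0 \<xi>" for \<xi>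
    proof (rule vector_eq_rdot[THEN iffD1], rule allI)
      show "y0 (\<i> *\<^sub>C \<xi>) \<bullet> z = (\<i> *\<^sub>C y0 \<xi>) \<bullet> z" for z
        by (simp add: y0 i_inner_left xi)
    qed
  qed
  have ex: "\<forall>\<xi> \<eta>. cinner (y0 \<xi>) \<eta> = cinner \<xi> (x \<eta>)"
    using cinner_eq_iff_inner[OF y0c x] y0 by blast
  have uniq: "y = y0" if "\<forall>\<xi> \<eta>. cinner (blinfun_apply y \<xi>) \<eta> = cinner \<xi> (x \<eta>)" for y
  proof (rule blinfun_eqI)
    fix \<xi>
    have "y \<xi> \<bullet> \<eta> = y0 \<xi> \<bullet> \<eta>" for \<eta>
      using that ex by (metis Re_cinner)
    then show "y \<xi> = y0 \<xi>" using vector_eq_rdot by blast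
  qed
  have adj: "adj x = y0"
    unfolding adj_def by (rule the_equality, rule ex, rule uniq, assumption)
  show "adj x \<in> cbounded_ops" "adj x \<xi> \<bullet> \<eta> = \<xi> \<bullet> x \<eta>" "cinner (adj x \<xi>) \<eta> = cinner \<xi> (x \<eta>)"
    using adj y0c y0 ex by auto
  show "adj x = y" if "\<And>\<xi> \<eta>. y \<xi> \<bullet> \<eta> = \<xi> \<bullet> x \<eta>"
  proof (rule blinfun_eqI)
    show "adj x \<xi> = y \<xi>" for \<xi>
      by (rule vector_eq_rdot[THEN iffD1]) (simp add: that adj y0)
  qed
qed

lemma op_simps:
  fixes x y z :: "'h::chilbert_space \<Rightarrow>\<^sub>L 'h"
  shows compose_add_left: "(x + y) \<cdot> z = x \<cdot> z + y \<cdot> z"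
    and compose_add_right: "z \<cdot> (x + y) = z \<cdot> x + z \<cdot> y"
    and compose_diff_left: "(x - y) \<cdot> z = x \<cdot> z - y \<cdot> z"
    and compose_diff_right: "z \<cdot> (x - y) = z \<cdot> x - z \<cdot> y"
    and compose_scaleR_left: "(r *\<^sub>R x) \<cdot> z = r *\<^sub>R (x \<cdot> z)"
    and compose_scaleR_right: "z \<cdot> (r *\<^sub>R x) = r *\<^sub>R (z \<cdot> x)"
    and compose_minus_left: "(- x) \<cdot> z = - (x \<cdot> z)"
    and compose_minus_right: "z \<cdot> (- x) = - (z \<cdot> x)"
    and compose_assoc: "(x \<cdot> y) \<cdot> z = x \<cdot> (y \<cdot> z)"
    and compose_id: "id_blinfun \<cdot> x = x" "x \<cdot> id_blinfun = x"
  by (auto intro!: blinfun_eqI simp: blinfun.bilinear_simps)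

lemma scaleC_blinfun_apply: "blinfun_apply (a *\<^sub>C x) \<xi> = a *\<^sub>C blinfun_apply x \<xi>"
  by transfer simp

lemma compose_scaleC:
  "(a *\<^sub>C x) \<cdot> y = a *\<^sub>C (x \<cdot> y)"
  "x \<in> cbounded_ops \<Longrightarrow> x \<cdot> (a *\<^sub>C y) = a *\<^sub>C (x \<cdot> y)"
  for x :: "'h::chilbert_space \<Rightarrow>\<^sub>L 'h"
  by (auto intro!: blinfun_eqI simp: scaleC_blinfun_apply cbounded_ops_def)

lemma scaleC_right_commute: "a *\<^sub>C b *\<^sub>C x = b *\<^sub>C a *\<^sub>C (x :: 'a::complex_vector)"
  by (simp add: scaleC_scaleC mult.commute)

lemma cbounded_ops_closed:
  shows cbounded_id: "id_blinfun \<in> cbounded_ops"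
    and cbounded_add: "x \<in> cbounded_ops \<Longrightarrow> y \<in> cbounded_ops \<Longrightarrow> x + y \<in> cbounded_ops"
    and cbounded_scaleC: "x \<in> cbounded_ops \<Longrightarrow> a *\<^sub>C x \<in> cbounded_ops"
    and cbounded_compose: "x \<in> cbounded_ops \<Longrightarrow> y \<in> cbounded_ops \<Longrightarrow> x \<cdot> y \<in> cbounded_ops"
  by (auto simp: cbounded_ops_def blinfun.bilinear_simps scaleC_add_right scaleC_blinfun_apply
      intro: scaleC_right_commute)

lemma adj_adj: "x \<in> cbounded_ops \<Longrightarrow> adj (adj x) = x"
  by (intro adj_eqI adj_cbounded) (simp_all add: inner_commute[of _ "adj x _"] inner_commute[of _ "x _"] inner_adj)

lemma adj_compose:
  "x \<in> cbounded_ops \<Longrightarrow> y \<in> cbounded_ops \<Longrightarrow> adj (x \<cdot> y) = adj y \<cdot> adj x"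
  by (intro adj_eqI cbounded_compose) (auto simp: inner_adj)

lemma adj_add:
  "x \<in> cbounded_ops \<Longrightarrow> y \<in> cbounded_ops \<Longrightarrow> adj (x + y) = adj x + adj y"
  by (intro adj_eqI cbounded_add) (auto simp: inner_adj blinfun.bilinear_simps inner_add_left inner_add_right)

lemma adj_id: "adj id_blinfun = id_blinfun"
  by (intro adj_eqI cbounded_id) auto

lemma scaleC_inner_left: "(a *\<^sub>C x) \<bullet> y = x \<bullet> (cnj a *\<^sub>C (y::'a::complex_inner))"
proof -
  obtain p q where a: "a = Complex p q" by (cases a)
  then have "cnj a = Complex p (- q)" by (simp add: complex_eq_iff)
  with a show ?thesis
    by (simp add: scaleC_complex_of_real inner_add_left inner_add_right inner_diff_right i_inner_left del: complex_cnj)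
qed

lemma adj_scaleC: "x \<in> cbounded_ops \<Longrightarrow> adj (a *\<^sub>C x) = cnj a *\<^sub>C adj x"
  by (intro adj_eqI cbounded_scaleC)
    (auto simp: inner_adj scaleC_blinfun_apply scaleC_inner_left cbounded_ops_def)

lemma norm_adj_le:
  assumes x: "x \<in> cbounded_ops"
  shows "norm (adj x) \<le> norm x"
proof (rule norm_blinfun_bound)
  fix \<xi>
  have "norm (adj x \<xi>) * norm (adj x \<xi>) = \<xi> \<bullet> x (adj x \<xi>)"
    by (simp add: inner_adj[OF x, symmetric] flip: power2_norm_eq_inner power2_eq_square)
  also have "\<dots> \<le> norm \<xi> * (norm x * norm (adj x \<xi>))"
    by (rule order_trans[OF norm_cauchy_schwarz]) (intro mult_left_mono norm_blinfun, simp)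
  finally have "norm (adj x \<xi>) * norm (adj x \<xi>) \<le> norm (adj x \<xi>) * (norm x * norm \<xi>)"
    by (simp add: algebra_simps)
  then show "norm (adj x \<xi>) \<le> norm x * norm \<xi>"
    by (cases "adj x \<xi> = 0") auto
qed simp

section \<open>The 2-norm of a tracial von Neumann algebra\<close>

lemma commutant_closed:
  fixes S :: "('h::chilbert_space \<Rightarrow>\<^sub>L 'h) set"
  shows commutant_cbounded: "x \<in> commutant S \<Longrightarrow> x \<in> cbounded_ops"
    and commutant_commutes: "x \<in> commutant S \<Longrightarrow> y \<in> S \<Longrightarrow> x \<cdot> y = y \<cdot> x"
    and commutant_id: "id_blinfun \<in> commutant S"
    and commutant_add: "x \<in> commutant S \<Longrightarrow> y \<in> commutant S \<Longrightarrow> x + y \<in> commutant S"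
    and commutant_compose: "x \<in> commutant S \<Longrightarrow> y \<in> commutant S \<Longrightarrow> x \<cdot> y \<in> commutant S"
    and commutant_scaleC: "S \<subseteq> cbounded_ops \<Longrightarrow> x \<in> commutant S \<Longrightarrow> a *\<^sub>C x \<in> commutant S"
  by (auto simp: commutant_def cbounded_ops_closed op_simps compose_scaleC subset_iff)
    (metis compose_assoc)

lemma commutant_subset_cbounded: "commutant S \<subseteq> cbounded_ops"
  using commutant_cbounded by blast

lemma adj_commutant:
  assumes S: "S \<subseteq> cbounded_ops" "\<And>y. y \<in> S \<Longrightarrow> adj y \<in> S" and x: "x \<in> commutant S"
  shows "adj x \<in> commutant S"
proof -
  have xc: "x \<in> cbounded_ops" using commutant_cbounded x by blast
  have "adj x \<cdot> y = y \<cdot> adj x" if y: "y \<in> S" for y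
  proof -
    have yc: "y \<in> cbounded_ops" using S y by blast
    have "adj (adj y \<cdot> x) = adj (x \<cdot> adj y)"
      using commutant_commutes[OF x S(2)[OF y]] by simp
    then show ?thesis
      using xc yc by (simp add: adj_compose adj_cbounded adj_adj)
  qed
  then show ?thesis using xc by (simp add: commutant_def adj_cbounded)
qed

lemma von_neumann_algebra_closed:
  assumes M: "von_neumann_algebra M"
  shows vn_cbounded: "x \<in> M \<Longrightarrow> x \<in> cbounded_ops"
    and vn_id: "id_blinfun \<in> M"
    and vn_add: "x \<in> M \<Longrightarrow> y \<in> M \<Longrightarrow> x + y \<in> M"
    and vn_compose: "x \<in> M \<Longrightarrow> y \<in> M \<Longrightarrow> x \<cdot> y \<in> M"
    and vn_scaleC: "x \<in> M \<Longrightarrow> a *\<^sub>C x \<in> M"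
    and vn_adj: "x \<in> M \<Longrightarrow> adj x \<in> M"
    and vn_bicommutant: "commutant (commutant M) = M"
proof -
  have eq: "commutant (commutant M) = M" using M by (simp add: von_neumann_algebra_def)
  show "commutant (commutant M) = M" by (rule eq)
  show "x \<in> M \<Longrightarrow> x \<in> cbounded_ops" using commutant_cbounded eq by metis
  show "id_blinfun \<in> M" using commutant_id eq by metis
  show "x \<in> M \<Longrightarrow> y \<in> M \<Longrightarrow> x + y \<in> M" using commutant_add eq by metis
  show "x \<in> M \<Longrightarrow> y \<in> M \<Longrightarrow> x \<cdot> y \<in> M" using commutant_compose eq by metis
  show "x \<in> M \<Longrightarrow> a *\<^sub>C x \<in> M" using commutant_scaleC commutant_subset_cbounded eq by metis
  show "x \<in> M \<Longrightarrow> adj x \<in> M" using M by (simp add: von_neumann_algebra_def)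
qed

lemma vn_scaleR: "von_neumann_algebra M \<Longrightarrow> x \<in> M \<Longrightarrow> r *\<^sub>R x \<in> M"
  using vn_scaleC[of M x "complex_of_real r"] by (simp only: scaleC_of_real)

lemma vn_zero: "von_neumann_algebra M \<Longrightarrow> 0 \<in> M"
  using vn_scaleR[OF _ vn_id, of M 0] by simp

lemma vn_uminus: "von_neumann_algebra M \<Longrightarrow> x \<in> M \<Longrightarrow> - x \<in> M"
  using vn_scaleR[of M x "-1"] by simp

lemma vn_diff: "von_neumann_algebra M \<Longrightarrow> x \<in> M \<Longrightarrow> y \<in> M \<Longrightarrow> x - y \<in> M"
  using vn_add[of M x "- y"] vn_uminus by fastforce

lemma adj_scaleR: "x \<in> cbounded_ops \<Longrightarrow> adj (r *\<^sub>R x) = r *\<^sub>R adj x"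
  using adj_scaleC[of x "complex_of_real r"] by (simp add: scaleC_of_real)

lemma adj_uminus: "x \<in> cbounded_ops \<Longrightarrow> adj (- x) = - adj x"
  using adj_scaleR[of x "-1"] by simp

lemma cbounded_uminus: "x \<in> cbounded_ops \<Longrightarrow> - x \<in> cbounded_ops"
  using cbounded_scaleC[of x "complex_of_real (-1)"] by (simp only: scaleC_of_real) simp

lemma adj_diff: "x \<in> cbounded_ops \<Longrightarrow> y \<in> cbounded_ops \<Longrightarrow> adj (x - y) = adj x - adj y"
  using adj_add[of x "- y"] by (simp add: adj_uminus cbounded_uminus)

locale tracial_vn =
  fixes M :: "('h::chilbert_space \<Rightarrow>\<^sub>L 'h) set" and \<tau> :: "('h \<Rightarrow>\<^sub>L 'h) \<Rightarrow> complex"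
  assumes tracial: "tracial_vn_algebra M \<tau>"
begin

lemma M_vn: "von_neumann_algebra M"
  using tracial by (simp add: tracial_vn_algebra_def)

lemmas M_closed [simp] = vn_cbounded[OF M_vn] vn_id[OF M_vn] vn_add[OF M_vn] vn_compose[OF M_vn]
  vn_scaleC[OF M_vn] vn_adj[OF M_vn] vn_scaleR[OF M_vn] vn_zero[OF M_vn] vn_uminus[OF M_vn]
  vn_diff[OF M_vn]

lemmas adj_simps = adj_compose adj_add adj_diff adj_scaleR adj_uminus adj_adj adj_id

lemma tau_linear:
  shows tau_add: "x \<in> M \<Longrightarrow> y \<in> M \<Longrightarrow> \<tau> (x + y) = \<tau> x + \<tau> y"
    and tau_scaleC: "x \<in> M \<Longrightarrow> \<tau> (a *\<^sub>C x) = a * \<tau> x"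
    and tau_scaleR: "x \<in> M \<Longrightarrow> \<tau> (r *\<^sub>R x) = r * \<tau> x"
    and tau_diff: "x \<in> M \<Longrightarrow> y \<in> M \<Longrightarrow> \<tau> (x - y) = \<tau> x - \<tau> y"
    and tau_zero: "\<tau> 0 = 0"
    and tau_id: "\<tau> id_blinfun = 1"
proof -
  have st: "state_on M \<tau>" using tracial by (simp add: tracial_vn_algebra_def)
  show add: "x \<in> M \<Longrightarrow> y \<in> M \<Longrightarrow> \<tau> (x + y) = \<tau> x + \<tau> y" for x y
    using st by (simp add: state_on_def)
  show "x \<in> M \<Longrightarrow> \<tau> (a *\<^sub>C x) = a * \<tau> x" for x a
    using st by (simp add: state_on_def)
  from this[of x "complex_of_real r" for x r]
  show sc: "x \<in> M \<Longrightarrow> \<tau> (r *\<^sub>R x) = r * \<tau> x" for x r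
    by (simp add: scaleC_of_real)
  show "x \<in> M \<Longrightarrow> y \<in> M \<Longrightarrow> \<tau> (x - y) = \<tau> x - \<tau> y"
    using add[of x "- y"] sc[of y "-1"] by simp
  show "\<tau> 0 = 0" using sc[of 0 0] by simp
  show "\<tau> id_blinfun = 1" using st by (simp add: state_on_def)
qed

lemma tau_commute: "x \<in> M \<Longrightarrow> y \<in> M \<Longrightarrow> \<tau> (x \<cdot> y) = \<tau> (y \<cdot> x)"
  using tracial by (simp add: tracial_vn_algebra_def tracial_on_def)

lemma tau_pos:
  assumes "x \<in> M"
  shows "0 \<le> Re (\<tau> (adj x \<cdot> x))" "Im (\<tau> (adj x \<cdot> x)) = 0"
proof -
  have "\<tau> (adj x \<cdot> x) \<in> \<real>\<^sub>\<ge>\<^sub>0"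
    using tracial assms by (simp add: tracial_vn_algebra_def state_on_def)
  then show "0 \<le> Re (\<tau> (adj x \<cdot> x))" "Im (\<tau> (adj x \<cdot> x)) = 0"
    by (auto simp: complex_nonneg_Reals_iff)
qed

text \<open>
  Positivity makes the trace Hermitian: expand the trace of \<open>(1 + \<i> z)* (1 + \<i> z)\<close>, which is real.
\<close>

lemma Re_tau_adj:
  assumes z: "z \<in> M"
  shows "Re (\<tau> (adj z)) = Re (\<tau> z)"
proof -
  let ?i = "\<i> *\<^sub>C z"
  have "Im (\<tau> (adj (id_blinfun + ?i) \<cdot> (id_blinfun + ?i))) = 0"
    "Im (\<tau> (adj ?i \<cdot> ?i)) = 0"
    using z by (intro tau_pos; simp)+
  then show ?thesis
    using z by (simp add: adj_simps op_simps tau_linear adj_scaleC compose_scaleC)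
qed

text \<open>The real inner product \<open>Re \<tau>(x* y)\<close>, whose norm is the 2-norm.\<close>

definition rp :: "('h \<Rightarrow>\<^sub>L 'h) \<Rightarrow> ('h \<Rightarrow>\<^sub>L 'h) \<Rightarrow> real"
  where "rp x y = Re (\<tau> (adj x \<cdot> y))"

lemma rp_bilinear:
  shows rp_add_left: "x \<in> M \<Longrightarrow> y \<in> M \<Longrightarrow> z \<in> M \<Longrightarrow> rp (x + y) z = rp x z + rp y z"
    and rp_add_right: "x \<in> M \<Longrightarrow> y \<in> M \<Longrightarrow> z \<in> M \<Longrightarrow> rp z (x + y) = rp z x + rp z y"
    and rp_diff_left: "x \<in> M \<Longrightarrow> y \<in> M \<Longrightarrow> z \<in> M \<Longrightarrow> rp (x - y) z = rp x z - rp y z"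
    and rp_diff_right: "x \<in> M \<Longrightarrow> y \<in> M \<Longrightarrow> z \<in> M \<Longrightarrow> rp z (x - y) = rp z x - rp z y"
    and rp_scaleR_left: "x \<in> M \<Longrightarrow> z \<in> M \<Longrightarrow> rp (r *\<^sub>R x) z = r * rp x z"
    and rp_scaleR_right: "x \<in> M \<Longrightarrow> z \<in> M \<Longrightarrow> rp z (r *\<^sub>R x) = r * rp z x"
  by (simp_all add: rp_def adj_simps op_simps tau_linear)

lemma rp_sym: "x \<in> M \<Longrightarrow> y \<in> M \<Longrightarrow> rp x y = rp y x"
  using Re_tau_adj[of "adj x \<cdot> y"] by (simp add: rp_def adj_simps)

lemma rp_mult_left: "z \<in> M \<Longrightarrow> x \<in> M \<Longrightarrow> y \<in> M \<Longrightarrow> rp (z \<cdot> x) y = rp x (adj z \<cdot> y)"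
  by (simp add: rp_def adj_simps compose_assoc)

lemma rp_adj: "x \<in> M \<Longrightarrow> y \<in> M \<Longrightarrow> rp (adj x) (adj y) = rp x y"
  using rp_sym[of x y] tau_commute[of x "adj y"] by (simp add: rp_def adj_simps)

abbreviation n2 :: "('h \<Rightarrow>\<^sub>L 'h) \<Rightarrow> real" where "n2 \<equiv> norm2 \<tau>"

lemma n2_sq: "x \<in> M \<Longrightarrow> (n2 x)\<^sup>2 = rp x x"
  using tau_pos(1)[of x] by (simp add: norm2_def rp_def)

lemma n2_nonneg: "x \<in> M \<Longrightarrow> 0 \<le> n2 x"
  using tau_pos(1)[of x] by (simp add: norm2_def)

lemma n2_eq_0: "x \<in> M \<Longrightarrow> n2 x = 0 \<Longrightarrow> x = 0"
proof -
  assume x: "x \<in> M" "n2 x = 0"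
  then have "\<tau> (adj x \<cdot> x) = 0"
    using tau_pos[of x] by (simp add: norm2_def complex_eq_iff)
  then show "x = 0"
    using tracial x by (simp add: tracial_vn_algebra_def faithful_on_def)
qed

lemma n2_id: "n2 id_blinfun = 1"
  by (simp add: norm2_def adj_simps op_simps tau_linear)

lemma n2_zero: "n2 0 = 0"
  by (simp add: norm2_def tau_linear)

lemma n2_adj: "x \<in> M \<Longrightarrow> n2 (adj x) = n2 x"
  using rp_adj[of x x] by (simp add: norm2_def rp_def)

lemma n2_scaleR: "x \<in> M \<Longrightarrow> n2 (r *\<^sub>R x) = \<bar>r\<bar> * n2 x"
  using rp_scaleR_left[of x "r *\<^sub>R x" r] rp_scaleR_right[of x x r]
  by (simp add: norm2_def real_sqrt_mult flip: rp_def power2_eq_square mult.assoc)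

lemma n2_uminus: "x \<in> M \<Longrightarrow> n2 (- x) = n2 x"
  using n2_scaleR[of x "-1"] by simp

lemma n2_minus_commute: "x \<in> M \<Longrightarrow> y \<in> M \<Longrightarrow> n2 (x - y) = n2 (y - x)"
  using n2_uminus[of "x - y"] by simp

lemma n2_scaleC: "x \<in> M \<Longrightarrow> n2 (a *\<^sub>C x) = cmod a * n2 x"
proof -
  assume x: "x \<in> M"
  have "adj (a *\<^sub>C x) \<cdot> (a *\<^sub>C x) = (a * cnj a) *\<^sub>C (adj x \<cdot> x)"
    using x by (simp add: adj_scaleC compose_scaleC scaleC_scaleC mult.commute)
  then have "\<tau> (adj (a *\<^sub>C x) \<cdot> (a *\<^sub>C x)) = (complex_of_real ((cmod a)\<^sup>2)) * \<tau> (adj x \<cdot> x)"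
    using x by (simp only: tau_scaleC[OF M_closed(4)] M_closed complex_norm_square)
  then show ?thesis
    by (simp add: norm2_def real_sqrt_mult)
qed

lemma n2_Cauchy_Schwarz:
  assumes "x \<in> M" "y \<in> M"
  shows "rp x y \<le> n2 x * n2 y"
proof -
  have "0 \<le> rp x x + 2 * s * rp x y + s\<^sup>2 * rp y y" for s
  proof -
    have "0 \<le> rp (x + s *\<^sub>R y) (x + s *\<^sub>R y)"
      using assms by (simp add: n2_sq[symmetric])
    also have "\<dots> = rp x x + 2 * s * rp x y + s\<^sup>2 * rp y y"
      using assms rp_sym[of y x] by (simp add: rp_bilinear power2_eq_square algebra_simps)
    finally show ?thesis .
  qed
  then have "(rp x y)\<^sup>2 \<le> rp x x * rp y y" by (rule quadratic_nonneg_discriminant)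
  also have "\<dots> = (n2 x * n2 y)\<^sup>2"
    using assms by (simp add: n2_sq power_mult_distrib)
  finally show ?thesis
    by (rule power2_le_imp_le) (simp add: assms n2_nonneg)
qed

lemma n2_triangle: "n2 (x + y) \<le> n2 x + n2 y" if "x \<in> M" "y \<in> M"
proof -
  have "(n2 (x + y))\<^sup>2 \<le> (n2 x + n2 y)\<^sup>2"
    using that n2_Cauchy_Schwarz[of x y] rp_sym[of y x]
    by (simp add: n2_sq rp_bilinear power2_sum)
  then show ?thesis
    using that by (rule_tac power2_le_imp_le) (simp_all add: n2_nonneg)
qed

lemma n2_triangle_diff:
  assumes "x \<in> M" "y \<in> M" "z \<in> M"
  shows "n2 (x - z) \<le> n2 (x - y) + n2 (y - z)"
  using n2_triangle[of "x - y" "y - z"] assms by simp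

lemma n2_triangle_minus: "x \<in> M \<Longrightarrow> y \<in> M \<Longrightarrow> n2 (x - y) \<le> n2 x + n2 y"
  using n2_triangle[of x "- y"] by (simp add: n2_uminus)

lemma n2_parallelogram:
  assumes "x \<in> M" "y \<in> M"
  shows "(n2 (x - y))\<^sup>2 = 2 * (n2 x)\<^sup>2 + 2 * (n2 y)\<^sup>2 - 4 * (n2 ((1/2) *\<^sub>R (x + y)))\<^sup>2"
  using assms rp_sym[of y x] by (simp add: n2_sq rp_bilinear field_simps)

text \<open>
  Elements acting contractively on the 2-norm from the left. Unlike for the operator norm, the
  invariance of this notion under trace-preserving automorphisms is evident.
\<close>

definition contr :: "('h \<Rightarrow>\<^sub>L 'h) set"
  where "contr = {x \<in> M. \<forall>y\<in>M. n2 (x \<cdot> y) \<le> n2 y}"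

lemma contr_M [simp]: "x \<in> contr \<Longrightarrow> x \<in> M" by (simp add: contr_def)

lemma contr_left: "x \<in> contr \<Longrightarrow> y \<in> M \<Longrightarrow> n2 (x \<cdot> y) \<le> n2 y"
  unfolding contr_def by blast

lemma contrI: "x \<in> M \<Longrightarrow> (\<And>y. y \<in> M \<Longrightarrow> n2 (x \<cdot> y) \<le> n2 y) \<Longrightarrow> x \<in> contr"
  unfolding contr_def by blast

lemma contr_compose: assumes "x \<in> contr" "y \<in> contr" shows "x \<cdot> y \<in> contr"
proof (rule contrI)
  fix z assume "z \<in> M"
  then have "n2 (x \<cdot> (y \<cdot> z)) \<le> n2 (y \<cdot> z)" "n2 (y \<cdot> z) \<le> n2 z"
    using assms by (simp_all add: contr_left)
  then show "n2 (x \<cdot> y \<cdot> z) \<le> n2 z" by (simp add: compose_assoc)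
qed (use assms in simp)

text \<open>
  With \<open>z = x* y\<close>, Cauchy-Schwarz gives \<open>\<parallel>z\<parallel>\<^sup>2 = \<langle>y, x z\<rangle> \<le> \<parallel>y\<parallel> \<parallel>z\<parallel>\<close> for the 2-norm.
\<close>

lemma contr_adj: assumes x: "x \<in> contr" shows "adj x \<in> contr"
proof (rule contrI)
  show "adj x \<in> M" using x by simp
  fix y assume y: "y \<in> M"
  let ?z = "adj x \<cdot> y"
  have "n2 ?z * n2 ?z = rp y (x \<cdot> ?z)"
    using x y by (simp add: rp_mult_left adj_simps n2_sq flip: power2_eq_square)
  also have "\<dots> \<le> n2 y * n2 (x \<cdot> ?z)"
    using x y by (intro n2_Cauchy_Schwarz) auto
  also have "\<dots> \<le> n2 y * n2 ?z"
    using x y by (intro mult_left_mono contr_left n2_nonneg) auto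
  finally show "n2 ?z \<le> n2 y"
    using x y n2_nonneg[of ?z] n2_nonneg[of y] by (cases "n2 ?z = 0") auto
qed

lemma contr_right: assumes "x \<in> contr" "y \<in> M" shows "n2 (y \<cdot> x) \<le> n2 y"
  using contr_left[OF contr_adj, of x "adj y"] n2_adj[of "y \<cdot> x"] n2_adj[of y] assms
  by (simp add: adj_simps)

lemma contr_n2: "x \<in> contr \<Longrightarrow> n2 x \<le> 1"
  using contr_left[of x id_blinfun] by (simp add: n2_id op_simps)

text \<open>
  A contraction whose 2-norm is close to 1 is almost isometric: with \<open>b = u* u\<close> the left side is
  \<open>1 - 2 \<tau>(b) + \<tau>(b\<^sup>2)\<close>, where \<open>\<tau>(b) = \<parallel>u\<parallel>\<^sup>2\<close> and \<open>\<tau>(b\<^sup>2) \<le> \<tau>(b)\<close>.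
\<close>

lemma n2_diff_adj_compose:
  assumes u: "u \<in> contr"
  shows "(n2 (id_blinfun - adj u \<cdot> u))\<^sup>2 \<le> 1 - (n2 u)\<^sup>2"
proof -
  have "n2 (adj u \<cdot> u) \<le> n2 u"
    using u by (intro contr_left contr_adj) auto
  then have "(n2 (adj u \<cdot> u))\<^sup>2 \<le> (n2 u)\<^sup>2"
    using u by (intro power_mono n2_nonneg) auto
  moreover have "rp id_blinfun (adj u \<cdot> u) = (n2 u)\<^sup>2"
    using u by (simp add: rp_def n2_sq adj_simps op_simps)
  moreover have "rp id_blinfun id_blinfun = 1"
    by (simp add: rp_def adj_simps op_simps tau_linear)
  ultimately show ?thesis
    using u rp_sym[of "adj u \<cdot> u" id_blinfun] by (simp add: n2_sq rp_bilinear)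
qed

lemma n2_diff_compose_adj: "u \<in> contr \<Longrightarrow> (n2 (id_blinfun - u \<cdot> adj u))\<^sup>2 \<le> 1 - (n2 u)\<^sup>2"
  using n2_diff_adj_compose[OF contr_adj, of u] by (simp add: n2_adj adj_adj)

text \<open>
  One step \<open>u (3 - b) / 2\<close>, \<open>b = u* u\<close>, of the Newton iteration towards the polar part of \<open>u\<close>.
\<close>

definition newton :: "('h \<Rightarrow>\<^sub>L 'h) \<Rightarrow> ('h \<Rightarrow>\<^sub>L 'h)"
  where "newton u = (1/2) *\<^sub>R (u \<cdot> (3 *\<^sub>R id_blinfun - adj u \<cdot> u))"

text \<open>
  Both are the identity \<open>b (3 - b)\<^sup>2 / 4 = 1 - (1 - b)\<^sup>2 + b (1 - b)\<^sup>2 / 4 = 2 b - b\<^sup>2 + b (1 - b)\<^sup>2 / 4\<close>,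
  evaluated in the vector functional of \<open>y\<close>. The first form shows that the step stays contractive,
  the second that it gains at least \<open>\<tau>(b - b\<^sup>2)\<close> in the square of the 2-norm.
\<close>

lemma newton_expand:
  assumes u: "u \<in> M" and y: "y \<in> M"
  defines "b \<equiv> adj u \<cdot> u"
  shows "(n2 (newton u \<cdot> y))\<^sup>2 =
      (n2 y)\<^sup>2 - (n2 (y - b \<cdot> y))\<^sup>2 + (n2 (u \<cdot> (y - b \<cdot> y)))\<^sup>2 / 4"
    and "(n2 (newton u \<cdot> y))\<^sup>2 =
      2 * (n2 (u \<cdot> y))\<^sup>2 - (n2 (b \<cdot> y))\<^sup>2 + (n2 (u \<cdot> (y - b \<cdot> y)))\<^sup>2 / 4"
proof -
  define p where "p = u \<cdot> y"
  define q where "q = u \<cdot> (b \<cdot> y)"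
  have M: "b \<in> M" "p \<in> M" "q \<in> M" using u y by (auto simp: b_def p_def q_def)
  have ny: "newton u \<cdot> y = (1/2) *\<^sub>R (3 *\<^sub>R p - q)"
    using u y by (simp add: newton_def p_def q_def b_def op_simps)
  have zu: "u \<cdot> (y - b \<cdot> y) = p - q"
    by (simp add: p_def q_def op_simps)
  have yb: "rp y (b \<cdot> y) = rp p p" "rp (b \<cdot> y) (b \<cdot> y) = rp p q" "rp (b \<cdot> y) y = rp p p"
    using u y M by (simp_all add: b_def p_def q_def rp_def adj_simps compose_assoc)
  have qp: "rp q p = rp p q" using M by (simp add: rp_sym)
  show "(n2 (newton u \<cdot> y))\<^sup>2 =
      (n2 y)\<^sup>2 - (n2 (y - b \<cdot> y))\<^sup>2 + (n2 (u \<cdot> (y - b \<cdot> y)))\<^sup>2 / 4"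
    unfolding ny zu using M y by (simp add: n2_sq rp_bilinear yb qp field_simps)
  show "(n2 (newton u \<cdot> y))\<^sup>2 =
      2 * (n2 (u \<cdot> y))\<^sup>2 - (n2 (b \<cdot> y))\<^sup>2 + (n2 (u \<cdot> (y - b \<cdot> y)))\<^sup>2 / 4"
    unfolding ny zu p_def[symmetric] using M y by (simp add: n2_sq rp_bilinear yb qp field_simps)
qed

lemma newton_contr: assumes u: "u \<in> contr" shows "newton u \<in> contr"
proof (rule contrI)
  show "newton u \<in> M" using u by (simp add: newton_def)
  fix y assume y: "y \<in> M"
  define z where "z = y - adj u \<cdot> u \<cdot> y"
  have z: "z \<in> M" using u y by (simp add: z_def)
  have "(n2 (u \<cdot> z))\<^sup>2 \<le> (n2 z)\<^sup>2"
    using u z by (intro power_mono contr_left n2_nonneg) auto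
  moreover have "0 \<le> (n2 z)\<^sup>2" by simp
  ultimately have "(n2 (newton u \<cdot> y))\<^sup>2 \<le> (n2 y)\<^sup>2"
    using newton_expand(1)[OF contr_M[OF u] y] unfolding z_def by linarith
  then show "n2 (newton u \<cdot> y) \<le> n2 y"
    using y by (rule_tac power2_le_imp_le) (simp_all add: n2_nonneg)
qed

lemma newton_gain:
  assumes u: "u \<in> M"
  shows "2 * (n2 u)\<^sup>2 - (n2 (adj u \<cdot> u))\<^sup>2 \<le> (n2 (newton u))\<^sup>2"
  using newton_expand(2)[OF u, of id_blinfun] by (simp add: op_simps)

end

section \<open>Completeness of the unit ball in the 2-norm\<close>

lemma norm_cinner_le: "cmod (cinner x y) \<le> norm x * norm (y :: 'a::complex_inner)"
proof (cases "cinner x y = 0")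
  case False
  define c where "c = cinner x y"
  \<comment> \<open>The phase that makes the inner product real and positive.\<close>
  define a where "a = cnj c / cmod c"
  have c: "c \<noteq> 0" using False by (simp add: c_def)
  have "cinner x (a *\<^sub>C y) = cmod c"
    using c by (simp add: cinner_scaleC_right a_def complex_norm_square[symmetric] power2_eq_square
        mult.commute flip: c_def)
  then have "cmod c = x \<bullet> (a *\<^sub>C y)" by (metis Re_cinner Re_complex_of_real)
  also have "\<dots> \<le> norm x * norm (a *\<^sub>C y)" by (rule norm_cauchy_schwarz)
  also have "norm (a *\<^sub>C y) = norm y" using c by (simp add: norm_scaleC a_def norm_divide)
  finally show ?thesis by (simp add: c_def)
qed (simp)

text \<open>
  Phrased as a commutation, complex linearity passes to weak operator limits in the same way
  as membership in a commutant does.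
\<close>

lemma cbounded_iff_commute: "x \<in> cbounded_ops \<longleftrightarrow> x \<cdot> (\<i> *\<^sub>C id_blinfun) = (\<i> *\<^sub>C id_blinfun) \<cdot> x"
proof
  assume "x \<cdot> (\<i> *\<^sub>C id_blinfun) = (\<i> *\<^sub>C id_blinfun) \<cdot> x"
  then have "(x \<cdot> (\<i> *\<^sub>C id_blinfun)) \<xi> = ((\<i> *\<^sub>C id_blinfun) \<cdot> x) \<xi>" for \<xi> by simp
  then show "x \<in> cbounded_ops"
    by (simp add: cbounded_ops_iff_i scaleC_blinfun_apply)
qed (auto intro!: blinfun_eqI simp: cbounded_ops_iff_i scaleC_blinfun_apply)

text \<open>
  Weak operator convergence. Testing against real inner products is enough, because \<open>\<xi>\<close> may be
  replaced by \<open>\<i> \<xi>\<close>.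
\<close>

definition wot_tendsto :: "(nat \<Rightarrow> 'h::chilbert_space \<Rightarrow>\<^sub>L 'h) \<Rightarrow> ('h \<Rightarrow>\<^sub>L 'h) \<Rightarrow> nat filter \<Rightarrow> bool"
  where "wot_tendsto x y F \<longleftrightarrow> (\<forall>\<xi> \<eta>. ((\<lambda>n. \<xi> \<bullet> x n \<eta>) \<longlongrightarrow> \<xi> \<bullet> y \<eta>) F)"

lemma filtercomap_inf_nontrivial:
  assumes "inf F (filtermap f G) \<noteq> bot"
  shows "inf G (filtercomap f F) \<noteq> bot"
proof
  assume "inf G (filtercomap f F) = bot"
  then obtain P Q where PQ: "eventually P G" "eventually Q (filtercomap f F)" "\<And>x. P x \<Longrightarrow> Q x \<Longrightarrow> False"
    unfolding trivial_limit_def eventually_inf by blast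
  obtain R where R: "eventually R F" "\<And>x. R (f x) \<Longrightarrow> Q x"
    using PQ(2) by (auto simp: eventually_filtercomap)
  have "eventually (\<lambda>y. \<not> R y) (filtermap f G)"
    using PQ(1) by (auto simp: eventually_filtermap elim!: eventually_mono dest: R(2) PQ(3))
  with R(1) have "eventually (\<lambda>_. False) (inf F (filtermap f G))"
    unfolding eventually_inf by blast
  with assms show False by (simp add: eventually_False)
qed

text \<open>
  The real matrix coefficients of the \<open>x n\<close> lie in a product of compact intervals. By Tychonoff
  they have a cluster point, which is a bounded bilinear form and hence comes from an operator. The
  unit ball need not be metrizable, so the cluster point is reached along a filter finer than the
  sequence and not along a subsequence.
\<close>

theorem wot_compact:
  fixes x :: "nat \<Rightarrow> 'h::chilbert_space \<Rightarrow>\<^sub>L 'h"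
  assumes x: "\<And>n. norm (x n) \<le> 1"
  shows "\<exists>y F. F \<noteq> bot \<and> F \<le> sequentially \<and> norm y \<le> 1 \<and> wot_tendsto x y F"
proof -
  define f where "f n = (\<lambda>(\<xi>, \<eta>). \<xi> \<bullet> x n \<eta>)" for n
  define K where "K = (\<Pi>\<^sub>E p\<in>UNIV. cball (0::real) (norm (fst p :: 'h) * norm (snd p :: 'h)))"
  have bnd: "\<bar>\<xi> \<bullet> x n \<eta>\<bar> \<le> norm \<xi> * norm \<eta>" for n \<xi> \<eta>
  proof -
    have "\<bar>\<xi> \<bullet> x n \<eta>\<bar> \<le> norm \<xi> * norm (x n \<eta>)" by (rule Cauchy_Schwarz_ineq2)
    also have "\<dots> \<le> norm \<xi> * (1 * norm \<eta>)"
      by (intro mult_left_mono order_trans[OF norm_blinfun] mult_right_mono x) auto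
    finally show ?thesis by simp
  qed
  have "compactin (product_topology (\<lambda>_. euclidean) UNIV) K"
    unfolding K_def by (subst compactin_PiE) (auto simp: compactin_euclidean_iff)
  then have K: "compact K" by (simp add: euclidean_product_topology compactin_euclidean_iff)
  have fK: "f n \<in> K" for n
    using bnd by (auto simp: K_def f_def)
  have "filtermap f sequentially \<noteq> bot" "eventually (\<lambda>g. g \<in> K) (filtermap f sequentially)"
    using fK by (auto simp: filtermap_bot_iff eventually_filtermap)
  with K obtain g where g: "g \<in> K" "inf (nhds g) (filtermap f sequentially) \<noteq> bot"
    unfolding compact_filter by blast
  define F where "F = inf sequentially (filtercomap f (nhds g))"
  have F: "F \<noteq> bot" "F \<le> sequentially"
    unfolding F_def using filtercomap_inf_nontrivial[OF g(2)] by auto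
  have fg: "(f \<longlongrightarrow> g) F"
    unfolding F_def by (rule filterlim_mono[OF filterlim_filtercomap]) auto
  have "((\<lambda>n. f n p) \<longlongrightarrow> g p) F" for p
  proof (rule topological_tendstoI)
    fix U :: "real set" assume U: "open U" "g p \<in> U"
    have "open ((\<lambda>h :: 'h \<times> 'h \<Rightarrow> real. h p) -` U)"
      by (rule open_vimage[OF U(1) continuous_on_product_coordinates])
    from topological_tendstoD[OF fg this] U(2) show "eventually (\<lambda>n. f n p \<in> U) F" by simp
  qed
  then have lim: "((\<lambda>n. \<xi> \<bullet> x n \<eta>) \<longlongrightarrow> g (\<xi>, \<eta>)) F" for \<xi> \<eta>
    unfolding f_def by (metis (mono_tags, lifting) case_prod_conv tendsto_cong always_eventually)
  have gb: "\<bar>g (\<xi>, \<eta>)\<bar> \<le> norm \<xi> * norm \<eta>" for \<xi> \<eta>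
    using g(1) by (force simp: K_def PiE_def Pi_def)
  have "bounded_linear (\<lambda>\<xi>. g (\<xi>, \<eta>))" for \<eta>
  proof (rule bounded_linear_intro[where K = "norm \<eta>"])
    show "g (a + b, \<eta>) = g (a, \<eta>) + g (b, \<eta>)" for a b
    proof (rule tendsto_unique[OF F(1) lim])
      show "((\<lambda>n. (a + b) \<bullet> x n \<eta>) \<longlongrightarrow> g (a, \<eta>) + g (b, \<eta>)) F"
        unfolding inner_add_left by (intro tendsto_intros lim)
    qed
    show "g (r *\<^sub>R a, \<eta>) = r *\<^sub>R g (a, \<eta>)" for r a
    proof (rule tendsto_unique[OF F(1) lim])
      show "((\<lambda>n. (r *\<^sub>R a) \<bullet> x n \<eta>) \<longlongrightarrow> r *\<^sub>R g (a, \<eta>)) F"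
        unfolding inner_scaleR_left real_scaleR_def by (intro tendsto_intros lim)
    qed
  qed (use gb in simp)
  then have "\<exists>z. \<forall>\<xi>. g (\<xi>, \<eta>) = z \<bullet> \<xi>" for \<eta>
    by (rule riesz_representation)
  then obtain y where y: "g (\<xi>, \<eta>) = \<xi> \<bullet> y \<eta>" for \<xi> \<eta>
    by (metis inner_commute)
  have ybnd: "norm (y \<eta>) \<le> norm \<eta>" for \<eta>
    using gb[of "y \<eta>" \<eta>] unfolding y
    by (cases "y \<eta> = 0") (auto simp flip: power2_norm_eq_inner simp: power2_eq_square)
  have yl: "bounded_linear y"
  proof (rule bounded_linear_intro[where K = 1])
    show "y (a + b) = y a + y b" for a b
    proof (rule vector_eq_ldot[THEN iffD1], rule allI)
      fix \<xi>
      have "((\<lambda>n. \<xi> \<bullet> x n (a + b)) \<longlongrightarrow> \<xi> \<bullet> y a + \<xi> \<bullet> y b) F"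
        unfolding blinfun.add_right inner_add_right using lim by (intro tendsto_add) (simp_all add: y)
      with lim[of \<xi> "a + b"] show "\<xi> \<bullet> y (a + b) = \<xi> \<bullet> (y a + y b)"
        using F(1) by (metis inner_add_right tendsto_unique y)
    qed
    show "y (r *\<^sub>R a) = r *\<^sub>R y a" for r a
    proof (rule vector_eq_ldot[THEN iffD1], rule allI)
      fix \<xi>
      have "((\<lambda>n. \<xi> \<bullet> x n (r *\<^sub>R a)) \<longlongrightarrow> r * (\<xi> \<bullet> y a)) F"
        unfolding blinfun.scaleR_right inner_scaleR_right using lim by (intro tendsto_mult_left) (simp add: y)
      with lim[of \<xi> "r *\<^sub>R a"] show "\<xi> \<bullet> y (r *\<^sub>R a) = \<xi> \<bullet> r *\<^sub>R y a"
        using F(1) by (metis inner_scaleR_right tendsto_unique y)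
    qed
  qed (use ybnd in simp)
  define Y where "Y = Blinfun y"
  have Y: "blinfun_apply Y = y" unfolding Y_def by (rule bounded_linear_Blinfun_apply[OF yl])
  have "norm Y \<le> 1" by (rule norm_blinfun_bound) (auto simp: Y ybnd)
  moreover have "wot_tendsto x Y F" unfolding wot_tendsto_def Y using lim by (simp add: y)
  ultimately show ?thesis using F by blast
qed

text \<open>
  The adjoint of \<open>z\<close> moves \<open>z\<close> to the other side of the inner product, where the limit can be taken.
\<close>

lemma wot_tendsto_commute:
  assumes x: "wot_tendsto x y F" and F: "F \<noteq> bot" and comm: "\<And>n. x n \<cdot> z = z \<cdot> x n"
  shows "y \<cdot> z = z \<cdot> y"
proof (rule blinfun_eqI)
  fix \<eta>
  obtain w where w: "blinfun_apply w \<xi> \<bullet> \<eta> = \<xi> \<bullet> z \<eta>" for \<xi> \<eta>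
    using real_adjoint_exists[of z] by blast
  have "\<xi> \<bullet> y (z \<eta>) = \<xi> \<bullet> z (y \<eta>)" for \<xi>
  proof (rule tendsto_unique[OF F])
    show "((\<lambda>n. \<xi> \<bullet> x n (z \<eta>)) \<longlongrightarrow> \<xi> \<bullet> y (z \<eta>)) F"
      using x by (simp add: wot_tendsto_def)
    have "\<xi> \<bullet> x n (z \<eta>) = w \<xi> \<bullet> x n \<eta>" for n
      using comm[of n] by (metis blinfun_apply_blinfun_compose w)
    then show "((\<lambda>n. \<xi> \<bullet> x n (z \<eta>)) \<longlongrightarrow> \<xi> \<bullet> z (y \<eta>)) F"
      using x by (simp add: wot_tendsto_def flip: w)
  qed
  then show "(y \<cdot> z) \<eta> = (z \<cdot> y) \<eta>"
    using vector_eq_ldot by auto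
qed

text \<open>
  An ultraweak functional is a series of weak-operator continuous functionals, dominated uniformly
  on bounded sets by a convergent series.
\<close>

lemma tendsto_ultraweak_open:
  assumes U: "openin ultraweak_topology U" and y: "y \<in> U"
    and x: "wot_tendsto x y F" "\<And>n. norm (x n) \<le> R" and F: "F \<noteq> bot"
  shows "eventually (\<lambda>n. x n \<in> U) F"
proof -
  have "generate_topology_on
    {(\<lambda>x. \<Sum>n. cinner (\<xi> n) (blinfun_apply x (\<eta> n))) -` U | (\<xi> :: nat \<Rightarrow> 'a) (\<eta> :: nat \<Rightarrow> 'a) U.
      summable (\<lambda>n. (norm (\<xi> n))\<^sup>2) \<and> summable (\<lambda>n. (norm (\<eta> n))\<^sup>2) \<and> open U} U"
    using U by (simp add: ultraweak_topology_def openin_topology_generated_by_iff)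
  then show ?thesis using y
  proof (induction rule: generate_topology_on.induct)
    case (UN K)
    then obtain k where "k \<in> K" "y \<in> k" by blast
    with UN.IH[of k] show ?case by (auto elim: eventually_mono)
  next
    case (Basis s)
    then obtain \<xi> \<eta> V where s: "s = (\<lambda>x. \<Sum>n. cinner (\<xi> n) (blinfun_apply x (\<eta> n))) -` V"
      and sm: "summable (\<lambda>n. (norm (\<xi> n))\<^sup>2)" "summable (\<lambda>n. (norm (\<eta> n))\<^sup>2)" and V: "open V"
      by blast
    define m where "m n = \<bar>R\<bar> * ((norm (\<xi> n))\<^sup>2 + (norm (\<eta> n))\<^sup>2)" for n
    have "summable m" unfolding m_def by (intro summable_mult summable_add sm)
    have bound: "norm (cinner (\<xi> k) (x n (\<eta> k))) \<le> m k" for k n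
    proof -
      have "norm (cinner (\<xi> k) (x n (\<eta> k))) \<le> norm (\<xi> k) * (norm (x n) * norm (\<eta> k))"
        by (rule order_trans[OF norm_cinner_le]) (intro mult_left_mono norm_blinfun, simp)
      also have "\<dots> \<le> norm (\<xi> k) * (\<bar>R\<bar> * norm (\<eta> k))"
        using x(2)[of n] by (intro mult_left_mono mult_right_mono) auto
      also have "\<dots> = \<bar>R\<bar> * (norm (\<xi> k) * norm (\<eta> k))" by simp
      also have "norm (\<xi> k) * norm (\<eta> k) \<le> (norm (\<xi> k))\<^sup>2 + (norm (\<eta> k))\<^sup>2"
        using sum_squares_bound[of "norm (\<xi> k)" "norm (\<eta> k)"]
        using mult_nonneg_nonneg[OF norm_ge_zero[of "\<xi> k"] norm_ge_zero[of "\<eta> k"]] by linarith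
      finally show ?thesis unfolding m_def by (simp add: mult_left_mono)
    qed
    have lim: "((\<lambda>n. cinner (\<xi> k) (x n (\<eta> k))) \<longlongrightarrow> cinner (\<xi> k) (y (\<eta> k))) F" for k
    proof -
      have eq: "cinner (\<xi> k) z = Complex (\<xi> k \<bullet> z) ((\<i> *\<^sub>C \<xi> k) \<bullet> z)" for z
        by (simp add: complex_eq_iff Re_cinner Im_cinner i_inner_left)
      show ?thesis
        unfolding eq using x(1) by (intro tendsto_Complex) (simp_all add: wot_tendsto_def)
    qed
    have "((\<lambda>n. \<Sum>k. cinner (\<xi> k) (x n (\<eta> k))) \<longlongrightarrow> (\<Sum>k. cinner (\<xi> k) (y (\<eta> k)))) F"
      using tannerys_theorem[where a = "\<lambda>k n. cinner (\<xi> k) (x n (\<eta> k))" and M = m, OF lim _ \<open>summable m\<close> F]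
        bound by (simp add: case_prod_unfold)
    moreover have "(\<Sum>k. cinner (\<xi> k) (y (\<eta> k))) \<in> V" using Basis s by simp
    ultimately show ?case using V by (auto simp: s dest: topological_tendstoD)
  qed (auto simp: eventually_conj)
qed

lemma topspace_ultraweak: "topspace ultraweak_topology = (UNIV :: ('h::chilbert_space \<Rightarrow>\<^sub>L 'h) set)"
proof -
  have "UNIV \<in> {(\<lambda>x. \<Sum>n. cinner (\<xi> n) (blinfun_apply x (\<eta> n))) -` U | (\<xi> :: nat \<Rightarrow> 'h) (\<eta> :: nat \<Rightarrow> 'h) U.
      summable (\<lambda>n. (norm (\<xi> n))\<^sup>2) \<and> summable (\<lambda>n. (norm (\<eta> n))\<^sup>2) \<and> open U}"
    by (intro CollectI exI[of _ "\<lambda>_. 0"] exI[of _ UNIV]) auto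
  then show ?thesis
    unfolding ultraweak_topology_def topology_generated_by_topspace by blast
qed

context tracial_vn
begin

lemma tau_wot_tendsto:
  assumes x: "wot_tendsto x y F" "\<And>n. norm (x n) \<le> R" "\<And>n. x n \<in> M" and y: "y \<in> M"
    and F: "F \<noteq> bot"
  shows "((\<lambda>n. \<tau> (x n)) \<longlongrightarrow> \<tau> y) F"
proof (rule topological_tendstoI)
  fix U :: "complex set" assume U: "open U" "\<tau> y \<in> U"
  have "continuous_map (subtopology ultraweak_topology M) euclidean \<tau>"
    using tracial by (simp add: tracial_vn_algebra_def normal_on_def)
  then have "openin (subtopology ultraweak_topology M) {z \<in> topspace (subtopology ultraweak_topology M). \<tau> z \<in> U}"
    using U by (simp add: continuous_map_def)
  then obtain T where T: "openin ultraweak_topology T"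
    "{z \<in> topspace (subtopology ultraweak_topology M). \<tau> z \<in> U} = T \<inter> M"
    unfolding openin_subtopology by auto
  have "eventually (\<lambda>n. x n \<in> T) F"
    using T U y by (intro tendsto_ultraweak_open[OF T(1) _ x(1,2) F]) (auto simp: topspace_ultraweak)
  then show "eventually (\<lambda>n. \<tau> (x n) \<in> U) F"
    by eventually_elim (use T(2) x(3) in \<open>auto simp: topspace_ultraweak\<close>)
qed

text \<open>
  Otherwise suitable multiples of elements of \<open>M\<close> tend to 0 in norm while their traces keep modulus 1,
  which contradicts normality.
\<close>

lemma tau_bounded: "\<exists>C. \<forall>x\<in>M. cmod (\<tau> x) \<le> C * norm x"
proof (rule ccontr)
  assume "\<nexists>C. \<forall>x\<in>M. cmod (\<tau> x) \<le> C * norm x"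
  then have "\<exists>x\<in>M. real (Suc n) * norm x < cmod (\<tau> x)" for n
    by (metis not_le)
  then obtain x where x: "x n \<in> M" "real (Suc n) * norm (x n) < cmod (\<tau> (x n))" for n
    by metis
  define y where "y n = (1 / cmod (\<tau> (x n))) *\<^sub>R x n" for n
  have pos: "0 < cmod (\<tau> (x n))" for n
    using x(2)[of n] by (smt (verit) mult_nonneg_nonneg norm_ge_zero of_nat_0_le_iff)
  have ny: "norm (y n) \<le> 1 / real (Suc n)" for n
    using x(2)[of n] pos[of n] by (simp add: y_def field_simps)
  then have ny1: "norm (y n) \<le> 1" for n
    by (rule order_trans) simp
  have y0: "y \<longlonglongrightarrow> 0"
    by (rule Lim_null_comparison[OF _ lim_1_over_n[THEN LIMSEQ_Suc]]) (use ny in simp)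
  have "wot_tendsto y 0 sequentially"
    unfolding wot_tendsto_def by (intro allI tendsto_intros y0)
  then have "(\<lambda>n. \<tau> (y n)) \<longlonglongrightarrow> \<tau> 0"
  proof (rule tau_wot_tendsto)
    show "y n \<in> M" for n using x(1) by (simp add: y_def)
  qed (use ny1 in auto)
  moreover have "cmod (\<tau> (y n)) = 1" for n
    using x(1)[of n] pos[of n] by (simp add: y_def tau_scaleR norm_mult norm_divide)
  ultimately have "(\<lambda>n. 1::real) \<longlonglongrightarrow> 0"
    using tendsto_norm[of "\<lambda>n. \<tau> (y n)" "\<tau> 0" sequentially] by (simp add: tau_zero)
  then show False by (simp add: LIMSEQ_const_iff)
qed

text \<open>
  Let \<open>s\<close> be the supremum of the 2-norm of \<open>z y\<close> over the operator norm contractions \<open>z\<close> in \<open>M\<close>; it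
  is finite because the trace is bounded. Since \<open>z* z\<close> is again a contraction,
  \<open>\<parallel>z y\<parallel>\<^sup>2 = \<langle>y, z* z y\<rangle> \<le> \<parallel>y\<parallel> s\<close>, whence \<open>s\<^sup>2 \<le> \<parallel>y\<parallel> s\<close>.
\<close>

lemma contr_of_norm_le_1:
  assumes x: "x \<in> M" "norm x \<le> 1"
  shows "x \<in> contr"
proof (rule contrI)
  fix y assume y: "y \<in> M"
  define B where "B = {z \<in> M. norm z \<le> 1}"
  have xB: "x \<in> B" using x by (simp add: B_def)
  obtain C where C: "\<And>z. z \<in> M \<Longrightarrow> cmod (\<tau> z) \<le> C * norm z" using tau_bounded by blast
  define s where "s = (SUP z\<in>B. n2 (z \<cdot> y))"
  have "n2 (z \<cdot> y) \<le> sqrt (\<bar>C\<bar> * (norm y * norm y))" if z: "z \<in> B" for z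
  proof -
    have zM: "z \<in> M" "norm z \<le> 1" using z by (auto simp: B_def)
    have zy: "norm (z \<cdot> y) \<le> norm y"
      using norm_blinfun_compose[of z y] zM(2) mult_right_mono[of "norm z" 1 "norm y"] by simp
    have "Re (\<tau> (adj (z \<cdot> y) \<cdot> (z \<cdot> y))) \<le> C * norm (adj (z \<cdot> y) \<cdot> (z \<cdot> y))"
      using y zM by (intro order_trans[OF complex_Re_le_cmod C]) auto
    also have "\<dots> \<le> \<bar>C\<bar> * (norm (z \<cdot> y) * norm (z \<cdot> y))"
      using y zM by (intro mult_mono order_trans[OF norm_blinfun_compose] norm_adj_le mult_right_mono) auto
    also have "\<dots> \<le> \<bar>C\<bar> * (norm y * norm y)"
      by (intro mult_left_mono mult_mono zy) auto
    finally show ?thesis unfolding norm2_def by (rule real_sqrt_le_mono)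
  qed
  then have bdd: "bdd_above ((\<lambda>z. n2 (z \<cdot> y)) ` B)" by (intro bdd_aboveI2)
  have le: "n2 (z \<cdot> y) \<le> s" if "z \<in> B" for z
    unfolding s_def by (rule cSUP_upper[OF that bdd])
  have s0: "0 \<le> s" using le[OF xB] n2_nonneg[of "x \<cdot> y"] x y by simp
  have sq: "(n2 (z \<cdot> y))\<^sup>2 \<le> n2 y * s" if z: "z \<in> B" for z
  proof -
    have zM: "z \<in> M" "norm z \<le> 1" using z by (auto simp: B_def)
    have "norm (adj z \<cdot> z) \<le> norm (adj z) * norm z" by (rule norm_blinfun_compose)
    also have "\<dots> \<le> 1 * 1"
      using zM norm_adj_le[of z] by (intro mult_mono) auto
    finally have "adj z \<cdot> z \<in> B" using zM by (simp add: B_def)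
    from le[OF this] have "n2 (adj z \<cdot> (z \<cdot> y)) \<le> s" by (simp add: compose_assoc)
    then have "n2 y * n2 (adj z \<cdot> (z \<cdot> y)) \<le> n2 y * s"
      using y by (intro mult_left_mono n2_nonneg) auto
    moreover have "(n2 (z \<cdot> y))\<^sup>2 = rp y (adj z \<cdot> (z \<cdot> y))"
      using zM y by (simp add: n2_sq rp_mult_left)
    ultimately show ?thesis
      using n2_Cauchy_Schwarz[of y "adj z \<cdot> (z \<cdot> y)"] zM y by simp
  qed
  have "s \<le> sqrt (n2 y * s)"
    unfolding s_def
  proof (rule cSUP_least)
    show "B \<noteq> {}" using xB by blast
    show "n2 (z \<cdot> y) \<le> sqrt (n2 y * (SUP z\<in>B. n2 (z \<cdot> y)))" if "z \<in> B" for z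
      using sq[OF that] unfolding s_def by (rule real_le_rsqrt)
  qed
  then have "s\<^sup>2 \<le> n2 y * s"
    using s0 y by (metis mult_nonneg_nonneg n2_nonneg power_mono real_sqrt_pow2)
  then have "s \<le> n2 y"
    using s0 n2_nonneg[OF y] by (cases "s = 0") (auto simp: power2_eq_square)
  with le[OF xB] show "n2 (x \<cdot> y) \<le> n2 y" by simp
qed (rule x)

lemma n2_compose_le:
  assumes x: "x \<in> M" and y: "y \<in> M"
  shows "n2 (x \<cdot> y) \<le> norm x * n2 y"
proof (cases "x = 0")
  case False
  have "n2 (((1 / norm x) *\<^sub>R x) \<cdot> y) \<le> n2 y"
    using x y False by (intro contr_left contr_of_norm_le_1) auto
  then show ?thesis
    using x y False by (simp add: op_simps n2_scaleR field_simps)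
qed (simp add: n2_zero)

lemma n2_compose_right_le:
  assumes x: "x \<in> M" and y: "y \<in> M"
  shows "n2 (y \<cdot> x) \<le> norm x * n2 y"
proof -
  have "n2 (y \<cdot> x) = n2 (adj x \<cdot> adj y)"
    using x y n2_adj[of "y \<cdot> x"] by (simp add: adj_simps)
  also have "\<dots> \<le> norm (adj x) * n2 (adj y)"
    using x y by (intro n2_compose_le) auto
  also have "\<dots> \<le> norm x * n2 y"
    using x y by (simp add: n2_adj mult_right_mono norm_adj_le n2_nonneg)
  finally show ?thesis .
qed

lemma n2_le_norm: "x \<in> M \<Longrightarrow> n2 x \<le> norm x"
  using n2_compose_le[of x id_blinfun] by (simp add: op_simps n2_id)

text \<open>
  Weak operator compactness provides a limit point \<open>y\<close>. With \<open>z = x n - y\<close>, normality makes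
  \<open>\<parallel>z\<parallel>\<^sup>2\<close> the limit over \<open>m\<close> of \<open>\<langle>z, x n - x m\<rangle>\<close>, and Cauchy-Schwarz bounds this by \<open>\<parallel>z\<parallel>\<close> times the
  Cauchy modulus of the sequence.
\<close>

theorem n2_complete:
  assumes x: "\<And>n. x n \<in> M" "\<And>n. norm (x n) \<le> 1"
    and C: "\<And>e. 0 < e \<Longrightarrow> \<exists>N. \<forall>m\<ge>N. \<forall>n\<ge>N. n2 (x m - x n) < e"
  shows "\<exists>y\<in>M. norm y \<le> 1 \<and> (\<lambda>n. n2 (x n - y)) \<longlonglongrightarrow> 0"
proof -
  obtain y F where F: "F \<noteq> bot" "F \<le> sequentially" and ny: "norm y \<le> 1" and xy: "wot_tendsto x y F"
    using wot_compact[of x, OF x(2)] by metis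
  have "y \<in> commutant (commutant M)"
    unfolding commutant_def[of "commutant M"]
  proof (intro CollectI conjI ballI)
    show "y \<in> cbounded_ops"
      unfolding cbounded_iff_commute
    proof (rule wot_tendsto_commute[OF xy F(1)])
      show "x n \<cdot> (\<i> *\<^sub>C id_blinfun) = (\<i> *\<^sub>C id_blinfun) \<cdot> x n" for n
        by (rule cbounded_iff_commute[THEN iffD1]) (simp add: x)
    qed
    show "y \<cdot> z = z \<cdot> y" if z: "z \<in> commutant M" for z
    proof (rule wot_tendsto_commute[OF xy F(1)])
      show "x n \<cdot> z = z \<cdot> x n" for n
        using commutant_commutes[OF z x(1)] by simp
    qed
  qed
  then have yM: "y \<in> M" by (simp add: vn_bicommutant[OF M_vn])
  have "(\<lambda>n. n2 (x n - y)) \<longlonglongrightarrow> 0"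
  proof (rule LIMSEQ_I)
    fix e :: real assume "0 < e"
    with C[of "e / 2"] obtain N where N: "\<And>m n. m \<ge> N \<Longrightarrow> n \<ge> N \<Longrightarrow> n2 (x m - x n) < e / 2"
      by auto
    have "norm (n2 (x n - y) - 0) < e" if n: "n \<ge> N" for n
    proof -
      define z where "z = x n - y"
      have z: "z \<in> M" using x yM by (simp add: z_def)
      have "((\<lambda>m. \<tau> (adj z \<cdot> (x n - x m))) \<longlongrightarrow> \<tau> (adj z \<cdot> (x n - y))) F"
      proof (rule tau_wot_tendsto[OF _ _ _ _ F(1)])
        have "\<xi> \<bullet> (adj z \<cdot> (x n - w)) \<eta> = z \<xi> \<bullet> x n \<eta> - z \<xi> \<bullet> w \<eta>" for \<xi> \<eta> w
          using inner_adj[of z "x n \<eta> - w \<eta>" \<xi>] z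
          by (simp add: inner_commute blinfun.diff_left inner_diff_right)
        then show "wot_tendsto (\<lambda>m. adj z \<cdot> (x n - x m)) (adj z \<cdot> (x n - y)) F"
          using xy unfolding wot_tendsto_def by (auto intro!: tendsto_diff)
        show "norm (adj z \<cdot> (x n - x m)) \<le> norm (adj z) * 2" for m
          using norm_triangle_ineq4[of "x n" "x m"] x(2)[of n] x(2)[of m]
          by (intro order_trans[OF norm_blinfun_compose] mult_left_mono) auto
      qed (use x yM z in auto)
      then have "((\<lambda>m. rp z (x n - x m)) \<longlongrightarrow> rp z z) F"
        unfolding rp_def by (intro tendsto_Re) (simp add: z_def)
      moreover have "eventually (\<lambda>m. m \<ge> N) F"
        using F(2) eventually_ge_at_top[of N] by (simp add: le_filter_def)
      then have "eventually (\<lambda>m. rp z (x n - x m) \<le> n2 z * (e / 2)) F"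
      proof eventually_elim
        case (elim m)
        have "rp z (x n - x m) \<le> n2 z * n2 (x n - x m)"
          using z x by (intro n2_Cauchy_Schwarz) auto
        also have "\<dots> \<le> n2 z * (e / 2)"
          using N[OF n elim] z by (intro mult_left_mono n2_nonneg) auto
        finally show ?case .
      qed
      ultimately have "rp z z \<le> n2 z * (e / 2)"
        using F(1) by (rule tendsto_upperbound)
      then have "n2 z * n2 z \<le> n2 z * (e / 2)"
        using z by (simp add: power2_eq_square flip: n2_sq)
      then show ?thesis
        using n2_nonneg[OF z] \<open>0 < e\<close> unfolding z_def[symmetric]
        by (cases "n2 z = 0") auto
    qed
    then show "\<exists>N. \<forall>n\<ge>N. norm (n2 (x n - y) - 0) < e" by blast
  qed
  with yM ny show ?thesis by blast
qed

end

section \<open>Square-summable sequences of vectors\<close>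

definition sq_summable :: "(nat \<Rightarrow> 'a::real_normed_vector) \<Rightarrow> bool"
  where "sq_summable f \<longleftrightarrow> summable (\<lambda>n. (norm (f n))\<^sup>2)"

lemma sq_summable_bound:
  assumes f: "sq_summable f" and g: "sq_summable g"
    and h: "\<And>n. (norm (h n))\<^sup>2 \<le> c * ((norm (f n))\<^sup>2 + (norm (g n))\<^sup>2)"
  shows "sq_summable h"
  unfolding sq_summable_def
  by (rule summable_comparison_test'[OF summable_mult[OF summable_add[OF f[unfolded sq_summable_def]
      g[unfolded sq_summable_def]], of c], of 0])
    (use h in simp)

lemma norm_add_sq_le: "(norm (a + b))\<^sup>2 \<le> 2 * ((norm a)\<^sup>2 + (norm b)\<^sup>2)"
proof -
  have "(norm (a + b))\<^sup>2 \<le> (norm a + norm b)\<^sup>2"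
    by (intro power_mono norm_triangle_ineq) simp
  also have "\<dots> \<le> 2 * ((norm a)\<^sup>2 + (norm b)\<^sup>2)"
    using sum_squares_bound[of "norm a" "norm b"] by (simp add: power2_sum)
  finally show ?thesis .
qed

lemma sq_summable_add:
  assumes "sq_summable f" "sq_summable g"
  shows "sq_summable (\<lambda>n. f n + g n)"
  by (rule sq_summable_bound[OF assms norm_add_sq_le])

lemma sq_summable_image:
  assumes f: "sq_summable f" and h: "\<And>n. norm (h n) \<le> K * norm (f n)"
  shows "sq_summable h"
proof (rule sq_summable_bound[OF f f, where c = "K\<^sup>2"])
  fix n
  have "(norm (h n))\<^sup>2 \<le> (K * norm (f n))\<^sup>2"
    by (intro power_mono h) simp
  also have "\<dots> \<le> K\<^sup>2 * ((norm (f n))\<^sup>2 + (norm (f n))\<^sup>2)"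
    unfolding power_mult_distrib by (intro mult_left_mono) auto
  finally show "(norm (h n))\<^sup>2 \<le> K\<^sup>2 * ((norm (f n))\<^sup>2 + (norm (f n))\<^sup>2)" .
qed

lemma sq_summable_blinfun: "sq_summable f \<Longrightarrow> sq_summable (\<lambda>n. blinfun_apply x (f n))"
  by (rule sq_summable_image[where K = "norm x"]) (auto intro: norm_blinfun)

lemma norm_mult_le_sq: "norm a * norm b \<le> (norm a)\<^sup>2 + (norm b)\<^sup>2"
  using sum_squares_bound[of "norm a" "norm b"]
    mult_nonneg_nonneg[OF norm_ge_zero[of a] norm_ge_zero[of b]] by linarith

lemma sq_summable_inner:
  fixes f g :: "nat \<Rightarrow> 'a::real_inner"
  assumes "sq_summable f" "sq_summable g"
  shows "summable (\<lambda>n. f n \<bullet> g n)"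
proof (rule summable_comparison_test'[OF summable_add[OF assms[unfolded sq_summable_def]], of 0])
  fix n
  show "norm (f n \<bullet> g n) \<le> (norm (f n))\<^sup>2 + (norm (g n))\<^sup>2"
    using order_trans[OF Cauchy_Schwarz_ineq2 norm_mult_le_sq] by simp
qed

text \<open>
  The Hilbert sum of countably many copies of a Hilbert space. An ultraweak functional involves
  infinitely many vectors, and here they become a single one.
\<close>

typedef (overloaded) 'a l2 = "{f :: nat \<Rightarrow> 'a::real_inner. sq_summable f}"
  morphisms coord Abs_l2
  by (rule exI[of _ "\<lambda>_. 0"]) (simp add: sq_summable_def)

setup_lifting type_definition_l2

lemma sq_summable_coord: "sq_summable (coord \<zeta>)"
  using coord by blast

lemma l2_eqI: "(\<And>n. coord a n = coord b n) \<Longrightarrow> a = b"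
  by (simp add: coord_inject[symmetric] fun_eq_iff)

instantiation l2 :: (real_inner) real_inner
begin

lift_definition zero_l2 :: "'a l2" is "\<lambda>_. 0" by (simp add: sq_summable_def)
lift_definition plus_l2 :: "'a l2 \<Rightarrow> 'a l2 \<Rightarrow> 'a l2" is "\<lambda>f g n. f n + g n"
  by (rule sq_summable_add)
lift_definition uminus_l2 :: "'a l2 \<Rightarrow> 'a l2" is "\<lambda>f n. - f n" by (simp add: sq_summable_def)
lift_definition minus_l2 :: "'a l2 \<Rightarrow> 'a l2 \<Rightarrow> 'a l2" is "\<lambda>f g n. f n - g n"
proof -
  fix f g :: "nat \<Rightarrow> 'a" assume "sq_summable f" "sq_summable g"
  then show "sq_summable (\<lambda>n. f n - g n)"
    using sq_summable_add[of f "\<lambda>n. - g n"] by (simp add: sq_summable_def)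
qed
lift_definition scaleR_l2 :: "real \<Rightarrow> 'a l2 \<Rightarrow> 'a l2" is "\<lambda>r f n. r *\<^sub>R f n"
proof -
  fix r and f :: "nat \<Rightarrow> 'a" assume "sq_summable f"
  then show "sq_summable (\<lambda>n. r *\<^sub>R f n)" by (rule sq_summable_image[where K = "\<bar>r\<bar>"]) simp
qed
lift_definition inner_l2 :: "'a l2 \<Rightarrow> 'a l2 \<Rightarrow> real" is "\<lambda>f g. \<Sum>n. f n \<bullet> g n" .

definition norm_l2 :: "'a l2 \<Rightarrow> real" where "norm_l2 a = sqrt (a \<bullet> a)"
definition dist_l2 :: "'a l2 \<Rightarrow> 'a l2 \<Rightarrow> real" where "dist_l2 a b = norm (a - b)"
definition sgn_l2 :: "'a l2 \<Rightarrow> 'a l2" where "sgn_l2 a = inverse (norm a) *\<^sub>R a"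
definition uniformity_l2 :: "('a l2 \<times> 'a l2) filter"
  where "uniformity_l2 = (INF e\<in>{0 <..}. principal {(a, b). dist a b < e})"
definition open_l2 :: "'a l2 set \<Rightarrow> bool"
  where "open_l2 U = (\<forall>x\<in>U. \<forall>\<^sub>F (x', y) in uniformity. x' = x \<longrightarrow> y \<in> U)"

instance
proof
  fix a b c :: "'a l2" and r s :: real
  show "a + b + c = a + (b + c)" "a + b = b + a" "0 + a = a" "- a + a = 0" "a - b = a + - b"
    "r *\<^sub>R (a + b) = r *\<^sub>R a + r *\<^sub>R b" "(r + s) *\<^sub>R a = r *\<^sub>R a + s *\<^sub>R a"
    "r *\<^sub>R s *\<^sub>R a = (r * s) *\<^sub>R a" "1 *\<^sub>R a = a"
    by (transfer; simp add: algebra_simps)+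
  show "dist a b = norm (a - b)" by (rule dist_l2_def)
  show "sgn a = inverse (norm a) *\<^sub>R a" by (rule sgn_l2_def)
  show "uniformity = (INF e\<in>{0 <..}. principal {(a, b :: 'a l2). dist a b < e})"
    by (rule uniformity_l2_def)
  show "open U = (\<forall>x\<in>U. \<forall>\<^sub>F (x', y) in uniformity. x' = x \<longrightarrow> y \<in> U)" for U :: "'a l2 set"
    by (rule open_l2_def)
  show "a \<bullet> b = b \<bullet> a" by transfer (simp add: inner_commute)
  show "(a + b) \<bullet> c = a \<bullet> c + b \<bullet> c"
    by transfer (simp add: inner_add_left suminf_add sq_summable_inner)
  show "r *\<^sub>R a \<bullet> b = r * (a \<bullet> b)"
    by transfer (simp add: suminf_mult sq_summable_inner)
  show "0 \<le> a \<bullet> a"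
    by transfer (simp add: suminf_nonneg sq_summable_inner)
  show "(a \<bullet> a = 0) = (a = 0)"
    by transfer (simp add: suminf_eq_zero_iff sq_summable_inner fun_eq_iff)
  show "norm a = sqrt (a \<bullet> a)" by (rule norm_l2_def)
qed

end

lemma norm_l2_sq: "(norm a)\<^sup>2 = (\<Sum>n. (norm (coord a n))\<^sup>2)"
  unfolding power2_norm_eq_inner by transfer simp

lemma coord_simps [simp]:
  "coord 0 n = 0" "coord (a + b) n = coord a n + coord b n" "coord (a - b) n = coord a n - coord b n"
  "coord (r *\<^sub>R a) n = r *\<^sub>R coord a n"
  by (transfer; simp)+

lemma coord_sum [simp]: "coord (sum f A) n = (\<Sum>i\<in>A. coord (f i) n)"
  by (induction A rule: infinite_finite_induct) auto

lemma norm_coord_le: "norm (coord a n) \<le> norm a"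
proof (rule power2_le_imp_le)
  have "(\<Sum>k\<in>{n}. (norm (coord a k))\<^sup>2) \<le> (\<Sum>k. (norm (coord a k))\<^sup>2)"
    using sq_summable_coord[of a] unfolding sq_summable_def by (intro sum_le_suminf) auto
  then show "(norm (coord a n))\<^sup>2 \<le> (norm a)\<^sup>2"
    by (simp add: norm_l2_sq)
qed simp

lemma bounded_linear_coord: "bounded_linear (\<lambda>a. coord a n)"
  by (rule bounded_linear_intro[where K = 1]) (auto simp: norm_coord_le)

instance l2 :: ("{real_inner, complete_space}") complete_space
proof
  fix X :: "nat \<Rightarrow> 'a l2" assume X: "Cauchy X"
  have "convergent (\<lambda>m. coord (X m) n)" for n
    using bounded_linear.Cauchy[OF bounded_linear_coord X] by (rule Cauchy_convergent)
  then obtain f where f: "(\<lambda>m. coord (X m) n) \<longlonglongrightarrow> f n" for n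
    unfolding convergent_def by metis
  have fin: "sum (\<lambda>n. (norm (coord (X m) n - f n))\<^sup>2) {..<K} \<le> e\<^sup>2"
    if N: "\<And>k. k \<ge> N \<Longrightarrow> norm (X m - X k) < e" for m N K e
  proof (rule tendsto_upperbound)
    show "((\<lambda>k. \<Sum>n<K. (norm (coord (X m) n - coord (X k) n))\<^sup>2) \<longlongrightarrow>
        (\<Sum>n<K. (norm (coord (X m) n - f n))\<^sup>2)) sequentially"
      by (intro tendsto_intros f)
    show "eventually (\<lambda>k. (\<Sum>n<K. (norm (coord (X m) n - coord (X k) n))\<^sup>2) \<le> e\<^sup>2) sequentially"
      using eventually_ge_at_top[of N]
    proof eventually_elim
      case (elim k)
      have "(\<Sum>n<K. (norm (coord (X m - X k) n))\<^sup>2) \<le> (\<Sum>n. (norm (coord (X m - X k) n))\<^sup>2)"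
        using sq_summable_coord[of "X m - X k"] unfolding sq_summable_def by (intro sum_le_suminf) auto
      also have "\<dots> = (norm (X m - X k))\<^sup>2" by (simp add: norm_l2_sq)
      also have "\<dots> \<le> e\<^sup>2"
        using N[OF elim] by (intro power_mono) auto
      finally show ?case by simp
    qed
  qed simp
  have sm: "sq_summable (\<lambda>n. coord (X m) n - f n)"
    if "\<And>k. k \<ge> N \<Longrightarrow> norm (X m - X k) < e" for m N e
    unfolding sq_summable_def by (rule summableI_nonneg_bounded[OF _ fin[OF that]]) auto
  obtain N1 where N1: "\<And>m k. m \<ge> N1 \<Longrightarrow> k \<ge> N1 \<Longrightarrow> norm (X m - X k) < 1"
    using CauchyD[OF X, of 1] by auto
  have "sq_summable (\<lambda>n. coord (X N1) n - f n)"
    by (rule sm[of N1 N1 1]) (use N1 in auto)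
  then have "sq_summable (\<lambda>n. - (coord (X N1) n - f n))"
    by (rule sq_summable_image[where K = 1]) (simp add: norm_minus_commute)
  from sq_summable_add[OF sq_summable_coord[of "X N1"] this]
  have sf: "sq_summable f" by simp
  define a where "a = Abs_l2 f"
  have a: "coord a = f" using sf by (simp add: a_def Abs_l2_inverse)
  have "X \<longlonglongrightarrow> a"
  proof (rule LIMSEQ_I)
    fix e :: real assume e: "0 < e"
    obtain N where N: "\<And>m k. m \<ge> N \<Longrightarrow> k \<ge> N \<Longrightarrow> norm (X m - X k) < e / 2"
      using CauchyD[OF X, of "e / 2"] e by auto
    have "norm (X m - a) < e" if m: "m \<ge> N" for m
    proof -
      have sq: "(norm (X m - a))\<^sup>2 \<le> (e / 2)\<^sup>2"
        unfolding norm_l2_sq using sm[OF N[OF m]] unfolding sq_summable_def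
        by (intro suminf_le_const) (simp_all add: a fin[OF N[OF m]])
      have "norm (X m - a) \<le> e / 2"
        by (rule power2_le_imp_le[OF sq]) (use e in simp)
      with e show ?thesis by simp
    qed
    then show "\<exists>N. \<forall>n\<ge>N. norm (X n - a) < e" by blast
  qed
  then show "convergent X" by (auto simp: convergent_def)
qed

section \<open>Density of a self-adjoint algebra in its bicommutant\<close>

lift_definition amplify :: "('a::real_inner \<Rightarrow>\<^sub>L 'a) \<Rightarrow> 'a l2 \<Rightarrow> 'a l2" is "\<lambda>x f n. blinfun_apply x (f n)"
  by (rule sq_summable_blinfun)

lemma coord_amplify [simp]: "coord (amplify x a) n = x (coord a n)"
  by transfer simp

lemma bounded_linear_amplify: "bounded_linear (amplify x)"
proof (rule bounded_linear_intro[where K = "norm x"])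
  fix a
  show "norm (amplify x a) \<le> norm a * norm x"
  proof (rule power2_le_imp_le)
    have "(\<Sum>n. (norm (x (coord a n)))\<^sup>2) \<le> (\<Sum>n. (norm x)\<^sup>2 * (norm (coord a n))\<^sup>2)"
    proof (rule suminf_le)
      show "summable (\<lambda>n. (norm (x (coord a n)))\<^sup>2)"
        using sq_summable_blinfun[OF sq_summable_coord] by (simp add: sq_summable_def)
      show "summable (\<lambda>n. (norm x)\<^sup>2 * (norm (coord a n))\<^sup>2)"
        using sq_summable_coord[of a] by (simp add: sq_summable_def summable_mult)
      show "(norm (x (coord a n)))\<^sup>2 \<le> (norm x)\<^sup>2 * (norm (coord a n))\<^sup>2" for n
        unfolding power_mult_distrib[symmetric] by (intro power_mono norm_blinfun) auto
    qed
    also have "\<dots> = (norm x)\<^sup>2 * (norm a)\<^sup>2"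
      using sq_summable_coord[of a] unfolding norm_l2_sq sq_summable_def by (rule suminf_mult)
    finally show "(norm (amplify x a))\<^sup>2 \<le> (norm a * norm x)\<^sup>2"
      by (simp add: norm_l2_sq power_mult_distrib mult.commute)
  qed simp
qed (auto intro!: l2_eqI simp: blinfun.bilinear_simps)

lift_definition inject :: "nat \<Rightarrow> 'a::real_inner \<Rightarrow> 'a l2" is "\<lambda>j x n. if n = j then x else 0"
  unfolding sq_summable_def
  by (rule summable_finite[of "{_}"]) auto

lemma coord_inject [simp]: "coord (inject j x) n = (if n = j then x else 0)"
  by transfer simp

lemma norm_inject: "norm (inject j x) = norm x"
proof -
  have "(norm (inject j x))\<^sup>2 = (\<Sum>n\<in>{j}. (norm (coord (inject j x) n))\<^sup>2)"
    unfolding norm_l2_sq by (rule suminf_finite) auto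
  then show ?thesis by simp
qed

lemma bounded_linear_inject: "bounded_linear (inject j)"
  by (rule bounded_linear_intro[where K = 1]) (auto intro!: l2_eqI simp: norm_inject)

lemma truncation_tendsto: "(\<lambda>n. \<Sum>j<n. inject j (coord a j)) \<longlonglongrightarrow> a"
proof -
  define g where "g k = (norm (coord a k))\<^sup>2" for k
  have g: "summable g" using sq_summable_coord[of a] by (simp add: g_def[abs_def] sq_summable_def)
  have "(norm (a - (\<Sum>j<n. inject j (coord a j))))\<^sup>2 = suminf g - sum g {..<n}" for n
  proof -
    have "(norm (a - (\<Sum>j<n. inject j (coord a j))))\<^sup>2 = (\<Sum>k. if k < n then 0 else g k)"
      unfolding norm_l2_sq by (rule suminf_cong) (auto simp: g_def sum.If_cases if_distrib cong: if_cong)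
    also have "\<dots> = (\<Sum>k. g k - (if k \<in> {..<n} then g k else 0))"
      by (rule suminf_cong) auto
    also have "\<dots> = suminf g - (\<Sum>k. if k \<in> {..<n} then g k else 0)"
      by (intro suminf_diff[symmetric] g summable_If_finite_set) auto
    also have "(\<Sum>k. if k \<in> {..<n} then g k else 0) = sum g {..<n}"
      by (subst suminf_finite[of "{..<n}"]) auto
    finally show ?thesis .
  qed
  moreover have "(\<lambda>n. suminf g - sum g {..<n}) \<longlonglongrightarrow> suminf g - suminf g"
    by (intro tendsto_intros summable_LIMSEQ g)
  ultimately have "(\<lambda>n. (norm (a - (\<Sum>j<n. inject j (coord a j))))\<^sup>2) \<longlonglongrightarrow> 0" by simp
  then have "(\<lambda>n. sqrt ((norm (a - (\<Sum>j<n. inject j (coord a j))))\<^sup>2)) \<longlonglongrightarrow> sqrt 0"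
    by (rule tendsto_real_sqrt)
  then have "(\<lambda>n. norm ((\<Sum>j<n. inject j (coord a j)) - a)) \<longlonglongrightarrow> 0"
    by (simp add: norm_minus_commute)
  then show ?thesis using Lim_null tendsto_norm_zero_iff by blast
qed

definition star_subalgebra :: "('h::chilbert_space \<Rightarrow>\<^sub>L 'h) set \<Rightarrow> bool"
  where "star_subalgebra P \<longleftrightarrow> P \<subseteq> cbounded_ops \<and> id_blinfun \<in> P \<and>
    (\<forall>x\<in>P. \<forall>y\<in>P. x + y \<in> P \<and> x \<cdot> y \<in> P) \<and> (\<forall>x\<in>P. \<forall>a. a *\<^sub>C x \<in> P) \<and> (\<forall>x\<in>P. adj x \<in> P)"

lemma subspace_closure:
  fixes S :: "'a::real_normed_vector set"
  assumes S: "subspace S"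
  shows "subspace (closure S)"
  unfolding subspace_def
proof (intro conjI ballI allI)
  show "0 \<in> closure S" using subspace_0[OF S] closure_subset by blast
  fix x assume "x \<in> closure S"
  then obtain f where f: "\<And>n. f n \<in> S" "f \<longlonglongrightarrow> x" unfolding closure_sequential by blast
  show "r *\<^sub>R x \<in> closure S" for r
    unfolding closure_sequential
    by (intro exI[of _ "\<lambda>n. r *\<^sub>R f n"] conjI allI tendsto_intros f subspace_scale[OF S])
  fix y assume "y \<in> closure S"
  then obtain g where g: "\<And>n. g n \<in> S" "g \<longlonglongrightarrow> y" unfolding closure_sequential by blast
  show "x + y \<in> closure S"
    unfolding closure_sequential
    by (intro exI[of _ "\<lambda>n. f n + g n"] conjI allI tendsto_intros f g subspace_add[OF S])
qed

text \<open>
  Von Neumann's argument. Let \<open>V\<close> be the closure of \<open>{(y \<zeta>\<^sub>n)\<^sub>n | y \<in> P}\<close> among the square-summable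
  sequences. The projection onto \<open>V\<close> commutes with the amplification of every element of \<open>P\<close>, so its
  matrix entries lie in the commutant of \<open>P\<close> and commute with \<open>x\<close>. Thus the amplification of \<open>x\<close>
  commutes with the projection and maps \<open>\<zeta> \<in> V\<close> into \<open>V\<close>.
\<close>

theorem ultrastrong_density:
  fixes P :: "('h::chilbert_space \<Rightarrow>\<^sub>L 'h) set"
  assumes P: "star_subalgebra P" and x: "x \<in> commutant (commutant P)"
    and \<zeta>: "sq_summable \<zeta>" and c: "0 < c"
  shows "\<exists>y\<in>P. (\<Sum>n. (norm ((x - y) (\<zeta> n)))\<^sup>2) < c"
proof -
  define z where "z = Abs_l2 \<zeta>"
  have z: "coord z = \<zeta>" using \<zeta> by (simp add: z_def Abs_l2_inverse)
  define D where "D = (\<lambda>y. amplify y z) ` P"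
  define V where "V = closure D"
  have amp: "amplify y (amplify w a) = amplify (y \<cdot> w) a"
    "amplify y a + amplify w a = amplify (y + w) a" "r *\<^sub>R amplify y a = amplify (r *\<^sub>R y) a"
    for y w a r by (auto intro!: l2_eqI simp: blinfun.bilinear_simps)
  have Pr: "r *\<^sub>R y \<in> P" if "y \<in> P" for r y
    using that P unfolding star_subalgebra_def by (metis scaleC_of_real)
  have Pi: "\<i> *\<^sub>C id_blinfun \<in> P" using P by (simp add: star_subalgebra_def)
  have "subspace D"
    unfolding subspace_def
  proof (intro conjI ballI allI)
    have "amplify (0 *\<^sub>R id_blinfun) z \<in> D"
      unfolding D_def using P by (intro imageI Pr) (simp add: star_subalgebra_def)
    moreover have "amplify (0 *\<^sub>R id_blinfun) z = 0" by (auto intro!: l2_eqI)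
    ultimately show "0 \<in> D" by metis
  qed (use P in \<open>auto simp: D_def amp star_subalgebra_def intro!: imageI Pr\<close>)
  then have V: "subspace V" "closed V" unfolding V_def by (auto intro: subspace_closure)
  have inv: "amplify y v \<in> V" if y: "y \<in> P" and v: "v \<in> V" for y v
  proof -
    have "amplify y ` closure D \<subseteq> closure (amplify y ` D)"
      by (rule closure_bounded_linear_image_subset[OF bounded_linear_amplify])
    also have "\<dots> \<subseteq> closure D"
      using P y by (intro closure_mono) (auto simp: D_def amp star_subalgebra_def)
    finally show ?thesis using v by (auto simp: V_def)
  qed
  have comm: "orth_proj V (amplify y a) = amplify y (orth_proj V a)" if y: "y \<in> P" for y a
  proof (rule orth_proj_commute[OF V])
    have yc: "y \<in> cbounded_ops" "adj y \<in> P" using P y by (auto simp: star_subalgebra_def)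
    show "amplify (adj y) a \<bullet> b = a \<bullet> amplify y b" for a b
      using yc(1) by transfer (simp add: inner_adj)
    show "linear (amplify y)" by (rule bounded_linear.linear[OF bounded_linear_amplify])
  qed (use inv P y in \<open>auto simp: star_subalgebra_def\<close>)
  have bl_e: "bounded_linear (orth_proj V)" by (rule bounded_linear_orth_proj[OF V])
  \<comment> \<open>The matrix entries of the projection.\<close>
  define E where "E i j = Blinfun (\<lambda>\<eta>. coord (orth_proj V (inject j \<eta>)) i)" for i j
  have E: "E i j \<eta> = coord (orth_proj V (inject j \<eta>)) i" for i j \<eta>
    unfolding E_def
    by (subst bounded_linear_Blinfun_apply)
      (auto intro!: bounded_linear_compose[OF bounded_linear_coord]
        bounded_linear_compose[OF bl_e bounded_linear_inject])
  have ampi: "amplify y (inject j \<eta>) = inject j (y \<eta>)" for y j \<eta>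
    by (rule l2_eqI) simp
  have EP: "E i j \<cdot> y = y \<cdot> E i j" if "y \<in> P" for i j y
    by (rule blinfun_eqI) (simp add: E comm[OF that] flip: ampi)
  have "E i j \<in> commutant P" for i j
    unfolding commutant_def using EP cbounded_iff_commute[of "E i j"] Pi by blast
  then have xE: "x (E i j \<eta>) = E i j (x \<eta>)" for i j \<eta>
    using commutant_commutes[OF x] by (metis blinfun_apply_blinfun_compose)
  \<comment> \<open>A commutator; it vanishes on sequences with one nonzero entry, whose span is dense.\<close>
  define f where "f a = orth_proj V (amplify x a) - amplify x (orth_proj V a)" for a
  have f: "bounded_linear f"
    unfolding f_def[abs_def]
    by (intro bounded_linear_sub bounded_linear_compose[OF bl_e bounded_linear_amplify]
        bounded_linear_compose[OF bounded_linear_amplify bl_e])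
  have f0: "f (inject j \<eta>) = 0" for j \<eta>
    by (rule l2_eqI) (simp add: f_def ampi xE flip: E)
  have "(\<lambda>n. f (\<Sum>j<n. inject j (coord z j))) \<longlonglongrightarrow> f z"
    by (rule bounded_linear.tendsto[OF f truncation_tendsto])
  moreover have "f (\<Sum>j<n. inject j (coord z j)) = 0" for n
    by (simp add: linear_sum[OF bounded_linear.linear[OF f]] f0)
  ultimately have "f z = 0" by (simp add: LIMSEQ_const_iff)
  moreover have zV: "z \<in> V"
  proof -
    have "amplify id_blinfun z = z" by (rule l2_eqI) simp
    moreover have "id_blinfun \<in> P" using P by (simp add: star_subalgebra_def)
    ultimately have "z \<in> D" unfolding D_def by (metis imageI)
    then show ?thesis using closure_subset by (auto simp: V_def)
  qed
  ultimately have "amplify x z \<in> closure D"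
    using orth_proj_in[OF V, of "amplify x z"] by (simp add: f_def orth_proj_ident[OF V zV] flip: V_def)
  then obtain y where y: "y \<in> P" "dist (amplify y z) (amplify x z) < sqrt c"
    using c unfolding closure_approachable D_def by (metis imageE real_sqrt_gt_0_iff)
  have "(norm (amplify x z - amplify y z))\<^sup>2 < (sqrt c)\<^sup>2"
    using y(2) by (intro power_strict_mono) (auto simp: dist_norm norm_minus_commute)
  then have "(\<Sum>n. (norm ((x - y) (\<zeta> n)))\<^sup>2) < c"
    using c by (simp add: norm_l2_sq z blinfun.diff_left)
  with y(1) show ?thesis by blast
qed

definition interleave :: "(nat \<Rightarrow> 'a) \<Rightarrow> (nat \<Rightarrow> 'a) \<Rightarrow> nat \<Rightarrow> 'a"
  where "interleave f g n = (if even n then f (n div 2) else g ((n - 1) div 2))"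

lemma interleave_sums:
  fixes h :: "'a \<Rightarrow> real"
  assumes "summable (\<lambda>n. h (f n))" "summable (\<lambda>n. h (g n))"
  shows "(\<lambda>n. h (interleave f g n)) sums ((\<Sum>n. h (f n)) + (\<Sum>n. h (g n)))"
proof -
  have "(\<lambda>n. h (interleave f g n)) = (\<lambda>n. if even n then h (f (n div 2)) else h (g ((n - 1) div 2)))"
    by (auto simp: interleave_def)
  then show ?thesis
    using sums_if[OF summable_sums[OF assms(2)] summable_sums[OF assms(1)]] by (simp add: add.commute)
qed

text \<open>
  For elements of the form \<open>w* w\<close> an ultraweak neighbourhood of 0 is controlled by a single
  square-summable sequence: \<open>\<bar>\<langle>\<xi>, w* w \<eta>\<rangle>\<bar> \<le> \<parallel>w \<xi>\<parallel>\<^sup>2 + \<parallel>w \<eta>\<parallel>\<^sup>2\<close>, and finitely many sequences are merged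
  by interleaving.
\<close>

lemma ultraweak_neighbourhood:
  fixes T :: "('h::chilbert_space \<Rightarrow>\<^sub>L 'h) set"
  assumes T: "openin ultraweak_topology T" "0 \<in> T"
  shows "\<exists>\<zeta> c. sq_summable \<zeta> \<and> 0 < c \<and>
    (\<forall>w\<in>cbounded_ops. (\<Sum>n. (norm (blinfun_apply w (\<zeta> n)))\<^sup>2) < c \<longrightarrow> adj w \<cdot> w \<in> T)"
proof -
  have sm: "summable (\<lambda>n. (norm (blinfun_apply w (\<zeta> n)))\<^sup>2)" if "sq_summable \<zeta>" for w :: "'h \<Rightarrow>\<^sub>L 'h" and \<zeta>
    using sq_summable_blinfun[OF that] by (simp add: sq_summable_def)
  have nn: "0 \<le> (\<Sum>n. (norm (blinfun_apply w (\<zeta> n)))\<^sup>2)" if "sq_summable \<zeta>" for w :: "'h \<Rightarrow>\<^sub>L 'h" and \<zeta>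
    using sm[OF that] by (simp add: suminf_nonneg)
  have il: "sq_summable (interleave \<xi> \<eta>)" if "sq_summable \<xi>" "sq_summable \<eta>" for \<xi> \<eta> :: "nat \<Rightarrow> 'h"
    using interleave_sums[of "\<lambda>v. (norm v)\<^sup>2" \<xi> \<eta>] that by (auto simp: sq_summable_def sums_iff)
  have ilw: "(\<Sum>n. (norm (blinfun_apply w (interleave \<xi> \<eta> n)))\<^sup>2) =
      (\<Sum>n. (norm (blinfun_apply w (\<xi> n)))\<^sup>2) + (\<Sum>n. (norm (blinfun_apply w (\<eta> n)))\<^sup>2)"
    if "sq_summable \<xi>" "sq_summable \<eta>" for w :: "'h \<Rightarrow>\<^sub>L 'h" and \<xi> \<eta>
    using interleave_sums[of "\<lambda>v. (norm (blinfun_apply w v))\<^sup>2" \<xi> \<eta>] sm that by (simp add: sums_iff)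
  have "generate_topology_on
    {(\<lambda>x. \<Sum>n. cinner (\<xi> n) (blinfun_apply x (\<eta> n))) -` U | (\<xi> :: nat \<Rightarrow> 'h) (\<eta> :: nat \<Rightarrow> 'h) U.
      summable (\<lambda>n. (norm (\<xi> n))\<^sup>2) \<and> summable (\<lambda>n. (norm (\<eta> n))\<^sup>2) \<and> open U} T"
    using T by (simp add: ultraweak_topology_def openin_topology_generated_by_iff)
  then show ?thesis using T(2)
  proof (induction rule: generate_topology_on.induct)
    case (Int a b)
    then have ab: "0 \<in> a" "0 \<in> b" by auto
    from Int.IH(1)[OF ab(1)] obtain \<xi> c where 1: "sq_summable \<xi>" "0 < c"
      "\<And>w. w \<in> cbounded_ops \<Longrightarrow> (\<Sum>n. (norm (blinfun_apply w (\<xi> n)))\<^sup>2) < c \<Longrightarrow> adj w \<cdot> w \<in> a"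
      by auto
    from Int.IH(2)[OF ab(2)] obtain \<eta> d where 2: "sq_summable \<eta>" "0 < d"
      "\<And>w. w \<in> cbounded_ops \<Longrightarrow> (\<Sum>n. (norm (blinfun_apply w (\<eta> n)))\<^sup>2) < d \<Longrightarrow> adj w \<cdot> w \<in> b"
      by auto
    show ?case
    proof (intro exI conjI ballI impI)
      show "sq_summable (interleave \<xi> \<eta>)" using il 1 2 by blast
      show "0 < min c d" using 1 2 by simp
      fix w :: "'h \<Rightarrow>\<^sub>L 'h" assume w: "w \<in> cbounded_ops" "(\<Sum>n. (norm (blinfun_apply w (interleave \<xi> \<eta> n)))\<^sup>2) < min c d"
      with ilw[OF 1(1) 2(1), of w] nn[OF 1(1), of w] nn[OF 2(1), of w] 1(3)[OF w(1)] 2(3)[OF w(1)] show "adj w \<cdot> w \<in> a \<inter> b" by auto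
    qed
  next
    case (UN K)
    then obtain k where k: "k \<in> K" "0 \<in> k" by blast
    from UN.IH[OF this] k show ?case by blast
  next
    case (Basis s)
    then obtain \<xi> \<eta> U where s: "s = (\<lambda>x. \<Sum>n. cinner (\<xi> n) (blinfun_apply x (\<eta> n))) -` U"
      and sq: "sq_summable \<xi>" "sq_summable \<eta>" and U: "open U"
      unfolding sq_summable_def by blast
    have "cinner v 0 = 0" for v :: 'h using norm_cinner_le[of v 0] by simp
    then have "0 \<in> U" using Basis.prems unfolding s by simp
    then obtain c where c: "0 < c" "ball 0 c \<subseteq> U" using U openE by blast
    show ?case
    proof (intro exI conjI ballI impI)
      show "sq_summable (interleave \<xi> \<eta>)" using il sq by blast
      show "0 < c" by fact
      fix w :: "'h \<Rightarrow>\<^sub>L 'h" assume w: "w \<in> cbounded_ops" "(\<Sum>n. (norm (blinfun_apply w (interleave \<xi> \<eta> n)))\<^sup>2) < c"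
      have eq: "cinner (\<xi> n) ((adj w \<cdot> w) (\<eta> n)) = cinner (w (\<xi> n)) (w (\<eta> n))" for n
        using cinner_adj[OF adj_cbounded[OF w(1)]] w(1) by (simp add: adj_adj)
      have le: "cmod (cinner (w (\<xi> n)) (w (\<eta> n))) \<le> (norm (blinfun_apply w (\<xi> n)))\<^sup>2 + (norm (blinfun_apply w (\<eta> n)))\<^sup>2" for n
        by (rule order_trans[OF norm_cinner_le norm_mult_le_sq])
      have sm2: "summable (\<lambda>n. (norm (blinfun_apply w (\<xi> n)))\<^sup>2 + (norm (blinfun_apply w (\<eta> n)))\<^sup>2)"
        by (intro summable_add sm sq)
      have sm1: "summable (\<lambda>n. cmod (cinner (w (\<xi> n)) (w (\<eta> n))))"
        by (rule summable_comparison_test'[OF sm2, of 0]) (use le in simp)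
      have "cmod (\<Sum>n. cinner (\<xi> n) ((adj w \<cdot> w) (\<eta> n))) \<le> (\<Sum>n. cmod (cinner (w (\<xi> n)) (w (\<eta> n))))"
        unfolding eq by (rule summable_norm[OF sm1])
      also have "\<dots> \<le> (\<Sum>n. (norm (blinfun_apply w (\<xi> n)))\<^sup>2 + (norm (blinfun_apply w (\<eta> n)))\<^sup>2)"
        by (intro suminf_le le sm1 sm2)
      also have "\<dots> = (\<Sum>n. (norm (blinfun_apply w (\<xi> n)))\<^sup>2) + (\<Sum>n. (norm (blinfun_apply w (\<eta> n)))\<^sup>2)"
        by (rule suminf_add[symmetric]) (intro sm sq)+
      also have "\<dots> < c" using ilw[OF sq, of w] w(2) by simp
      finally show "adj w \<cdot> w \<in> s" using c(2) by (auto simp: s)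
    qed
  qed auto
qed

context tracial_vn
begin

text \<open>
  The square of the 2-norm of \<open>x - y\<close> is the trace of \<open>w* w\<close> with \<open>w = x - y\<close>, so normality of the
  trace turns the ultrastrong approximation into approximation in the 2-norm.
\<close>

theorem n2_density:
  assumes P: "star_subalgebra P" "P \<subseteq> M" and x: "x \<in> commutant (commutant P)" "x \<in> M" and e: "0 < e"
  shows "\<exists>y\<in>P. n2 (x - y) < e"
proof -
  have "continuous_map (subtopology ultraweak_topology M) euclidean \<tau>"
    using tracial by (simp add: tracial_vn_algebra_def normal_on_def)
  then have "openin (subtopology ultraweak_topology M)
      {z \<in> topspace (subtopology ultraweak_topology M). \<tau> z \<in> ball 0 (e\<^sup>2)}"
    by (rule openin_continuous_map_preimage) simp
  then obtain T where T: "openin ultraweak_topology T"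
    "{z \<in> topspace (subtopology ultraweak_topology M). \<tau> z \<in> ball 0 (e\<^sup>2)} = T \<inter> M"
    unfolding openin_subtopology by auto
  have "0 \<in> T"
  proof -
    have "0 \<in> {z \<in> topspace (subtopology ultraweak_topology M). \<tau> z \<in> ball 0 (e\<^sup>2)}"
      using e by (simp add: topspace_ultraweak tau_zero)
    then show ?thesis unfolding T(2) by simp
  qed
  from ultraweak_neighbourhood[OF T(1) this] obtain \<zeta> c where \<zeta>: "sq_summable \<zeta>" "0 < c"
    "\<And>w. w \<in> cbounded_ops \<Longrightarrow> (\<Sum>n. (norm (blinfun_apply w (\<zeta> n)))\<^sup>2) < c \<Longrightarrow> adj w \<cdot> w \<in> T" by blast
  obtain y where y: "y \<in> P" "(\<Sum>n. (norm ((x - y) (\<zeta> n)))\<^sup>2) < c"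
    using ultrastrong_density[OF P(1) x(1) \<zeta>(1,2)] by blast
  have xy: "x - y \<in> M" using x y P by auto
  have "adj (x - y) \<cdot> (x - y) \<in> T \<inter> M"
    using \<zeta>(3)[OF _ y(2)] xy by simp
  then have "cmod (\<tau> (adj (x - y) \<cdot> (x - y))) < e\<^sup>2" unfolding T(2)[symmetric] by simp
  then have "Re (\<tau> (adj (x - y) \<cdot> (x - y))) < e\<^sup>2"
    using complex_Re_le_cmod order.strict_trans1 by blast
  then have "n2 (x - y) < sqrt (e\<^sup>2)" unfolding norm2_def by (rule real_sqrt_less_mono)
  with y(1) e show ?thesis by auto
qed

end

section \<open>Averaging over unitaries\<close>

definition unitaries :: "('h::chilbert_space \<Rightarrow>\<^sub>L 'h) set \<Rightarrow> ('h \<Rightarrow>\<^sub>L 'h) set"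
  where "unitaries Q = {u \<in> Q. adj u \<cdot> u = id_blinfun \<and> u \<cdot> adj u = id_blinfun}"

lemma norm_isometry_le:
  fixes u :: "'h::chilbert_space \<Rightarrow>\<^sub>L 'h"
  assumes u: "u \<in> cbounded_ops" "adj u \<cdot> u = id_blinfun"
  shows "norm u \<le> 1"
proof (rule norm_blinfun_bound)
  fix \<xi>
  have "u \<xi> \<bullet> u \<xi> = (adj u \<cdot> u) \<xi> \<bullet> \<xi>"
    using inner_adj[OF u(1), of "u \<xi>" \<xi>] by simp
  then show "norm (u \<xi>) \<le> 1 * norm \<xi>"
    by (simp add: u(2) norm_eq_sqrt_inner)
qed simp

instance chilbert_space \<subseteq> banach ..

text \<open>
  A one-sided inverse is a fixed point of the contraction \<open>S \<mapsto> 1 - T S\<close> or \<open>S \<mapsto> 1 - S T\<close>; the two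
  inverses coincide.
\<close>

lemma neumann_inverse:
  fixes T :: "'h::chilbert_space \<Rightarrow>\<^sub>L 'h"
  assumes T: "norm T \<le> 1/2"
  shows "\<exists>S. (id_blinfun + T) \<cdot> S = id_blinfun \<and> S \<cdot> (id_blinfun + T) = id_blinfun"
proof -
  have "\<exists>!S. id_blinfun - T \<cdot> S = S"
  proof (rule banach_fix_type[where c = "1/2" and f = "\<lambda>S. id_blinfun - T \<cdot> S"])
    show "\<forall>x y. dist (id_blinfun - T \<cdot> x) (id_blinfun - T \<cdot> y) \<le> 1/2 * dist x y"
    proof (intro allI)
    fix x y :: "'h \<Rightarrow>\<^sub>L 'h"
    have "dist (id_blinfun - T \<cdot> x) (id_blinfun - T \<cdot> y) = norm (T \<cdot> (x - y))"
      by (simp add: dist_norm compose_diff_right norm_minus_commute)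
    also have "\<dots> \<le> norm T * norm (x - y)" by (rule norm_blinfun_compose)
    also have "\<dots> \<le> 1/2 * norm (x - y)" by (intro mult_right_mono T) simp
    finally show "dist (id_blinfun - T \<cdot> x) (id_blinfun - T \<cdot> y) \<le> 1/2 * dist x y"
      by (simp add: dist_norm)
    qed
  qed auto
  then obtain S where S: "id_blinfun - T \<cdot> S = S" by blast
  have "\<exists>!S. id_blinfun - S \<cdot> T = S"
  proof (rule banach_fix_type[where c = "1/2" and f = "\<lambda>S. id_blinfun - S \<cdot> T"])
    show "\<forall>x y. dist (id_blinfun - x \<cdot> T) (id_blinfun - y \<cdot> T) \<le> 1/2 * dist x y"
    proof (intro allI)
    fix x y :: "'h \<Rightarrow>\<^sub>L 'h"
    have "dist (id_blinfun - x \<cdot> T) (id_blinfun - y \<cdot> T) = norm ((x - y) \<cdot> T)"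
      by (simp add: dist_norm compose_diff_left norm_minus_commute)
    also have "\<dots> \<le> norm (x - y) * norm T" by (rule norm_blinfun_compose)
    also have "\<dots> \<le> norm (x - y) * (1/2)" by (intro mult_left_mono T) simp
    finally show "dist (id_blinfun - x \<cdot> T) (id_blinfun - y \<cdot> T) \<le> 1/2 * dist x y"
      by (simp add: dist_norm)
    qed
  qed auto
  then obtain S' where S': "id_blinfun - S' \<cdot> T = S'" by blast
  have 1: "(id_blinfun + T) \<cdot> S = id_blinfun"
    using S by (simp add: op_simps algebra_simps)
  have 2: "S' \<cdot> (id_blinfun + T) = id_blinfun"
    using S' by (simp add: op_simps algebra_simps)
  have "S' = S' \<cdot> ((id_blinfun + T) \<cdot> S)" using 1 by (simp add: op_simps)
  also have "\<dots> = S" unfolding compose_assoc[symmetric] 2 by (simp add: op_simps)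
  finally show ?thesis using 1 2 by blast
qed

lemma inverse_commute:
  fixes A :: "'h::chilbert_space \<Rightarrow>\<^sub>L 'h"
  assumes "A \<cdot> S = id_blinfun" "S \<cdot> A = id_blinfun" "A \<cdot> y = y \<cdot> A"
  shows "S \<cdot> y = y \<cdot> S"
proof -
  have "S \<cdot> y = S \<cdot> (y \<cdot> A) \<cdot> S"
    using assms(1) by (simp add: op_simps)
  also have "\<dots> = (S \<cdot> A) \<cdot> (y \<cdot> S)"
    by (simp only: assms(3)[symmetric] compose_assoc)
  also have "\<dots> = y \<cdot> S"
    by (simp only: assms(2) compose_id)
  finally show ?thesis .
qed

text \<open>
  An inverse commutes with everything that commutes with the element, so bicommutants are closed under
  inverses.
\<close>

lemma vn_inverse:
  assumes Q: "von_neumann_algebra Q" and A: "A \<in> Q"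
    and S: "A \<cdot> S = id_blinfun" "S \<cdot> A = id_blinfun"
  shows "S \<in> Q"
proof -
  have "S \<in> commutant (commutant Q)"
    unfolding commutant_def[of "commutant Q"]
  proof (intro CollectI conjI ballI)
    show "S \<in> cbounded_ops"
      unfolding cbounded_iff_commute
      by (rule inverse_commute[OF S]) (use vn_cbounded[OF Q A] cbounded_iff_commute in blast)
    show "S \<cdot> y = y \<cdot> S" if "y \<in> commutant Q" for y
      using commutant_commutes[OF that A] by (intro inverse_commute[OF S]) simp
  qed
  then show ?thesis by (simp add: vn_bicommutant[OF Q])
qed

text \<open>
  With \<open>S = (1 + T)\<^sup>-\<^sup>1\<close>, the element \<open>2 S - 1 = (1 - T) (1 + T)\<^sup>-\<^sup>1\<close> is the Cayley transform of the
  skew-adjoint \<open>T\<close>. It recovers \<open>T\<close> from a unitary by algebra alone.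
\<close>

lemma cayley_unitary:
  assumes Q: "von_neumann_algebra Q" and T: "T \<in> Q" "adj T = - T" "norm T \<le> 1/2"
  shows "\<exists>S\<in>Q. (id_blinfun + T) \<cdot> S = id_blinfun \<and> S \<cdot> (id_blinfun + T) = id_blinfun \<and>
    2 *\<^sub>R S - id_blinfun \<in> unitaries Q"
proof -
  obtain S where S: "(id_blinfun + T) \<cdot> S = id_blinfun" "S \<cdot> (id_blinfun + T) = id_blinfun"
    using neumann_inverse[OF T(3)] by blast
  have SQ: "S \<in> Q"
    by (rule vn_inverse[OF Q _ S]) (intro vn_add[OF Q] vn_id[OF Q] T)
  note cb = vn_cbounded[OF Q]
  have 1: "adj S \<cdot> (id_blinfun - T) = id_blinfun"
    using arg_cong[OF S(1), of adj] T cb[OF SQ] cb[OF T(1)]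
    by (simp add: adj_compose adj_add adj_id cbounded_add cbounded_id)
  have 2: "(id_blinfun - T) \<cdot> adj S = id_blinfun"
    using arg_cong[OF S(2), of adj] T cb[OF SQ] cb[OF T(1)]
    by (simp add: adj_compose adj_add adj_id cbounded_add cbounded_id)
  have sum: "(id_blinfun - T) + (id_blinfun + T) = 2 *\<^sub>R (id_blinfun :: 'a \<Rightarrow>\<^sub>L 'a)" by (simp add: scaleR_2)
  have a: "2 *\<^sub>R (adj S \<cdot> S) = S + adj S"
  proof -
    have "2 *\<^sub>R (adj S \<cdot> S) = adj S \<cdot> ((id_blinfun - T) + (id_blinfun + T)) \<cdot> S"
      unfolding sum by (simp add: op_simps)
    also have "\<dots> = adj S \<cdot> (id_blinfun - T) \<cdot> S + adj S \<cdot> ((id_blinfun + T) \<cdot> S)"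
      by (simp only: compose_add_left compose_add_right compose_assoc)
    also have "\<dots> = S + adj S" unfolding 1 S by (simp add: op_simps)
    finally show ?thesis .
  qed
  have b: "2 *\<^sub>R (S \<cdot> adj S) = adj S + S"
  proof -
    have "2 *\<^sub>R (S \<cdot> adj S) = S \<cdot> ((id_blinfun - T) + (id_blinfun + T)) \<cdot> adj S"
      unfolding sum by (simp add: op_simps)
    also have "\<dots> = S \<cdot> ((id_blinfun - T) \<cdot> adj S) + S \<cdot> (id_blinfun + T) \<cdot> adj S"
      by (simp only: compose_add_left compose_add_right compose_assoc)
    also have "\<dots> = S + adj S" unfolding 2 S by (simp add: op_simps)
    finally show ?thesis by (simp add: add.commute)
  qed
  define u where "u = 2 *\<^sub>R S - id_blinfun"
  have au: "adj u = 2 *\<^sub>R adj S - id_blinfun"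
    unfolding u_def using cb[OF SQ] cb[OF vn_scaleR[OF Q SQ]]
    by (simp add: adj_diff adj_scaleR adj_id cbounded_id)
  have "adj u \<cdot> u = 2 *\<^sub>R (2 *\<^sub>R (adj S \<cdot> S)) - 2 *\<^sub>R (S + adj S) + id_blinfun"
    by (subst au, subst u_def) (simp add: op_simps scaleR_add_right scaleR_diff_right algebra_simps)
  then have 3: "adj u \<cdot> u = id_blinfun" unfolding a by simp
  have "u \<cdot> adj u = 2 *\<^sub>R (2 *\<^sub>R (S \<cdot> adj S)) - 2 *\<^sub>R (adj S + S) + id_blinfun"
    by (subst au, subst u_def) (simp add: op_simps scaleR_add_right scaleR_diff_right algebra_simps)
  then have 4: "u \<cdot> adj u = id_blinfun" unfolding b by simp
  have "u \<in> Q" unfolding u_def by (intro vn_diff[OF Q] vn_scaleR[OF Q] vn_id[OF Q] SQ)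
  with 3 4 S SQ show ?thesis by (auto simp: unitaries_def u_def)
qed

context tracial_vn
begin

context
  fixes \<phi> assumes \<phi>: "trace_preserving_aut M \<tau> \<phi>"
begin

lemma aut:
  shows aut_M: "x \<in> M \<Longrightarrow> \<phi> x \<in> M"
    and aut_add: "x \<in> M \<Longrightarrow> y \<in> M \<Longrightarrow> \<phi> (x + y) = \<phi> x + \<phi> y"
    and aut_scaleC: "x \<in> M \<Longrightarrow> \<phi> (a *\<^sub>C x) = a *\<^sub>C \<phi> x"
    and aut_compose: "x \<in> M \<Longrightarrow> y \<in> M \<Longrightarrow> \<phi> (x \<cdot> y) = \<phi> x \<cdot> \<phi> y"
    and aut_adj: "x \<in> M \<Longrightarrow> \<phi> (adj x) = adj (\<phi> x)"
    and aut_tau: "x \<in> M \<Longrightarrow> \<tau> (\<phi> x) = \<tau> x"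
    and aut_surj: "y \<in> M \<Longrightarrow> \<exists>x\<in>M. y = \<phi> x"
    and aut_inj: "x \<in> M \<Longrightarrow> y \<in> M \<Longrightarrow> \<phi> x = \<phi> y \<Longrightarrow> x = y"
  using \<phi> by (auto simp: trace_preserving_aut_def bij_betw_def inj_on_def)

lemma aut_scaleR: "x \<in> M \<Longrightarrow> \<phi> (r *\<^sub>R x) = r *\<^sub>R \<phi> x"
  using aut_scaleC[of x "complex_of_real r"] by (simp only: scaleC_of_real)

lemma aut_diff: "x \<in> M \<Longrightarrow> y \<in> M \<Longrightarrow> \<phi> (x - y) = \<phi> x - \<phi> y"
  using aut_add[of x "- y"] aut_scaleR[of y "-1"] by simp

lemma aut_id: "\<phi> id_blinfun = id_blinfun"
proof -
  obtain y where y: "y \<in> M" "id_blinfun = \<phi> y" using aut_surj[of id_blinfun] by auto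
  have "\<phi> id_blinfun = \<phi> id_blinfun \<cdot> \<phi> y" unfolding y(2)[symmetric] by (simp add: op_simps)
  also have "\<dots> = \<phi> (id_blinfun \<cdot> y)" using y by (simp add: aut_compose)
  also have "\<dots> = id_blinfun" using y by (simp add: op_simps)
  finally show ?thesis .
qed

lemma aut_n2: "x \<in> M \<Longrightarrow> n2 (\<phi> x) = n2 x"
  by (simp add: norm2_def aut_tau flip: aut_adj aut_compose)

lemma aut_contr:
  assumes x: "x \<in> contr" shows "\<phi> x \<in> contr"
proof (rule contrI)
  show "\<phi> x \<in> M" using x by (simp add: aut_M)
  fix y assume "y \<in> M"
  then obtain z where z: "z \<in> M" "y = \<phi> z" using aut_surj by blast
  then have "n2 (\<phi> x \<cdot> y) = n2 (x \<cdot> z)"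
    using x by (simp add: aut_n2 flip: aut_compose)
  also have "\<dots> \<le> n2 y" using x z by (simp add: contr_left aut_n2)
  finally show "n2 (\<phi> x \<cdot> y) \<le> n2 y" .
qed

lemma aut_compose_le:
  assumes x: "x \<in> M" and y: "y \<in> M"
  shows "n2 (\<phi> x \<cdot> y) \<le> norm x * n2 y"
proof -
  obtain z where z: "z \<in> M" "y = \<phi> z" using aut_surj[OF y] by blast
  then have "n2 (\<phi> x \<cdot> y) = n2 (x \<cdot> z)"
    using x by (simp add: aut_n2 flip: aut_compose)
  also have "\<dots> \<le> norm x * n2 y" using x z by (simp add: n2_compose_le aut_n2)
  finally show ?thesis .
qed

text \<open>
  If \<open>h\<close> intertwines the Cayley transform of a small skew-adjoint \<open>T\<close>, then it intertwines
  \<open>(1 + T)\<^sup>-\<^sup>1\<close> and hence \<open>T\<close>. Every element is a combination of two skew-adjoint ones.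
\<close>

lemma intertwines_of_unitaries:
  assumes Q: "von_neumann_algebra Q" "Q \<subseteq> M" and h: "h \<in> M"
    and u: "\<And>u. u \<in> unitaries Q \<Longrightarrow> \<phi> u \<cdot> h = h \<cdot> u" and x: "x \<in> Q"
  shows "\<phi> x \<cdot> h = h \<cdot> x"
proof -
  have QM: "y \<in> Q \<Longrightarrow> y \<in> M" for y using Q by blast
  have small: "\<phi> T \<cdot> h = h \<cdot> T" if T: "T \<in> Q" "adj T = - T" "norm T \<le> 1/2" for T
  proof -
    obtain S where S: "S \<in> Q" "(id_blinfun + T) \<cdot> S = id_blinfun" "S \<cdot> (id_blinfun + T) = id_blinfun"
      "2 *\<^sub>R S - id_blinfun \<in> unitaries Q" using cayley_unitary[OF Q(1) T] by blast
    have "2 *\<^sub>R (\<phi> S \<cdot> h) = 2 *\<^sub>R (h \<cdot> S)"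
      using u[OF S(4)] QM[OF S(1)] by (simp add: aut_diff aut_scaleR aut_id op_simps)
    then have Sh: "\<phi> S \<cdot> h = h \<cdot> S" by simp
    have "h \<cdot> (id_blinfun + T) = \<phi> ((id_blinfun + T) \<cdot> S) \<cdot> h \<cdot> (id_blinfun + T)"
      unfolding S(2) aut_id by (simp add: op_simps)
    also have "\<dots> = \<phi> (id_blinfun + T) \<cdot> (\<phi> S \<cdot> h) \<cdot> (id_blinfun + T)"
      using QM[OF S(1)] QM[OF T(1)] by (simp add: aut_compose compose_assoc)
    also have "\<dots> = \<phi> (id_blinfun + T) \<cdot> h \<cdot> (S \<cdot> (id_blinfun + T))"
      unfolding Sh by (simp only: compose_assoc)
    also have "\<dots> = \<phi> (id_blinfun + T) \<cdot> h" unfolding S(3) by (simp add: op_simps)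
    finally show ?thesis
      using QM[OF T(1)] by (simp add: aut_add aut_id op_simps)
  qed
  have skew: "\<phi> T \<cdot> h = h \<cdot> T" if T: "T \<in> Q" "adj T = - T" for T
  proof -
    define r where "r = 1 / (2 * (norm T + 1))"
    have r: "0 < r" unfolding r_def by (simp add: add_nonneg_pos)
    have "r * norm T \<le> r * (norm T + 1)" using r by simp
    also have "\<dots> = 1/2"
      unfolding r_def using add_nonneg_pos[OF norm_ge_zero[of T] zero_less_one] by simp
    finally have "norm (r *\<^sub>R T) \<le> 1/2" using r by simp
    then have "\<phi> (r *\<^sub>R T) \<cdot> h = h \<cdot> (r *\<^sub>R T)"
      using T vn_scaleR[OF Q(1) T(1)] QM[OF T(1)] by (intro small) (auto simp: adj_scaleR)
    then show ?thesis using r QM[OF T(1)] by (simp add: aut_scaleR op_simps)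
  qed
  \<comment> \<open>Two skew-adjoint elements with \<open>x = A - \<i> B\<close>.\<close>
  define A where "A = (1/2) *\<^sub>R (x - adj x)"
  define B where "B = \<i> *\<^sub>C ((1/2) *\<^sub>R (x + adj x))"
  have AB: "A \<in> Q" "B \<in> Q"
    using x Q(1) by (auto simp: A_def B_def intro!: vn_scaleR vn_scaleC vn_add vn_diff vn_adj)
  have xM: "x \<in> M" by (rule QM[OF x])
  have adjA: "adj A = - A" unfolding A_def using xM by (simp add: adj_simps flip: scaleR_minus_right)
  have adjB: "adj B = - B"
    unfolding B_def using xM by (simp add: adj_simps adj_scaleC add.commute minus_scaleC)
  have dec: "x = A + (- \<i>) *\<^sub>C B"
    unfolding A_def B_def scaleC_scaleC by (simp add: scaleC_one flip: scaleR_add_right)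
  have "\<phi> x \<cdot> h = \<phi> A \<cdot> h + (- \<i>) *\<^sub>C (\<phi> B \<cdot> h)"
    by (subst dec) (use QM[OF AB(1)] QM[OF AB(2)] in \<open>simp add: aut_add aut_scaleC op_simps compose_scaleC\<close>)
  also have "\<dots> = h \<cdot> A + (- \<i>) *\<^sub>C (h \<cdot> B)" by (simp add: skew AB adjA adjB)
  also have "\<dots> = h \<cdot> x"
    using h by (subst dec) (simp add: op_simps compose_scaleC)
  finally show ?thesis .
qed

text \<open>
  The element of least 2-norm in the closed convex hull of \<open>{\<phi>(u) u* | u}\<close>, \<open>u\<close> unitary in \<open>Q\<close>,
  is fixed by all maps \<open>k \<mapsto> \<phi>(u) k u*\<close>, because these permute the hull and preserve the 2-norm.
\<close>

theorem intertwiner_near_identity: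
  assumes Q: "von_neumann_algebra Q" "Q \<subseteq> M"
    and \<epsilon>: "\<And>x. x \<in> Q \<Longrightarrow> norm x \<le> 1 \<Longrightarrow> n2 (\<phi> x - x) \<le> \<epsilon>"
  shows "\<exists>h\<in>M. norm h \<le> 1 \<and> (\<forall>x\<in>Q. \<phi> x \<cdot> h = h \<cdot> x) \<and> n2 (h - id_blinfun) \<le> \<epsilon>"
proof -
  define G where "G = (\<lambda>u. \<phi> u \<cdot> adj u) ` unitaries Q"
  define K where "K = convex hull G"
  have U: "u \<in> M" "u \<in> Q" "adj u \<cdot> u = id_blinfun" "u \<cdot> adj u = id_blinfun" "norm u \<le> 1" "norm (\<phi> u) \<le> 1"
    "norm (adj u) \<le> 1"
    if u: "u \<in> unitaries Q" for u
  proof -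
    show uM: "u \<in> M" "u \<in> Q" "adj u \<cdot> u = id_blinfun" "u \<cdot> adj u = id_blinfun"
      using u Q by (auto simp: unitaries_def)
    show nu: "norm u \<le> 1" using uM by (intro norm_isometry_le) auto
    show "norm (\<phi> u) \<le> 1"
      using uM aut_compose[of "adj u" u] by (intro norm_isometry_le) (auto simp: aut_M aut_adj aut_id)
    show "norm (adj u) \<le> 1" using norm_adj_le[of u] nu uM(1) by simp
  qed
  have KL: "K \<subseteq> {k \<in> M. norm k \<le> 1 \<and> n2 (k - id_blinfun) \<le> \<epsilon>}"
    unfolding K_def
  proof (rule hull_minimal)
    show "G \<subseteq> {k \<in> M. norm k \<le> 1 \<and> n2 (k - id_blinfun) \<le> \<epsilon>}"
      unfolding G_def
    proof safe
      fix u assume u: "u \<in> unitaries Q"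
      show "\<phi> u \<cdot> adj u \<in> M" using U[OF u] by (simp add: aut_M)
      have "norm (\<phi> u \<cdot> adj u) \<le> norm (\<phi> u) * norm (adj u)" by (rule norm_blinfun_compose)
      also have "\<dots> \<le> 1 * 1" using U[OF u] by (intro mult_mono) auto
      finally show "norm (\<phi> u \<cdot> adj u) \<le> 1" by simp
      have "\<phi> u \<cdot> adj u - id_blinfun = (\<phi> u - u) \<cdot> adj u"
        using U[OF u] by (simp add: op_simps)
      also have "n2 \<dots> \<le> n2 (\<phi> u - u)"
        using U[OF u] by (intro contr_right contr_of_norm_le_1) (auto simp: aut_M)
      also have "\<dots> \<le> \<epsilon>" using U[OF u] by (intro \<epsilon>)
      finally show "n2 (\<phi> u \<cdot> adj u - id_blinfun) \<le> \<epsilon>" .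
    qed
    show "convex {k \<in> M. norm k \<le> 1 \<and> n2 (k - id_blinfun) \<le> \<epsilon>}"
      unfolding convex_def
    proof (intro ballI allI impI, safe)
      fix a b :: "'h \<Rightarrow>\<^sub>L 'h" and s t :: real
      assume *: "a \<in> M" "norm a \<le> 1" "n2 (a - id_blinfun) \<le> \<epsilon>" "b \<in> M" "norm b \<le> 1" "n2 (b - id_blinfun) \<le> \<epsilon>"
        "0 \<le> s" "0 \<le> t" "s + t = 1"
      show "s *\<^sub>R a + t *\<^sub>R b \<in> M" using * by simp
      have "norm (s *\<^sub>R a + t *\<^sub>R b) \<le> s * norm a + t * norm b"
        using * by (intro order_trans[OF norm_triangle_ineq]) auto
      also have "\<dots> \<le> s * 1 + t * 1" using * by (intro add_mono mult_left_mono) auto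
      finally show "norm (s *\<^sub>R a + t *\<^sub>R b) \<le> 1" using * by simp
      have "s *\<^sub>R a + t *\<^sub>R b - id_blinfun = s *\<^sub>R a + t *\<^sub>R b - (s + t) *\<^sub>R id_blinfun" using * by simp
      also have "\<dots> = s *\<^sub>R (a - id_blinfun) + t *\<^sub>R (b - id_blinfun)"
        by (simp add: algebra_simps)
      also have "n2 \<dots> \<le> s * n2 (a - id_blinfun) + t * n2 (b - id_blinfun)"
        using * by (intro order_trans[OF n2_triangle]) (auto simp: n2_scaleR)
      also have "\<dots> \<le> s * \<epsilon> + t * \<epsilon>" using * by (intro add_mono mult_left_mono) auto
      also have "\<dots> = (s + t) * \<epsilon>" by (simp add: algebra_simps)
      finally show "n2 (s *\<^sub>R a + t *\<^sub>R b - id_blinfun) \<le> \<epsilon>" using * by simp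
    qed
  qed
  have KM: "k \<in> M" "norm k \<le> 1" "n2 (k - id_blinfun) \<le> \<epsilon>" if "k \<in> K" for k using KL that by auto
  have cK: "convex K" unfolding K_def by (rule convex_convex_hull)
  have stable: "\<phi> v \<cdot> k \<cdot> adj v \<in> K" if v: "v \<in> unitaries Q" and k: "k \<in> K" for v k
  proof -
    have "K \<subseteq> {k. \<phi> v \<cdot> k \<cdot> adj v \<in> K}"
      unfolding K_def
    proof (rule hull_minimal; fold K_def)
      show "convex {k. \<phi> v \<cdot> k \<cdot> adj v \<in> K}"
        unfolding convex_def using cK by (auto simp: op_simps convex_def)
      show "G \<subseteq> {k. \<phi> v \<cdot> k \<cdot> adj v \<in> K}"
        unfolding G_def
      proof safe
        fix u assume u: "u \<in> unitaries Q"
        have "adj (v \<cdot> u) \<cdot> (v \<cdot> u) = adj u \<cdot> (adj v \<cdot> v) \<cdot> u" "(v \<cdot> u) \<cdot> adj (v \<cdot> u) = v \<cdot> (u \<cdot> adj u) \<cdot> adj v"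
          using U(1)[OF u] U(1)[OF v] by (simp_all add: adj_simps compose_assoc)
        then have "v \<cdot> u \<in> unitaries Q"
          using U[OF u] U[OF v] vn_compose[OF Q(1), of v u] by (simp add: unitaries_def op_simps)
        then have "\<phi> (v \<cdot> u) \<cdot> adj (v \<cdot> u) \<in> K"
          unfolding K_def G_def by (intro hull_inc imageI)
        then show "\<phi> v \<cdot> (\<phi> u \<cdot> adj u) \<cdot> adj v \<in> K"
          using U[OF u] U[OF v] by (simp add: aut_compose adj_simps compose_assoc)
      qed
    qed
    with k show ?thesis by blast
  qed
  have "id_blinfun \<in> unitaries Q" using vn_id[OF Q(1)] by (simp add: unitaries_def adj_simps op_simps)
  then have ne: "K \<noteq> {}" unfolding K_def G_def by auto
  define d where "d = (INF k\<in>K. n2 k)"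
  have bdd: "bdd_below (n2 ` K)" using KM n2_nonneg by (intro bdd_belowI2[of _ 0]) auto
  have dle: "d \<le> n2 k" if "k \<in> K" for k unfolding d_def by (rule cINF_lower[OF bdd that])
  have d0: "0 \<le> d" unfolding d_def using KM n2_nonneg by (intro cINF_greatest ne) auto
  have "\<exists>k\<in>K. n2 k < d + 1 / real (Suc n)" for n
    using cINF_less_iff[OF ne bdd, of "d + 1 / real (Suc n)"] by (simp add: d_def)
  then obtain k where k: "k n \<in> K" "n2 (k n) < d + 1 / real (Suc n)" for n by metis
  have kd: "(\<lambda>n. n2 (k n)) \<longlonglongrightarrow> d"
  proof (rule tendsto_sandwich[where f = "\<lambda>_. d"])
    show "(\<lambda>n. d + 1 / real (Suc n)) \<longlonglongrightarrow> d"
      using tendsto_add[OF tendsto_const LIMSEQ_inverse_real_of_nat, of d]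
      by (simp add: inverse_eq_divide)
  qed (use k dle in \<open>auto intro!: always_eventually less_imp_le\<close>)
  have par: "(n2 (a - b))\<^sup>2 \<le> 2 * (n2 a)\<^sup>2 + 2 * (n2 b)\<^sup>2 - 4 * d\<^sup>2" if ab: "a \<in> K" "b \<in> K" for a b
  proof -
    have "(1/2) *\<^sub>R a + (1/2) *\<^sub>R b \<in> K" using ab cK by (intro convexD) auto
    then have "d\<^sup>2 \<le> (n2 ((1/2) *\<^sub>R (a + b)))\<^sup>2"
      using d0 by (intro power_mono dle) (auto simp: scaleR_add_right)
    then show ?thesis using n2_parallelogram[OF KM(1)[OF ab(1)] KM(1)[OF ab(2)]] by linarith
  qed
  have "\<exists>N. \<forall>m\<ge>N. \<forall>n\<ge>N. n2 (k m - k n) < e" if "0 < e" for e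
    using minimizing_Cauchy[of "\<lambda>n. n2 (k n)" d "\<lambda>m n. n2 (k m - k n)", OF kd par[OF k(1) k(1)] that]
    by metis
  from n2_complete[of k, OF KM(1)[OF k(1)] KM(2)[OF k(1)] this]
  obtain h where h: "h \<in> M" "norm h \<le> 1" and kh: "(\<lambda>n. n2 (k n - h)) \<longlonglongrightarrow> 0" by blast
  have kM: "k n \<in> M" for n by (rule KM(1)[OF k(1)])
  have "n2 (h - id_blinfun) \<le> \<epsilon>"
  proof (rule LIMSEQ_le_const)
    show "(\<lambda>n. n2 (k n - h) + \<epsilon>) \<longlonglongrightarrow> \<epsilon>"
      using tendsto_add[OF kh tendsto_const, of \<epsilon>] by simp
    have "n2 (h - id_blinfun) \<le> n2 (k n - h) + \<epsilon>" for n
      using n2_triangle_diff[of h "k n" id_blinfun] KM(3)[OF k(1)[of n]] h kM[of n] n2_minus_commute[of h "k n"] by simp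
    then show "\<exists>N. \<forall>n\<ge>N. n2 (h - id_blinfun) \<le> n2 (k n - h) + \<epsilon>" by blast
  qed
  moreover have "\<phi> x \<cdot> h = h \<cdot> x" if x: "x \<in> Q" for x
  proof (rule intertwines_of_unitaries[OF Q h(1) _ x])
    fix v assume v: "v \<in> unitaries Q"
    have vc: "\<phi> v \<in> contr" "adj v \<in> contr"
      using U[OF v] by (auto intro!: contr_of_norm_le_1 simp: aut_M)
    \<comment> \<open>Conjugation by \<open>v\<close>, twisted by \<open>\<phi>\<close>; it maps \<open>K\<close> into itself without increasing the 2-norm.\<close>
    define ad where "ad y = \<phi> v \<cdot> y \<cdot> adj v" for y
    have adM: "ad y \<in> M" if "y \<in> M" for y using that U[OF v] by (simp add: ad_def aut_M)
    have adn: "n2 (ad y) \<le> n2 y" if "y \<in> M" for y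
      unfolding ad_def using that vc by (intro order_trans[OF contr_right contr_left]) auto
    have add: "ad (y - z) = ad y - ad z" for y z by (simp add: ad_def op_simps)
    \<comment> \<open>By the parallelogram law, a bound for the distance between \<open>k n\<close> and its conjugate.\<close>
    define b where "b n = sqrt (4 * (n2 (k n))\<^sup>2 - 4 * d\<^sup>2)" for n
    have "b \<longlonglongrightarrow> sqrt (4 * d\<^sup>2 - 4 * d\<^sup>2)"
      unfolding b_def by (intro tendsto_intros kd)
    then have b: "b \<longlonglongrightarrow> 0" by simp
    have le: "n2 (ad h - h) \<le> 2 * n2 (k n - h) + b n" for n
    proof -
      have "(n2 (ad (k n) - k n))\<^sup>2 \<le> 2 * (n2 (ad (k n)))\<^sup>2 + 2 * (n2 (k n))\<^sup>2 - 4 * d\<^sup>2"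
        using stable[OF v k(1)] k(1) by (intro par) (auto simp: ad_def)
      also have "\<dots> \<le> 4 * (n2 (k n))\<^sup>2 - 4 * d\<^sup>2"
        using power_mono[OF adn[OF kM[of n]] n2_nonneg[OF adM[OF kM[of n]]], of 2] by linarith
      finally have 1: "n2 (ad (k n) - k n) \<le> b n"
        unfolding b_def by (rule real_le_rsqrt)
      have "n2 (ad h - h) \<le> n2 (ad h - ad (k n)) + n2 (ad (k n) - h)"
        using h kM by (intro n2_triangle_diff adM) auto
      moreover have "n2 (ad (k n) - h) \<le> n2 (ad (k n) - k n) + n2 (k n - h)"
        using h kM by (intro n2_triangle_diff adM) auto
      moreover have "n2 (ad h - ad (k n)) \<le> n2 (k n - h)"
        unfolding add[symmetric] using adn[of "h - k n"] h kM[of n] n2_minus_commute[of h "k n"] by simp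
      ultimately show ?thesis using 1 by linarith
    qed
    have "n2 (ad h - h) \<le> 0"
    proof (rule LIMSEQ_le_const)
      have "(\<lambda>n. 2 * n2 (k n - h) + b n) \<longlonglongrightarrow> 2 * 0 + 0" by (intro tendsto_intros kh b)
      then show "(\<lambda>n. 2 * n2 (k n - h) + b n) \<longlonglongrightarrow> 0" by simp
    qed (use le in blast)
    then have "ad h - h = 0"
      using h adM[OF h(1)] n2_nonneg[of "ad h - h"] by (intro n2_eq_0) auto
    then have "h \<cdot> v = ad h \<cdot> v" by simp
    also have "\<dots> = \<phi> v \<cdot> h \<cdot> (adj v \<cdot> v)" by (simp only: ad_def compose_assoc)
    also have "\<dots> = \<phi> v \<cdot> h" using U[OF v] by (simp add: op_simps)
    finally show "\<phi> v \<cdot> h = h \<cdot> v" by simp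
  qed
  ultimately show ?thesis using h by blast
qed

end

end

section \<open>Intertwiners of an s-malleable deformation\<close>

locale deformation = tracial_vn A \<tau>
  for A :: "('h::chilbert_space \<Rightarrow>\<^sub>L 'h) set" and \<tau> +
  fixes M :: "('h \<Rightarrow>\<^sub>L 'h) set" and \<alpha> \<beta>
  assumes sub: "M \<subseteq> A" and malleable: "s_malleable_deformation M A \<tau> \<alpha> \<beta>"
begin

lemma alpha_aut: "trace_preserving_aut A \<tau> (\<alpha> t)"
  and beta_aut: "trace_preserving_aut A \<tau> \<beta>"
  and alpha_add: "x \<in> A \<Longrightarrow> \<alpha> (s + t) x = \<alpha> s (\<alpha> t x)"
  and beta_fix: "x \<in> M \<Longrightarrow> \<beta> x = x"
  and beta_alpha: "x \<in> A \<Longrightarrow> \<beta> (\<alpha> t x) = \<alpha> (- t) (\<beta> x)"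
  using malleable by (auto simp: s_malleable_deformation_def)

lemmas alpha_simps = aut_M[OF alpha_aut] aut_add[OF alpha_aut] aut_diff[OF alpha_aut]
  aut_scaleC[OF alpha_aut] aut_n2[OF alpha_aut] aut_id[OF alpha_aut]

lemmas beta_simps = aut_M[OF beta_aut] aut_diff[OF beta_aut] aut_compose[OF beta_aut]
  aut_adj[OF beta_aut] aut_id[OF beta_aut]

lemma alpha_zero: "x \<in> A \<Longrightarrow> \<alpha> 0 x = x"
  using alpha_add[of x 0 0] aut_inj[OF alpha_aut[of 0], of "\<alpha> 0 x" x] by (simp add: alpha_simps)

definition intertwiners :: "real \<Rightarrow> ('h \<Rightarrow>\<^sub>L 'h) set \<Rightarrow> ('h \<Rightarrow>\<^sub>L 'h) set"
  where "intertwiners t Q = {v \<in> A. \<forall>x\<in>Q. \<alpha> t x \<cdot> v = v \<cdot> x}"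

lemma intertwinersD:
  "v \<in> intertwiners t Q \<Longrightarrow> v \<in> A" "v \<in> intertwiners t Q \<Longrightarrow> x \<in> Q \<Longrightarrow> \<alpha> t x \<cdot> v = v \<cdot> x"
  by (auto simp: intertwiners_def)

lemma intertwiners_antimono: "Q' \<subseteq> Q \<Longrightarrow> intertwiners t Q \<subseteq> intertwiners t Q'"
  by (auto simp: intertwiners_def)

text \<open>
  Both elements implement \<open>\<alpha>\<^sub>t\<close> on \<open>Q\<close>, and the adjoint of the first one undoes it.
\<close>

lemma intertwiners_quotient:
  assumes Q: "Q \<subseteq> A" "\<And>x. x \<in> Q \<Longrightarrow> adj x \<in> Q"
    and u: "u \<in> intertwiners t Q" and v: "v \<in> intertwiners t Q"
  shows "adj u \<cdot> v \<in> commutant Q \<inter> A"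
proof -
  note uv = intertwinersD(1)[OF u] intertwinersD(1)[OF v]
  have "(adj u \<cdot> v) \<cdot> x = x \<cdot> (adj u \<cdot> v)" if x: "x \<in> Q" for x
  proof -
    have xA: "x \<in> A" using x Q by blast
    have "(adj u \<cdot> v) \<cdot> x = adj u \<cdot> (\<alpha> t x \<cdot> v)"
      by (simp add: intertwinersD(2)[OF v x] compose_assoc)
    also have "\<dots> = adj (\<alpha> t (adj x) \<cdot> u) \<cdot> v"
      using uv xA by (simp add: adj_simps aut_adj[OF alpha_aut] alpha_simps compose_assoc)
    also have "\<dots> = adj (u \<cdot> adj x) \<cdot> v" by (simp add: intertwinersD(2)[OF u Q(2)[OF x]])
    also have "\<dots> = x \<cdot> (adj u \<cdot> v)" using uv xA by (simp add: adj_simps compose_assoc)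
    finally show ?thesis .
  qed
  then show ?thesis using uv by (simp add: commutant_def)
qed

lemma intertwiners_compose:
  assumes "v \<in> intertwiners t Q" "c \<in> commutant Q" "c \<in> A"
  shows "v \<cdot> c \<in> intertwiners t Q"
  unfolding intertwiners_def
proof (intro CollectI conjI ballI)
  show "v \<cdot> c \<in> A" using assms intertwinersD by simp
  fix x assume x: "x \<in> Q"
  have "\<alpha> t x \<cdot> (v \<cdot> c) = v \<cdot> (x \<cdot> c)"
    by (simp add: intertwinersD(2)[OF assms(1) x] flip: compose_assoc)
  then show "\<alpha> t x \<cdot> (v \<cdot> c) = v \<cdot> c \<cdot> x"
    by (simp add: commutant_commutes[OF assms(2) x] compose_assoc)
qed

lemma newton_intertwiners:
  assumes Q: "Q \<subseteq> A" "\<And>x. x \<in> Q \<Longrightarrow> adj x \<in> Q" and u: "u \<in> intertwiners t Q"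
  shows "newton u \<in> intertwiners t Q"
proof -
  have uA: "u \<in> A" by (rule intertwinersD(1)[OF u])
  have b: "adj u \<cdot> u \<in> commutant Q" using intertwiners_quotient[OF Q u u] by simp
  \<comment> \<open>The Newton step multiplies \<open>u\<close> by an element of the relative commutant.\<close>
  define c where "c = (1/2) *\<^sub>R (3 *\<^sub>R id_blinfun - adj u \<cdot> u)"
  have "c \<cdot> x = x \<cdot> c" if "x \<in> Q" for x
    using commutant_commutes[OF b that] by (simp add: c_def op_simps)
  moreover have cA: "c \<in> A" using uA by (simp add: c_def)
  ultimately have "c \<in> commutant Q" by (simp add: commutant_def)
  then have "u \<cdot> c \<in> intertwiners t Q" by (rule intertwiners_compose[OF u _ cA])
  then show ?thesis by (simp add: c_def newton_def op_simps)
qed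

text \<open>
  The element that intertwines \<open>\<alpha>\<^sub>-\<^sub>t\<close> with \<open>\<alpha>\<^sub>t\<close>: \<open>\<beta>(v)*\<close> leads back from time \<open>-t\<close> to time 0 and
  \<open>v\<close> leads from there to time \<open>t\<close>. It is unchanged when \<open>v\<close> is multiplied on the right by a unitary
  fixed by \<open>\<beta>\<close>.
\<close>

definition twist :: "('h \<Rightarrow>\<^sub>L 'h) \<Rightarrow> 'h \<Rightarrow>\<^sub>L 'h"
  where "twist v = v \<cdot> adj (\<beta> v)"

lemma twist_A: "v \<in> A \<Longrightarrow> twist v \<in> A"
  by (simp add: twist_def beta_simps)

lemma twist_contr: "v \<in> contr \<Longrightarrow> twist v \<in> contr"
  unfolding twist_def by (intro contr_compose contr_adj aut_contr[OF beta_aut])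

text \<open>
  Applying \<open>\<beta>\<close> and the adjoint to the intertwining relation of \<open>v\<close> gives
  \<open>\<beta>(v)* \<alpha>\<^sub>-\<^sub>t(x) = x \<beta>(v)*\<close>, because \<open>\<beta>\<close> fixes \<open>x\<close> and reverses time. The outer \<open>\<alpha>\<^sub>t\<close> shifts the
  interval from \<open>-t\<close> to \<open>t\<close> to the one from 0 to \<open>2t\<close>.
\<close>

lemma twist_intertwiners:
  assumes Q: "Q \<subseteq> M" "\<And>x. x \<in> Q \<Longrightarrow> adj x \<in> Q" and v: "v \<in> intertwiners t Q"
  shows "\<alpha> t (twist v) \<in> intertwiners (2 * t) Q"
  unfolding intertwiners_def
proof (intro CollectI conjI ballI)
  have vA: "v \<in> A" by (rule intertwinersD(1)[OF v])
  then show "\<alpha> t (twist v) \<in> A" by (simp add: twist_A alpha_simps)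
  fix x assume x: "x \<in> Q"
  have xA: "x \<in> A" "adj x \<in> A" "x \<in> M" "adj x \<in> M" using x Q sub by auto
  have "\<beta> (\<alpha> t (adj x) \<cdot> v) = \<beta> (v \<cdot> adj x)"
    by (simp add: intertwinersD(2)[OF v Q(2)[OF x]])
  then have "\<alpha> (- t) (adj x) \<cdot> \<beta> v = \<beta> v \<cdot> adj x"
    using xA vA by (simp add: beta_simps beta_alpha beta_fix alpha_simps del: M_closed(6))
  then have "adj (\<alpha> (- t) (adj x) \<cdot> \<beta> v) = adj (\<beta> v \<cdot> adj x)" by simp
  then have 1: "adj (\<beta> v) \<cdot> \<alpha> (- t) x = x \<cdot> adj (\<beta> v)"
    using xA vA by (simp add: adj_simps beta_simps alpha_simps aut_adj[OF alpha_aut])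
  have "twist v \<cdot> \<alpha> (- t) x = v \<cdot> x \<cdot> adj (\<beta> v)"
    by (simp only: twist_def compose_assoc 1)
  also have "\<dots> = \<alpha> t x \<cdot> twist v"
    by (simp only: twist_def compose_assoc flip: intertwinersD(2)[OF v x])
  finally have "\<alpha> t (\<alpha> t x \<cdot> twist v) = \<alpha> t (twist v \<cdot> \<alpha> (- t) x)" by simp
  then have "\<alpha> t (\<alpha> t x) \<cdot> \<alpha> t (twist v) = \<alpha> t (twist v) \<cdot> \<alpha> t (\<alpha> (- t) x)"
    using xA vA by (simp add: aut_compose[OF alpha_aut] alpha_simps twist_A)
  then show "\<alpha> (2 * t) x \<cdot> \<alpha> t (twist v) = \<alpha> t (twist v) \<cdot> x"
    using xA alpha_add[of x t t] alpha_add[of x t "- t"] by (simp add: alpha_zero)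
qed

text \<open>
  If \<open>\<beta>\<close> fixes \<open>b = v* v\<close>, then the trace of \<open>\<beta>(v) b \<beta>(v)*\<close> is that of \<open>b \<beta>(v* v) = b\<^sup>2\<close>.
\<close>

lemma n2_twist:
  assumes v: "v \<in> A" and b: "adj v \<cdot> v \<in> M"
  shows "n2 (twist v) = n2 (adj v \<cdot> v)"
proof -
  have bv: "\<beta> v \<in> A" using v by (simp add: beta_simps)
  have "adj (twist v) \<cdot> twist v = \<beta> v \<cdot> (adj v \<cdot> v \<cdot> adj (\<beta> v))"
    using v bv by (simp add: twist_def adj_simps compose_assoc)
  then have "\<tau> (adj (twist v) \<cdot> twist v) = \<tau> (adj v \<cdot> v \<cdot> adj (\<beta> v) \<cdot> \<beta> v)"
    using v bv tau_commute[of "\<beta> v" "adj v \<cdot> v \<cdot> adj (\<beta> v)"] by simp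
  also have "adj v \<cdot> v \<cdot> adj (\<beta> v) \<cdot> \<beta> v = adj v \<cdot> v \<cdot> \<beta> (adj v \<cdot> v)"
    using v by (simp add: beta_simps compose_assoc)
  also have "\<dots> = adj (adj v \<cdot> v) \<cdot> (adj v \<cdot> v)"
    unfolding beta_fix[OF b] using v by (simp add: adj_simps)
  finally show ?thesis by (simp add: norm2_def)
qed

lemma eps_upper:
  assumes Q: "Q \<subseteq> A" and x: "x \<in> Q" "norm x \<le> 1"
  shows "n2 (\<alpha> t x - x) \<le> rigidity_eps \<tau> \<alpha> t Q"
  unfolding rigidity_eps_def
proof (rule cSUP_upper)
  show "bdd_above ((\<lambda>x. n2 (\<alpha> t x - x)) ` {x \<in> Q. norm x \<le> 1})"
  proof (rule bdd_aboveI2)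
    fix y assume "y \<in> {x \<in> Q. norm x \<le> 1}"
    then have y: "y \<in> A" "norm y \<le> 1" using Q by auto
    have "n2 (\<alpha> t y - y) \<le> n2 (\<alpha> t y) + n2 y" using y by (intro n2_triangle_minus) (auto simp: alpha_simps)
    also have "\<dots> \<le> 2" using y n2_le_norm[of y] by (simp add: alpha_simps)
    finally show "n2 (\<alpha> t y - y) \<le> 2" .
  qed
qed (use x in simp)

lemma eps_nonneg: "von_neumann_algebra Q \<Longrightarrow> Q \<subseteq> A \<Longrightarrow> 0 \<le> rigidity_eps \<tau> \<alpha> t Q"
  using eps_upper[of Q 0 t] vn_zero[of Q] n2_nonneg[of "\<alpha> t 0 - 0"] by (simp add: alpha_simps)

lemma intertwiner_within_eps:
  assumes Q: "von_neumann_algebra Q" "Q \<subseteq> A"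
  shows "\<exists>h\<in>intertwiners t Q \<inter> contr. n2 (h - id_blinfun) \<le> rigidity_eps \<tau> \<alpha> t Q"
proof -
  obtain h where "h \<in> A" "norm h \<le> 1" "\<forall>x\<in>Q. \<alpha> t x \<cdot> h = h \<cdot> x" "n2 (h - id_blinfun) \<le> rigidity_eps \<tau> \<alpha> t Q"
    using intertwiner_near_identity[OF alpha_aut Q eps_upper[OF Q(2)]] by blast
  then show ?thesis by (intro bexI[of _ h]) (auto simp: intertwiners_def contr_of_norm_le_1)
qed

text \<open>
  The supremum of \<open>\<parallel>v\<parallel>\<^sub>2\<^sup>2\<close> over the contractive intertwiners measures how close they come
  to being unitary. It does not drop under doubling of \<open>t\<close>: near the supremum, a Newton step cannot
  gain, so \<open>v* v\<close> is nearly a projection, and then \<open>v \<beta>(v)*\<close> has nearly the same 2-norm as \<open>v\<close>.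
\<close>

definition unitarity :: "real \<Rightarrow> ('h \<Rightarrow>\<^sub>L 'h) set \<Rightarrow> real"
  where "unitarity t Q = (SUP v\<in>intertwiners t Q \<inter> contr. (n2 v)\<^sup>2)"

lemma unitarity_upper:
  assumes "v \<in> intertwiners t Q" "v \<in> contr"
  shows "(n2 v)\<^sup>2 \<le> unitarity t Q"
  unfolding unitarity_def
proof (rule cSUP_upper)
  show "bdd_above ((\<lambda>v. (n2 v)\<^sup>2) ` (intertwiners t Q \<inter> contr))"
    by (rule bdd_aboveI2[of _ _ 1]) (auto intro!: power_le_one contr_n2 n2_nonneg)
qed (use assms in simp)

lemma unitarity_approx:
  assumes e: "0 < e"
  shows "\<exists>v\<in>intertwiners t Q \<inter> contr. unitarity t Q - e < (n2 v)\<^sup>2"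
proof (rule ccontr)
  assume neg: "\<not> ?thesis"
  have "0 \<in> intertwiners t Q \<inter> contr"
    by (auto simp: intertwiners_def intro!: contr_of_norm_le_1)
  then have "unitarity t Q \<le> unitarity t Q - e"
    using neg unfolding unitarity_def by (intro cSUP_least) (auto simp: not_less)
  with e show False by simp
qed

lemma unitarity_double:
  assumes Q: "Q \<subseteq> M" "\<And>x. x \<in> Q \<Longrightarrow> adj x \<in> Q" and comm: "commutant Q \<inter> A \<subseteq> M"
  shows "unitarity t Q \<le> unitarity (2 * t) Q"
proof (rule field_le_epsilon)
  fix e :: real assume "0 < e"
  then obtain v where v: "v \<in> intertwiners t Q" "v \<in> contr" and ve: "unitarity t Q - e / 2 < (n2 v)\<^sup>2"
    using unitarity_approx[of "e / 2" t Q] by auto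
  have QA: "Q \<subseteq> A" using Q sub by blast
  have vA: "v \<in> A" using v by simp
  have "2 * (n2 v)\<^sup>2 - (n2 (adj v \<cdot> v))\<^sup>2 \<le> (n2 (newton v))\<^sup>2"
    by (rule newton_gain[OF vA])
  also have "\<dots> \<le> unitarity t Q"
    using newton_intertwiners[OF QA Q(2) v(1)] newton_contr[OF v(2)] by (rule unitarity_upper)
  finally have "unitarity t Q \<le> (n2 (adj v \<cdot> v))\<^sup>2 + e" using ve by simp
  also have "n2 (adj v \<cdot> v) = n2 (\<alpha> t (twist v))"
    using intertwiners_quotient[OF QA Q(2) v(1) v(1)] comm vA
    by (subst n2_twist[symmetric]) (auto simp: alpha_simps twist_A)
  also have "(n2 (\<alpha> t (twist v)))\<^sup>2 \<le> unitarity (2 * t) Q"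
    using twist_intertwiners[OF Q v(1)] aut_contr[OF alpha_aut twist_contr[OF v(2)]]
    by (rule unitarity_upper)
  finally show "unitarity t Q \<le> unitarity (2 * t) Q + e" by simp
qed

lemma unitarity_ge_eps:
  assumes Q: "von_neumann_algebra Q" "Q \<subseteq> A"
  shows "1 - 2 * rigidity_eps \<tau> \<alpha> t Q \<le> unitarity t Q"
proof -
  define \<epsilon> where "\<epsilon> = rigidity_eps \<tau> \<alpha> t Q"
  obtain h where h: "h \<in> intertwiners t Q" "h \<in> contr" "n2 (h - id_blinfun) \<le> \<epsilon>"
    using intertwiner_within_eps[OF Q, of t] by (auto simp: \<epsilon>_def)
  have hA: "h \<in> A" using h by simp
  have "n2 id_blinfun \<le> n2 (id_blinfun - h) + n2 h"
    using n2_triangle[of "id_blinfun - h" h] hA by simp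
  then have 1: "1 - \<epsilon> \<le> n2 h"
    using h(3) n2_minus_commute[of h id_blinfun] hA by (simp add: n2_id)
  have "1 - 2 * \<epsilon> \<le> (n2 h)\<^sup>2"
  proof (cases "\<epsilon> \<le> 1")
    case True
    have "1 - 2 * \<epsilon> \<le> (1 - \<epsilon>)\<^sup>2" by (simp add: power2_eq_square algebra_simps)
    also have "\<dots> \<le> (n2 h)\<^sup>2" using True 1 by (intro power_mono) auto
    finally show ?thesis .
  next
    case False
    then have "1 - 2 * \<epsilon> \<le> 0" by simp
    also have "0 \<le> (n2 h)\<^sup>2" by simp
    finally show ?thesis .
  qed
  also have "\<dots> \<le> unitarity t Q" by (rule unitarity_upper[OF h(1,2)])
  finally show ?thesis by (simp add: \<epsilon>_def)
qed

text \<open>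
  Start at time \<open>t / 2\<^sup>n\<close>, where rigidity makes the averaged intertwiner close to 1, and double \<open>n\<close> times.
\<close>

theorem unitarity_rigid:
  assumes Q: "Q \<in> Rig M \<tau> \<alpha>" and comm: "commutant Q \<inter> A \<subseteq> M"
  shows "1 \<le> unitarity t Q"
proof -
  have vn: "von_neumann_algebra Q" and QM: "Q \<subseteq> M"
    and lim: "((\<lambda>t. rigidity_eps \<tau> \<alpha> t Q) \<longlongrightarrow> 0) (at 0)"
    using Q by (auto simp: Rig_def)
  have QA: "Q \<subseteq> A" using QM sub by blast
  have double: "unitarity (t / 2 ^ n) Q \<le> unitarity t Q" for n
  proof (induction n)
    case (Suc n)
    have "unitarity (t / 2 ^ Suc n) Q \<le> unitarity (2 * (t / 2 ^ Suc n)) Q"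
      by (rule unitarity_double[OF QM vn_adj[OF vn] comm])
    also have "2 * (t / 2 ^ Suc n) = t / 2 ^ n" by simp
    finally show ?case using Suc by simp
  qed simp
  show ?thesis
  proof (cases "t = 0")
    case True
    have "id_blinfun \<in> intertwiners 0 Q"
      using QA by (auto simp: intertwiners_def alpha_zero op_simps)
    moreover have "id_blinfun \<in> contr"
      unfolding contr_def by (simp add: op_simps)
    ultimately show ?thesis
      using unitarity_upper[of id_blinfun 0 Q] True by (simp add: n2_id)
  next
    case False
    have "(\<lambda>n. t * (1 / 2) ^ n) \<longlonglongrightarrow> t * 0"
      by (intro tendsto_intros LIMSEQ_power_zero) simp
    then have "filterlim (\<lambda>n. t / 2 ^ n) (at 0) sequentially"
      using False by (simp add: filterlim_at power_one_over field_simps)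
    then have "(\<lambda>n. rigidity_eps \<tau> \<alpha> (t / 2 ^ n) Q) \<longlonglongrightarrow> 0"
      by (rule filterlim_compose[OF lim])
    then have "(\<lambda>n. 1 - 2 * rigidity_eps \<tau> \<alpha> (t / 2 ^ n) Q) \<longlonglongrightarrow> 1 - 2 * 0"
      by (intro tendsto_intros)
    then have "1 - 2 * 0 \<le> unitarity t Q"
    proof (rule LIMSEQ_le_const2)
      show "\<exists>N. \<forall>n\<ge>N. 1 - 2 * rigidity_eps \<tau> \<alpha> (t / 2 ^ n) Q \<le> unitarity t Q"
        using unitarity_ge_eps[OF vn QA] double order_trans by blast
    qed
    then show ?thesis by simp
  qed
qed

corollary near_unitary_intertwiner:
  assumes Q: "Q \<in> Rig M \<tau> \<alpha>" and comm: "commutant Q \<inter> A \<subseteq> M" and d: "0 < \<delta>"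
  shows "\<exists>u\<in>intertwiners t Q \<inter> contr. n2 (id_blinfun - u \<cdot> adj u) \<le> \<delta>"
proof -
  obtain u where u: "u \<in> intertwiners t Q" "u \<in> contr" "unitarity t Q - \<delta>\<^sup>2 < (n2 u)\<^sup>2"
    using unitarity_approx[of "\<delta>\<^sup>2" t Q] d by auto
  have "(n2 (id_blinfun - u \<cdot> adj u))\<^sup>2 \<le> \<delta>\<^sup>2"
    using n2_diff_compose_adj[OF u(2)] u(3) unitarity_rigid[OF Q comm, of t] by linarith
  then have "n2 (id_blinfun - u \<cdot> adj u) \<le> \<delta>"
    by (rule power2_le_imp_le) (use d in simp)
  with u show ?thesis by blast
qed

text \<open>
  As \<open>u* h\<close> is fixed by \<open>\<beta>\<close>, the product of \<open>u \<beta>(u)*\<close> and \<open>\<beta>(h)\<close> is \<open>u u* h\<close>, which is nearly \<open>h\<close>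
  when \<open>u\<close> is nearly unitary; and both \<open>h\<close> and \<open>\<beta>(h)\<close> are close to 1.
\<close>

lemma twist_near_identity:
  assumes N: "commutant N \<inter> A \<subseteq> M" "N \<subseteq> A" "\<And>x. x \<in> N \<Longrightarrow> adj x \<in> N"
    and u: "u \<in> intertwiners t N" "u \<in> contr" and h: "h \<in> intertwiners t N" "h \<in> contr"
  shows "n2 (twist u - id_blinfun) \<le> 2 * n2 (h - id_blinfun) + n2 (id_blinfun - u \<cdot> adj u)"
proof -
  have A: "u \<in> A" "h \<in> A" "\<beta> u \<in> A" "\<beta> h \<in> A" using u h by (auto simp: beta_simps)
  have "adj u \<cdot> h = \<beta> (adj u \<cdot> h)"
    using intertwiners_quotient[OF N(2,3) u(1) h(1)] N(1) by (intro beta_fix[symmetric]) blast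
  also have "\<dots> = adj (\<beta> u) \<cdot> \<beta> h" using A by (simp add: beta_simps)
  finally have th: "twist u \<cdot> \<beta> h = u \<cdot> adj u \<cdot> h" by (simp add: twist_def compose_assoc)
  have tA: "twist u \<in> A" using A by (simp add: twist_A)
  have 1: "n2 (twist u - twist u \<cdot> \<beta> h) \<le> n2 (h - id_blinfun)"
  proof -
    have "twist u - twist u \<cdot> \<beta> h = twist u \<cdot> \<beta> (id_blinfun - h)"
      using A by (simp add: beta_simps op_simps)
    also have "n2 \<dots> \<le> n2 (\<beta> (id_blinfun - h))"
      using A u by (intro contr_left twist_contr) (auto simp: beta_simps)
    also have "\<dots> = n2 (h - id_blinfun)"
      using A n2_minus_commute[of h id_blinfun] by (simp add: aut_n2[OF beta_aut])
    finally show ?thesis .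
  qed
  have 2: "n2 (twist u \<cdot> \<beta> h - h) \<le> n2 (id_blinfun - u \<cdot> adj u)"
  proof -
    have "n2 (twist u \<cdot> \<beta> h - h) = n2 ((id_blinfun - u \<cdot> adj u) \<cdot> h)"
      unfolding th using A by (subst n2_minus_commute) (simp_all add: op_simps)
    also have "\<dots> \<le> n2 (id_blinfun - u \<cdot> adj u)"
      using A h by (intro contr_right) auto
    finally show ?thesis .
  qed
  have "n2 (twist u - id_blinfun) \<le> n2 (twist u - twist u \<cdot> \<beta> h) + n2 (twist u \<cdot> \<beta> h - id_blinfun)"
    using A tA by (intro n2_triangle_diff) auto
  also have "n2 (twist u \<cdot> \<beta> h - id_blinfun) \<le> n2 (twist u \<cdot> \<beta> h - h) + n2 (h - id_blinfun)"
    using A tA by (intro n2_triangle_diff) auto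
  finally show ?thesis using 1 2 by linarith
qed

text \<open>
  As \<open>u* v\<close> is fixed by \<open>\<beta>\<close>, one has \<open>u u* v \<beta>(v)* = u \<beta>(u)* \<beta>(v v*)\<close>. For unitaries this is the
  equality of the two twists.
\<close>

lemma twist_unique:
  assumes N: "commutant N \<inter> A \<subseteq> M" "N \<subseteq> A" "\<And>x. x \<in> N \<Longrightarrow> adj x \<in> N"
    and u: "u \<in> intertwiners t N" "u \<in> contr" and v: "v \<in> intertwiners t N" "v \<in> contr"
  shows "n2 (twist v - twist u) \<le> n2 (id_blinfun - u \<cdot> adj u) + n2 (id_blinfun - v \<cdot> adj v)"
proof -
  have A: "u \<in> A" "v \<in> A" "\<beta> u \<in> A" "\<beta> v \<in> A" using u v by (auto simp: beta_simps)
  have tA: "twist u \<in> A" "twist v \<in> A" using A by (auto simp: twist_A)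
  have "adj u \<cdot> v = \<beta> (adj u \<cdot> v)"
    using intertwiners_quotient[OF N(2,3) u(1) v(1)] N(1) by (intro beta_fix[symmetric]) blast
  also have "\<dots> = adj (\<beta> u) \<cdot> \<beta> v" using A by (simp add: beta_simps)
  finally have eq: "u \<cdot> adj u \<cdot> twist v = twist u \<cdot> \<beta> (v \<cdot> adj v)"
    using A by (simp add: twist_def beta_simps flip: compose_assoc) (simp add: compose_assoc)
  have 1: "n2 (twist v - u \<cdot> adj u \<cdot> twist v) \<le> n2 (id_blinfun - u \<cdot> adj u)"
  proof -
    have "twist v - u \<cdot> adj u \<cdot> twist v = (id_blinfun - u \<cdot> adj u) \<cdot> twist v"
      by (simp add: op_simps)
    also have "n2 \<dots> \<le> n2 (id_blinfun - u \<cdot> adj u)"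
      using A v by (intro contr_right twist_contr) auto
    finally show ?thesis .
  qed
  have 2: "n2 (u \<cdot> adj u \<cdot> twist v - twist u) \<le> n2 (id_blinfun - v \<cdot> adj v)"
  proof -
    have "n2 (u \<cdot> adj u \<cdot> twist v - twist u) = n2 (twist u \<cdot> \<beta> (id_blinfun - v \<cdot> adj v))"
      unfolding eq using A tA
      by (subst n2_minus_commute) (simp_all add: beta_simps op_simps)
    also have "\<dots> \<le> n2 (\<beta> (id_blinfun - v \<cdot> adj v))"
      using A u by (intro contr_left twist_contr) (auto simp: aut_M[OF beta_aut])
    also have "\<dots> = n2 (id_blinfun - v \<cdot> adj v)" using A by (simp add: aut_n2[OF beta_aut])
    finally show ?thesis .
  qed
  have "n2 (twist v - twist u) \<le>
      n2 (twist v - u \<cdot> adj u \<cdot> twist v) + n2 (u \<cdot> adj u \<cdot> twist v - twist u)"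
    using A tA by (intro n2_triangle_diff) auto
  with 1 2 show ?thesis by linarith
qed

section \<open>Asymptotically intertwined elements\<close>

definition asymp :: "real \<Rightarrow> (nat \<Rightarrow> 'h \<Rightarrow>\<^sub>L 'h) \<Rightarrow> ('h \<Rightarrow>\<^sub>L 'h) set"
  where "asymp t X = {x \<in> A. (\<lambda>n. n2 (\<alpha> t x \<cdot> X n - X n \<cdot> x)) \<longlonglongrightarrow> 0}"

lemma asympI:
  assumes x: "x \<in> A" and X: "\<And>n. X n \<in> A"
    and b: "b \<longlonglongrightarrow> 0" "\<And>n. n2 (\<alpha> t x \<cdot> X n - X n \<cdot> x) \<le> b n"
  shows "x \<in> asymp t X"
  unfolding asymp_def
  using x by (intro CollectI conjI tendsto_sandwich[OF _ _ tendsto_const b(1)])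
    (auto intro!: always_eventually n2_nonneg b simp: alpha_simps X)

context
  fixes X and t :: real assumes X: "\<And>n :: nat. X n \<in> contr"
begin

lemma X_A [simp]: "X n \<in> A" using X by simp

lemma asymp_add:
  assumes "x \<in> asymp t X" "y \<in> asymp t X" shows "x + y \<in> asymp t X"
proof (rule asympI)
  have A: "x \<in> A" "y \<in> A" using assms by (auto simp: asymp_def)
  then show "x + y \<in> A" by simp
  show "(\<lambda>n. n2 (\<alpha> t x \<cdot> X n - X n \<cdot> x) + n2 (\<alpha> t y \<cdot> X n - X n \<cdot> y)) \<longlonglongrightarrow> 0"
    using assms by (auto simp: asymp_def intro!: tendsto_add_zero)
  show "n2 (\<alpha> t (x + y) \<cdot> X n - X n \<cdot> (x + y)) \<le>
      n2 (\<alpha> t x \<cdot> X n - X n \<cdot> x) + n2 (\<alpha> t y \<cdot> X n - X n \<cdot> y)" for n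
  proof -
    have "\<alpha> t (x + y) \<cdot> X n - X n \<cdot> (x + y) = (\<alpha> t x \<cdot> X n - X n \<cdot> x) + (\<alpha> t y \<cdot> X n - X n \<cdot> y)"
      using A by (simp add: alpha_simps op_simps)
    also have "n2 \<dots> \<le> n2 (\<alpha> t x \<cdot> X n - X n \<cdot> x) + n2 (\<alpha> t y \<cdot> X n - X n \<cdot> y)"
      using A by (intro n2_triangle) (auto simp: alpha_simps)
    finally show ?thesis .
  qed
qed simp

lemma asymp_scaleC:
  assumes "x \<in> asymp t X" shows "a *\<^sub>C x \<in> asymp t X"
proof (rule asympI)
  have A: "x \<in> A" using assms by (auto simp: asymp_def)
  then show "a *\<^sub>C x \<in> A" by simp
  show "(\<lambda>n. cmod a * n2 (\<alpha> t x \<cdot> X n - X n \<cdot> x)) \<longlonglongrightarrow> 0"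
    using assms by (auto simp: asymp_def intro!: tendsto_mult_right_zero)
  show "n2 (\<alpha> t (a *\<^sub>C x) \<cdot> X n - X n \<cdot> (a *\<^sub>C x)) \<le> cmod a * n2 (\<alpha> t x \<cdot> X n - X n \<cdot> x)" for n
  proof -
    have "\<alpha> t (a *\<^sub>C x) \<cdot> X n - X n \<cdot> (a *\<^sub>C x) = a *\<^sub>C (\<alpha> t x \<cdot> X n - X n \<cdot> x)"
      using A by (simp add: alpha_simps compose_scaleC scaleC_diff_right)
    then show ?thesis using A by (simp add: n2_scaleC alpha_simps)
  qed
qed simp

lemma asymp_compose:
  assumes "x \<in> asymp t X" "y \<in> asymp t X" shows "x \<cdot> y \<in> asymp t X"
proof (rule asympI)
  have A: "x \<in> A" "y \<in> A" using assms by (auto simp: asymp_def)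
  then show "x \<cdot> y \<in> A" by simp
  show "(\<lambda>n. norm x * n2 (\<alpha> t y \<cdot> X n - X n \<cdot> y) + norm y * n2 (\<alpha> t x \<cdot> X n - X n \<cdot> x)) \<longlonglongrightarrow> 0"
    using assms by (auto simp: asymp_def intro!: tendsto_add_zero tendsto_mult_right_zero)
  show "n2 (\<alpha> t (x \<cdot> y) \<cdot> X n - X n \<cdot> (x \<cdot> y)) \<le>
      norm x * n2 (\<alpha> t y \<cdot> X n - X n \<cdot> y) + norm y * n2 (\<alpha> t x \<cdot> X n - X n \<cdot> x)" for n
  proof -
    have "\<alpha> t (x \<cdot> y) \<cdot> X n - X n \<cdot> (x \<cdot> y) =
        \<alpha> t x \<cdot> (\<alpha> t y \<cdot> X n - X n \<cdot> y) + (\<alpha> t x \<cdot> X n - X n \<cdot> x) \<cdot> y"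
      using A by (simp add: aut_compose[OF alpha_aut] op_simps)
    also have "n2 \<dots> \<le> n2 (\<alpha> t x \<cdot> (\<alpha> t y \<cdot> X n - X n \<cdot> y)) + n2 ((\<alpha> t x \<cdot> X n - X n \<cdot> x) \<cdot> y)"
      using A by (intro n2_triangle) (auto simp: alpha_simps)
    also have "\<dots> \<le> norm x * n2 (\<alpha> t y \<cdot> X n - X n \<cdot> y) + norm y * n2 (\<alpha> t x \<cdot> X n - X n \<cdot> x)"
      using A by (intro add_mono aut_compose_le[OF alpha_aut] n2_compose_right_le) (auto simp: alpha_simps)
    finally show ?thesis .
  qed
qed simp

text \<open>
  All maps involved are contractive for the 2-norm, uniformly in \<open>n\<close>.
\<close>

lemma asymp_closed:
  assumes x: "x \<in> A" and approx: "\<And>e. 0 < e \<Longrightarrow> \<exists>y\<in>asymp t X. n2 (x - y) < e"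
  shows "x \<in> asymp t X"
proof -
  have "(\<lambda>n. n2 (\<alpha> t x \<cdot> X n - X n \<cdot> x)) \<longlonglongrightarrow> 0"
  proof (rule LIMSEQ_I)
    fix e :: real assume e: "0 < e"
    then obtain y where y: "y \<in> A" "(\<lambda>n. n2 (\<alpha> t y \<cdot> X n - X n \<cdot> y)) \<longlonglongrightarrow> 0" "n2 (x - y) < e / 3"
      using approx[of "e / 3"] by (auto simp: asymp_def)
    from LIMSEQ_D[OF y(2), of "e / 3"] e obtain N
      where N: "\<And>n. n \<ge> N \<Longrightarrow> norm (n2 (\<alpha> t y \<cdot> X n - X n \<cdot> y) - 0) < e / 3" by auto
    have "norm (n2 (\<alpha> t x \<cdot> X n - X n \<cdot> x) - 0) < e" if n: "n \<ge> N" for n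
    proof -
      have "\<alpha> t x \<cdot> X n - X n \<cdot> x =
          \<alpha> t (x - y) \<cdot> X n + ((\<alpha> t y \<cdot> X n - X n \<cdot> y) - X n \<cdot> (x - y))"
        using x y by (simp add: alpha_simps op_simps)
      also have "n2 \<dots> \<le> n2 (\<alpha> t (x - y) \<cdot> X n) + n2 ((\<alpha> t y \<cdot> X n - X n \<cdot> y) - X n \<cdot> (x - y))"
        using x y by (intro n2_triangle) (auto simp: alpha_simps)
      also have "n2 ((\<alpha> t y \<cdot> X n - X n \<cdot> y) - X n \<cdot> (x - y)) \<le>
          n2 (\<alpha> t y \<cdot> X n - X n \<cdot> y) + n2 (X n \<cdot> (x - y))"
        using x y by (intro n2_triangle_minus) (auto simp: alpha_simps)
      also have "n2 (X n \<cdot> (x - y)) \<le> n2 (x - y)"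
        using x y by (intro contr_left X) auto
      also have "n2 (\<alpha> t (x - y) \<cdot> X n) \<le> n2 (\<alpha> t (x - y))"
        using x y by (intro contr_right X) (auto simp: aut_M[OF alpha_aut])
      also have "n2 (\<alpha> t (x - y)) = n2 (x - y)"
        using x y by (simp add: aut_n2[OF alpha_aut])
      finally have "n2 (\<alpha> t x \<cdot> X n - X n \<cdot> x) < e"
        using y(3) N[OF n] by simp
      then show ?thesis using x n2_nonneg[of "\<alpha> t x \<cdot> X n - X n \<cdot> x"] by (simp add: alpha_simps)
    qed
    then show "\<exists>N. \<forall>n\<ge>N. norm (n2 (\<alpha> t x \<cdot> X n - X n \<cdot> x) - 0) < e" by blast
  qed
  with x show ?thesis by (simp add: asymp_def)
qed

text \<open>
  A self-adjoint unital algebra which is closed for the 2-norm equals its bicommutant, by density.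
\<close>

theorem asymp_von_neumann: "von_neumann_algebra {x \<in> asymp t X. adj x \<in> asymp t X}"
  (is "von_neumann_algebra ?P")
proof -
  have PA: "?P \<subseteq> A" by (auto simp: asymp_def)
  have "id_blinfun \<in> asymp t X"
    by (simp add: asymp_def alpha_simps op_simps n2_zero)
  then have P: "star_subalgebra ?P"
    using PA unfolding star_subalgebra_def
    by (auto simp: adj_simps adj_scaleC subset_iff intro!: asymp_add asymp_compose asymp_scaleC)
  have "x \<in> ?P" if x: "x \<in> commutant (commutant ?P)" for x
  proof -
    have Pc: "?P \<subseteq> cbounded_ops" and Pa: "\<And>y. y \<in> ?P \<Longrightarrow> adj y \<in> ?P"
      using P by (auto simp: star_subalgebra_def)
    have sub: "commutant (commutant ?P) \<subseteq> A"
    proof -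
      have "commutant A \<subseteq> commutant ?P" using PA by (auto simp: commutant_def)
      then have "commutant (commutant ?P) \<subseteq> commutant (commutant A)" by (auto simp: commutant_def)
      then show ?thesis by (simp add: vn_bicommutant[OF M_vn])
    qed
    have in_asymp: "z \<in> asymp t X" if z: "z \<in> commutant (commutant ?P)" for z
    proof (rule asymp_closed)
      show zA: "z \<in> A" using z sub by blast
      fix e :: real assume "0 < e"
      from n2_density[OF P PA z zA this] show "\<exists>y\<in>asymp t X. n2 (z - y) < e" by blast
    qed
    have "adj x \<in> commutant (commutant ?P)"
      by (rule adj_commutant[OF commutant_subset_cbounded adj_commutant[OF Pc Pa] x])
    then show ?thesis using in_asymp x by blast
  qed
  moreover have "?P \<subseteq> commutant (commutant ?P)"
    using P by (auto simp: star_subalgebra_def commutant_def)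
  moreover have "\<And>x. x \<in> ?P \<Longrightarrow> adj x \<in> ?P" using P by (simp add: star_subalgebra_def)
  ultimately show ?thesis unfolding von_neumann_algebra_def by blast
qed

end

text \<open>
  The sequence \<open>X\<close> of shifted twists of almost unitary intertwiners of \<open>Q1\<close> intertwines \<open>Q1\<close>
  exactly; it intertwines \<open>Q2\<close> asymptotically, because it is asymptotically equal to the sequence \<open>Y\<close> built from \<open>Q2\<close>.
  Its distance from the identity is at most \<open>2 \<epsilon>\<close> in the limit, and that enters twice, on the left and on the
  right of \<open>x\<close>.
\<close>

theorem rigidity_join:
  assumes Q1: "Q1 \<in> Rig M \<tau> \<alpha>" and Q2: "Q2 \<in> Rig M \<tau> \<alpha>"
    and comm: "commutant (Q1 \<inter> Q2) \<inter> A \<subseteq> M"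
  shows "rigidity_eps \<tau> \<alpha> (2 * t) (Q1 \<or>\<^sub>v\<^sub>N Q2) \<le> 4 * rigidity_eps \<tau> \<alpha> t Q1"
proof -
  define \<epsilon> where "\<epsilon> = rigidity_eps \<tau> \<alpha> t Q1"
  define N where "N = Q1 \<inter> Q2"
  have vn: "von_neumann_algebra Q1" "von_neumann_algebra Q2" and QM: "Q1 \<subseteq> M" "Q2 \<subseteq> M"
    using Q1 Q2 by (auto simp: Rig_def)
  have QA: "Q1 \<subseteq> A" "Q2 \<subseteq> A" using QM sub by auto
  have N: "commutant N \<inter> A \<subseteq> M" "N \<subseteq> A" "\<And>x. x \<in> N \<Longrightarrow> adj x \<in> N"
    using comm QA vn_adj[OF vn(1)] vn_adj[OF vn(2)] by (auto simp: N_def)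
  have commQ: "commutant Q1 \<inter> A \<subseteq> M" "commutant Q2 \<inter> A \<subseteq> M"
    using comm by (auto simp: commutant_def)
  obtain h where h: "h \<in> intertwiners t Q1" "h \<in> contr" "n2 (h - id_blinfun) \<le> \<epsilon>"
    using intertwiner_within_eps[OF vn(1) QA(1), of t] by (auto simp: \<epsilon>_def)
  have IN: "intertwiners t Q1 \<subseteq> intertwiners t N" "intertwiners t Q2 \<subseteq> intertwiners t N"
    by (auto simp: N_def intro!: intertwiners_antimono)
  have "\<exists>u\<in>intertwiners t Q1 \<inter> contr. n2 (id_blinfun - u \<cdot> adj u) \<le> 1 / real (Suc n)" for n
    by (rule near_unitary_intertwiner[OF Q1 commQ(1)]) simp
  then obtain u where u: "u n \<in> intertwiners t Q1" "u n \<in> contr"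
    "n2 (id_blinfun - u n \<cdot> adj (u n)) \<le> 1 / real (Suc n)" for n by (metis IntD1 IntD2)
  have "\<exists>v\<in>intertwiners t Q2 \<inter> contr. n2 (id_blinfun - v \<cdot> adj v) \<le> 1 / real (Suc n)" for n
    by (rule near_unitary_intertwiner[OF Q2 commQ(2)]) simp
  then obtain v where v: "v n \<in> intertwiners t Q2" "v n \<in> contr"
    "n2 (id_blinfun - v n \<cdot> adj (v n)) \<le> 1 / real (Suc n)" for n by (metis IntD1 IntD2)
  define X where "X n = \<alpha> t (twist (u n))" for n
  define Y where "Y n = \<alpha> t (twist (v n))" for n
  have X: "X n \<in> contr" for n
    unfolding X_def by (intro aut_contr[OF alpha_aut] twist_contr u)
  have Yc: "Y n \<in> contr" for n
    unfolding Y_def by (intro aut_contr[OF alpha_aut] twist_contr v)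
  have XA: "X n \<in> A" and YA: "Y n \<in> A" for n using X Yc by auto
  have uA: "u n \<in> A" "v n \<in> A" for n using u v by auto
  have lim: "(\<lambda>n. 1 / real (Suc n)) \<longlonglongrightarrow> 0"
    using LIMSEQ_inverse_real_of_nat by (simp add: inverse_eq_divide)
  have X1: "n2 (X n - id_blinfun) \<le> 2 * \<epsilon> + 1 / real (Suc n)" for n
  proof -
    have "X n - id_blinfun = \<alpha> t (twist (u n) - id_blinfun)"
      using uA by (simp add: X_def alpha_simps twist_A)
    then have "n2 (X n - id_blinfun) = n2 (twist (u n) - id_blinfun)"
      using uA by (simp add: aut_n2[OF alpha_aut] twist_A)
    also have "\<dots> \<le> 2 * n2 (h - id_blinfun) + n2 (id_blinfun - u n \<cdot> adj (u n))"
      using IN u h by (intro twist_near_identity[OF N]) auto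
    finally show ?thesis using h(3) u(3)[of n] by linarith
  qed
  have XY: "n2 (X n - Y n) \<le> 2 / real (Suc n)" for n
  proof -
    have "X n - Y n = \<alpha> t (twist (u n) - twist (v n))"
      using uA by (simp add: X_def Y_def alpha_simps twist_A)
    then have "n2 (X n - Y n) = n2 (twist (u n) - twist (v n))"
      using uA by (simp add: aut_n2[OF alpha_aut] twist_A)
    also have "\<dots> \<le> n2 (id_blinfun - v n \<cdot> adj (v n)) + n2 (id_blinfun - u n \<cdot> adj (u n))"
      using IN u v by (intro twist_unique[OF N]) auto
    finally show ?thesis using u(3)[of n] v(3)[of n] by (simp add: add_divide_distrib[symmetric])
  qed
  have as1: "Q1 \<subseteq> asymp (2 * t) X"
  proof
    fix x assume x: "x \<in> Q1"
    have "\<alpha> (2 * t) x \<cdot> X n = X n \<cdot> x" for n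
      unfolding X_def by (rule intertwinersD(2)[OF twist_intertwiners[OF QM(1) vn_adj[OF vn(1)] u(1)] x])
    then show "x \<in> asymp (2 * t) X" using x QA by (auto simp: asymp_def n2_zero)
  qed
  have as2: "Q2 \<subseteq> asymp (2 * t) X"
  proof
    fix x assume x: "x \<in> Q2"
    then have xA: "x \<in> A" using QA by blast
    show "x \<in> asymp (2 * t) X"
    proof (rule asympI[OF xA XA])
      show "(\<lambda>n. 2 * norm x * 2 * (1 / real (Suc n))) \<longlonglongrightarrow> 0"
        by (rule tendsto_mult_right_zero[OF lim])
      fix n
      have "\<alpha> (2 * t) x \<cdot> Y n = Y n \<cdot> x"
        unfolding Y_def by (rule intertwinersD(2)[OF twist_intertwiners[OF QM(2) vn_adj[OF vn(2)] v(1)] x])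
      then have "\<alpha> (2 * t) x \<cdot> X n - X n \<cdot> x = \<alpha> (2 * t) x \<cdot> (X n - Y n) - (X n - Y n) \<cdot> x"
        by (simp add: op_simps)
      also have "n2 \<dots> \<le> n2 (\<alpha> (2 * t) x \<cdot> (X n - Y n)) + n2 ((X n - Y n) \<cdot> x)"
        using xA XA YA by (intro n2_triangle_minus) (auto simp: alpha_simps)
      also have "\<dots> \<le> norm x * n2 (X n - Y n) + norm x * n2 (X n - Y n)"
        using xA XA YA by (intro add_mono aut_compose_le[OF alpha_aut] n2_compose_right_le) auto
      also have "\<dots> = 2 * norm x * n2 (X n - Y n)" by simp
      also have "\<dots> \<le> 2 * norm x * (2 / real (Suc n))"
        by (intro mult_left_mono XY) auto
      finally show "n2 (\<alpha> (2 * t) x \<cdot> X n - X n \<cdot> x) \<le> 2 * norm x * 2 * (1 / real (Suc n))" by simp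
    qed
  qed
  have "Q1 \<union> Q2 \<subseteq> {x \<in> asymp (2 * t) X. adj x \<in> asymp (2 * t) X}"
    using as1 as2 vn_adj[OF vn(1)] vn_adj[OF vn(2)] by blast
  then have join: "Q1 \<or>\<^sub>v\<^sub>N Q2 \<subseteq> {x \<in> asymp (2 * t) X. adj x \<in> asymp (2 * t) X}"
    unfolding vn_join_def by (rule hull_minimal) (rule asymp_von_neumann[OF X])
  have "0 \<in> Q1 \<or>\<^sub>v\<^sub>N Q2"
    using hull_subset[of "Q1 \<union> Q2" von_neumann_algebra] vn_zero[OF vn(1)] by (auto simp: vn_join_def)
  then have ne: "{x \<in> Q1 \<or>\<^sub>v\<^sub>N Q2. norm x \<le> 1} \<noteq> {}" by force
  show ?thesis
    unfolding rigidity_eps_def[of _ _ "2 * t"]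
  proof (rule cSUP_least[OF ne])
    fix x assume "x \<in> {x \<in> Q1 \<or>\<^sub>v\<^sub>N Q2. norm x \<le> 1}"
    then have x: "x \<in> A" "norm x \<le> 1" and r: "(\<lambda>n. n2 (\<alpha> (2 * t) x \<cdot> X n - X n \<cdot> x)) \<longlonglongrightarrow> 0"
      using join by (auto simp: asymp_def)
    have "(\<lambda>n. 2 * (2 * \<epsilon> + 1 / real (Suc n)) + n2 (\<alpha> (2 * t) x \<cdot> X n - X n \<cdot> x)) \<longlonglongrightarrow> 2 * (2 * \<epsilon> + 0) + 0"
      by (intro tendsto_add tendsto_mult tendsto_const lim r)
    moreover have "n2 (\<alpha> (2 * t) x - x) \<le> 2 * (2 * \<epsilon> + 1 / real (Suc n)) + n2 (\<alpha> (2 * t) x \<cdot> X n - X n \<cdot> x)" for n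
    proof -
      have "n2 (\<alpha> (2 * t) x - x) =
          n2 ((\<alpha> (2 * t) x \<cdot> X n - X n \<cdot> x) + ((X n - id_blinfun) \<cdot> x - \<alpha> (2 * t) x \<cdot> (X n - id_blinfun)))"
        by (simp add: op_simps)
      also have "\<dots> \<le> n2 (\<alpha> (2 * t) x \<cdot> X n - X n \<cdot> x) +
          n2 ((X n - id_blinfun) \<cdot> x - \<alpha> (2 * t) x \<cdot> (X n - id_blinfun))"
        using x XA by (intro n2_triangle) (auto simp: alpha_simps)
      finally have "n2 (\<alpha> (2 * t) x - x) \<le> n2 (\<alpha> (2 * t) x \<cdot> X n - X n \<cdot> x) +
          n2 ((X n - id_blinfun) \<cdot> x - \<alpha> (2 * t) x \<cdot> (X n - id_blinfun))" .
      moreover have "n2 ((X n - id_blinfun) \<cdot> x - \<alpha> (2 * t) x \<cdot> (X n - id_blinfun)) \<le>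
          n2 ((X n - id_blinfun) \<cdot> x) + n2 (\<alpha> (2 * t) x \<cdot> (X n - id_blinfun))"
        using x XA by (intro n2_triangle_minus) (auto simp: alpha_simps)
      moreover have "n2 ((X n - id_blinfun) \<cdot> x) \<le> n2 (X n - id_blinfun)"
        using x XA by (intro contr_right contr_of_norm_le_1) auto
      moreover have "n2 (\<alpha> (2 * t) x \<cdot> (X n - id_blinfun)) \<le> n2 (X n - id_blinfun)"
        using x XA by (intro contr_left aut_contr[OF alpha_aut] contr_of_norm_le_1) auto
      ultimately have "n2 (\<alpha> (2 * t) x - x) \<le> 2 * n2 (X n - id_blinfun) + n2 (\<alpha> (2 * t) x \<cdot> X n - X n \<cdot> x)"
        by linarith
      also have "\<dots> \<le> 2 * (2 * \<epsilon> + 1 / real (Suc n)) + n2 (\<alpha> (2 * t) x \<cdot> X n - X n \<cdot> x)"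
        by (intro add_right_mono mult_left_mono X1) simp
      finally show ?thesis .
    qed
    ultimately have "n2 (\<alpha> (2 * t) x - x) \<le> 2 * (2 * \<epsilon> + 0) + 0"
      by (intro LIMSEQ_le_const) blast+
    then show "n2 (\<alpha> (2 * t) x - x) \<le> 4 * rigidity_eps \<tau> \<alpha> t Q1" by (simp add: \<epsilon>_def)
  qed
qed

end

theorem theorem1p3:
  fixes M M' Q1 Q2 :: "('h::chilbert_space \<Rightarrow>\<^sub>L 'h) set"
    and \<tau> \<tau>' :: "('h \<Rightarrow>\<^sub>L 'h) \<Rightarrow> complex"
    and \<alpha> :: "real \<Rightarrow> ('h \<Rightarrow>\<^sub>L 'h) \<Rightarrow> ('h \<Rightarrow>\<^sub>L 'h)"
    and \<beta> :: "('h \<Rightarrow>\<^sub>L 'h) \<Rightarrow> ('h \<Rightarrow>\<^sub>L 'h)"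
    and t :: real
  assumes "tracial_inclusion M \<tau> M' \<tau>'"
    and "s_malleable_deformation M M' \<tau>' \<alpha> \<beta>"
    and "Q1 \<in> Rig M \<tau>' \<alpha>"
    and "Q2 \<in> Rig M \<tau>' \<alpha>"
    and "commutant (Q1 \<inter> Q2) \<inter> M' \<subseteq> M"
  shows "rigidity_eps \<tau>' \<alpha> (2 * t) (Q1 \<or>\<^sub>v\<^sub>N Q2) \<le> 24 * rigidity_eps \<tau>' \<alpha> t Q1"
proof -
  interpret deformation M' \<tau>' M \<alpha> \<beta>
    using assms(1,2) by unfold_locales (auto simp: tracial_inclusion_def)
  have "0 \<le> rigidity_eps \<tau>' \<alpha> t Q1"
    using assms(3) sub by (intro eps_nonneg) (auto simp: Rig_def)
  with rigidity_join[OF assms(3-5), of t] show ?thesis by linarith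
qed

end
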